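(* Consider the DR-DSGD iterates $\boldsymbol{\theta}_i^t$ ($i\in[K]$) with regularization parameter $\mu$, learning rate $\eta$, mini-batch size $B$, mixing matrix $\boldsymbol{W}$ and number of iterations $T$, as defined in the context, under Assumptions 1-5 listed in the context, with all local models initiated at the same point. If $\mu\ge 1$ and if one chooses $$\eta=\frac{1}{2L+\sqrt{T/K}}\quad\text{and}\quad B=\sqrt{KT},$$ then, with $\bar{\boldsymbol{\theta}}^t=\frac1K\sum_{i=1}^K\boldsymbol{\theta}_i^t$, $$\frac{1}{T}\sum_{t=1}^T\mathbb{E}\left[\|\nabla F(\bar{\boldsymbol{\theta}}^{t})\|^2\right]=\mathcal{O}\left(\frac{1}{\sqrt{KT}}+\frac{K}{T}\right).$$
   Context: Setting. There are $K$ devices; write $[K]=\{1,\dots,K\}$. Device $i$ has a data distribution $\mathcal{D}_i$. Given a loss $\ell(\boldsymbol{\theta},\xi)$ with $\boldsymbol{\theta}\in\mathbb{R}^d$, put $f_i(\boldsymbol{\theta})=\mathbb{E}_{\xi_i\sim\mathcal{D}_i}[\ell(\boldsymbol{\theta},\xi_i)]$; $\nabla$ denotes the gradient in $\boldsymbol{\theta}$. For $\mu>0$ put $F_i(\boldsymbol{\theta})=\exp(f_i(\boldsymbol{\theta})/\mu)$ and $F=\frac1K\sum_{i=1}^KF_i$. The devices are the vertices of a connected undirected graph with edge set $\mathcal{E}$. The mixing matrix $\boldsymbol{W}=[W_{ij}]\in\mathbb{R}^{K\times K}$ is symmetric and doubly stochastic, with $W_{ij}\in[0,1]$ and $W_{ij}=0$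 whenever $i\ne j$ and $(i,j)\notin\mathcal{E}$. $\boldsymbol{J}=\frac1K\boldsymbol{1}\boldsymbol{1}^T$. $\|\cdot\|$ is the $\ell_2$-norm of a vector or the spectral norm of a matrix. $f=\mathcal{O}(g)$ means that $f$ is bounded above up to a constant factor by $g$, asymptotically. DR-DSGD. At each iteration $t=0,1,\dots$, each device $i$ (in parallel) samples a mini-batch $\{\xi_j^t\}_{j=1}^B$ of size $B$ from its data and computes, with $\boldsymbol{g}_i(\boldsymbol{\theta})=\frac1B\sum_{j=1}^B\nabla\ell(\boldsymbol{\theta},\xi_j^t)$ the mini-batch stochastic gradient and $h(\boldsymbol{\theta};\mu)=\exp\big(\frac1B\sum_{j=1}^B\ell(\boldsymbol{\theta},\xi_j^t)/\mu\big)$, the quantities $\boldsymbol{g}_i(\boldsymbol{\theta}_i^t)$ and $h(\boldsymbol{\theta}_i^t;\mu)$. It then sets $\boldsymbol{\theta}_i^{t+\frac12}=\boldsymbol{\theta}_i^t-\frac{\eta}{\mu}h(\boldsymbol{\theta}_i^t;\mu)\,\boldsymbol{g}_i(\boldsymbol{\theta}_i^t)$ and $\boldsymbol{\theta}_i^{t+1}=\sum_{j=1}^KW_{ij}\boldsymbol{\theta}_j^{t+\frac12}$. Assumptions (for all $i\in[K]$ and all $\boldsymbol{\theta},\boldsymbol{\theta}_1,\boldsymbol{\theta}_2\in\mathbb{R}^d$): 1. (Smoothness) There exist constants $L_F$ and $L_1$ such that $\|\nabla F(\boldsymbol{\theta}_1)-\nabla F(\boldsymbol{\theta}_2)\|\le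 L_F\|\boldsymbol{\theta}_1-\boldsymbol{\theta}_2\|$ and $\mathbb{E}[\|\boldsymbol{g}_i(\boldsymbol{\theta}_1)-\boldsymbol{g}_i(\boldsymbol{\theta}_2)\|]\le L_1\|\boldsymbol{\theta}_1-\boldsymbol{\theta}_2\|$. 2. (Gradient boundedness) There exists $G_1$ such that $\|\nabla f_i(\boldsymbol{\theta})\|\le G_1$. 3. (Variance boundedness) There exist positive scalars $\sigma_1,\sigma_2$ such that $\mathbb{E}[|\ell(\boldsymbol{\theta},\xi_i)-f_i(\boldsymbol{\theta})|^2]\le\sigma_1^2$ and $\mathbb{E}[\|\boldsymbol{g}_i(\boldsymbol{\theta})-\nabla f_i(\boldsymbol{\theta})\|^2]\le\sigma_2^2$. 4. (Function boundedness) $F$ is lower bounded, i.e. $F_{inf}=\inf_{\boldsymbol{\theta}\in\mathbb{R}^d}F(\boldsymbol{\theta})>-\infty$, and the functions $\ell(\cdot,\xi_i)$ are bounded, i.e. there exists $M>0$ such that $\mathbb{E}[|\ell(\boldsymbol{\theta},\xi_i)|]\le M$. 5. (Spectral norm) $\rho=\|\mathbb{E}[\boldsymbol{W}^T\boldsymbol{W}]-\boldsymbol{J}\|$ is less than $1$. Constant $L$. When $\mu\ge1$, one can find a constant $L_2$, not depending on $\mu$, such that $\mathbb{E}[|\exp(y_1)-\exp(y_2)|]\le L_2|y_1-y_2|$ for all $y_1,y_2\in\mathcal{Y}$, where $\mathcal{Y}=\{y=\ell(\boldsymbol{\theta},\xi_i)/\mu:\boldsymbol{\theta}\in\mathbb{R}^d\}$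 is the range of the functions $\ell(\boldsymbol{\theta},\xi_i)/\mu$. Then $L=\max\{L_F,L_1,L_2\}$. *)

theory Defs
  imports "HOL-Probability.Probability"
begin

definition gradient :: "('a::real_inner \<Rightarrow> real) \<Rightarrow> 'a \<Rightarrow> 'a" where
  "gradient f x = (THE D. GDERIV f x :> D)"

text \<open>The Bochner integral of a non-integrable function is 0, so a bound on an expectation
  always comes with integrability.\<close>

definition expectation_le :: "'b measure \<Rightarrow> ('b \<Rightarrow> real) \<Rightarrow> real \<Rightarrow> bool" where
  "expectation_le N X c \<longleftrightarrow> integrable N X \<and> (LINT x|N. X x) \<le> c"

text \<open>The devices are \<open>{1..K}\<close>. Vectors in \<open>\<real>\<^sup>K\<close> and \<open>K \<times> K\<close> matrices are functions on \<open>nat\<close>, of which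
  only the entries with indices in \<open>{1..K}\<close> are used, since \<open>K\<close> is not fixed.\<close>

definition spectral_norm :: "nat \<Rightarrow> (nat \<Rightarrow> nat \<Rightarrow> real) \<Rightarrow> real" where
  "spectral_norm K A =
     (SUP x\<in>{x. L2_set x {1..K} \<le> 1}. L2_set (\<lambda>i. \<Sum>j\<in>{1..K}. A i j * x j) {1..K})"

definition connected_graph :: "nat \<Rightarrow> (nat \<times> nat) set \<Rightarrow> bool" where
  "connected_graph K E \<longleftrightarrow> E \<subseteq> {1..K} \<times> {1..K} \<and> sym E \<and> (\<forall>i\<in>{1..K}. \<forall>j\<in>{1..K}. (i, j) \<in> E\<^sup>*)"

definition mixing_matrix :: "nat \<Rightarrow> (nat \<times> nat) set \<Rightarrow> (nat \<Rightarrow> nat \<Rightarrow> real) \<Rightarrow> bool" where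
  "mixing_matrix K E W \<longleftrightarrow>
     (\<forall>i\<in>{1..K}. \<forall>j\<in>{1..K}. W i j = W j i) \<and>
     (\<forall>i\<in>{1..K}. (\<Sum>j\<in>{1..K}. W i j) = 1) \<and>
     (\<forall>j\<in>{1..K}. (\<Sum>i\<in>{1..K}. W i j) = 1) \<and>
     (\<forall>i\<in>{1..K}. \<forall>j\<in>{1..K}. 0 \<le> W i j \<and> W i j \<le> 1) \<and>
     (\<forall>i\<in>{1..K}. \<forall>j\<in>{1..K}. i \<noteq> j \<and> (i, j) \<notin> E \<longrightarrow> W i j = 0)"

text \<open>\<open>W\<close> is deterministic, so the expectation of \<open>W\<^sup>T W\<close> is \<open>W\<^sup>T W\<close> itself; all entries of \<open>J\<close> are \<open>1/K\<close>.\<close>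

definition spectral_assm :: "nat \<Rightarrow> (nat \<Rightarrow> nat \<Rightarrow> real) \<Rightarrow> real \<Rightarrow> bool" where
  "spectral_assm K W \<rho> \<longleftrightarrow>
     spectral_norm K (\<lambda>i j. (\<Sum>k\<in>{1..K}. W k i * W k j) - 1 / real K) \<le> \<rho> \<and> \<rho> < 1"

definition local_risk :: "('a \<Rightarrow> 'b \<Rightarrow> real) \<Rightarrow> (nat \<Rightarrow> 'b measure) \<Rightarrow> nat \<Rightarrow> 'a \<Rightarrow> real" where
  "local_risk loss D i \<theta> = (LINT \<xi>|D i. loss \<theta> \<xi>)"

definition robust_obj :: "('a \<Rightarrow> 'b \<Rightarrow> real) \<Rightarrow> (nat \<Rightarrow> 'b measure) \<Rightarrow> nat \<Rightarrow> real \<Rightarrow> 'a \<Rightarrow> real" where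
  "robust_obj loss D K \<mu> \<theta> = 1 / real K * (\<Sum>i\<in>{1..K}. exp (local_risk loss D i \<theta> / \<mu>))"

text \<open>A mini-batch is a function \<open>x\<close> whose samples are \<open>x 1, \<dots>, x B\<close>.\<close>

definition minibatch_grad :: "('a::real_inner \<Rightarrow> 'b \<Rightarrow> real) \<Rightarrow> nat \<Rightarrow> 'a \<Rightarrow> (nat \<Rightarrow> 'b) \<Rightarrow> 'a" where
  "minibatch_grad loss B \<theta> x = (1 / real B) *\<^sub>R (\<Sum>j\<in>{1..B}. gradient (\<lambda>\<theta>. loss \<theta> (x j)) \<theta>)"

definition minibatch_exp :: "('a \<Rightarrow> 'b \<Rightarrow> real) \<Rightarrow> nat \<Rightarrow> real \<Rightarrow> 'a \<Rightarrow> (nat \<Rightarrow> 'b) \<Rightarrow> real" where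
  "minibatch_exp loss B \<mu> \<theta> x = exp (1 / real B * (\<Sum>j\<in>{1..B}. loss \<theta> (x j)) / \<mu>)"

definition minibatch_law :: "(nat \<Rightarrow> 'b measure) \<Rightarrow> nat \<Rightarrow> nat \<Rightarrow> (nat \<Rightarrow> 'b) measure" where
  "minibatch_law D B i = Pi\<^sub>M {1..B} (\<lambda>_. D i)"

text \<open>The regularity without which \<open>f\<^sub>i\<close>, its gradient and the gradient of the loss are not defined.\<close>

definition loss_model :: "('a::real_inner \<Rightarrow> 'b \<Rightarrow> real) \<Rightarrow> (nat \<Rightarrow> 'b measure) \<Rightarrow> nat \<Rightarrow> bool" where
  "loss_model loss D K \<longleftrightarrow>
     (\<forall>i\<in>{1..K}. prob_space (D i) \<and>
        (\<forall>\<theta>. integrable (D i) (loss \<theta>)) \<and>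
        (\<forall>\<theta>. \<forall>\<xi>\<in>space (D i). (\<lambda>\<theta>. loss \<theta> \<xi>) differentiable at \<theta>) \<and>
        (\<forall>\<theta>. local_risk loss D i differentiable at \<theta>))"

definition smoothness_assm ::
  "('a::real_inner \<Rightarrow> 'b \<Rightarrow> real) \<Rightarrow> (nat \<Rightarrow> 'b measure) \<Rightarrow> nat \<Rightarrow> real \<Rightarrow> nat \<Rightarrow> real \<Rightarrow> real \<Rightarrow> bool" where
  "smoothness_assm loss D K \<mu> B L\<^sub>F L\<^sub>1 \<longleftrightarrow>
     (\<forall>\<theta>\<^sub>1 \<theta>\<^sub>2. norm (gradient (robust_obj loss D K \<mu>) \<theta>\<^sub>1 - gradient (robust_obj loss D K \<mu>) \<theta>\<^sub>2)
        \<le> L\<^sub>F * norm (\<theta>\<^sub>1 - \<theta>\<^sub>2)) \<and>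
     (\<forall>i\<in>{1..K}. \<forall>\<theta>\<^sub>1 \<theta>\<^sub>2. expectation_le (minibatch_law D B i)
        (\<lambda>x. norm (minibatch_grad loss B \<theta>\<^sub>1 x - minibatch_grad loss B \<theta>\<^sub>2 x)) (L\<^sub>1 * norm (\<theta>\<^sub>1 - \<theta>\<^sub>2)))"

definition gradient_bounded_assm ::
  "('a::real_inner \<Rightarrow> 'b \<Rightarrow> real) \<Rightarrow> (nat \<Rightarrow> 'b measure) \<Rightarrow> nat \<Rightarrow> real \<Rightarrow> bool" where
  "gradient_bounded_assm loss D K G\<^sub>1 \<longleftrightarrow>
     (\<forall>i\<in>{1..K}. \<forall>\<theta>. norm (gradient (local_risk loss D i) \<theta>) \<le> G\<^sub>1)"

definition variance_assm ::
  "('a::real_inner \<Rightarrow> 'b \<Rightarrow> real) \<Rightarrow> (nat \<Rightarrow> 'b measure) \<Rightarrow> nat \<Rightarrow> nat \<Rightarrow> real \<Rightarrow> real \<Rightarrow> bool" where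
  "variance_assm loss D K B \<sigma>\<^sub>1 \<sigma>\<^sub>2 \<longleftrightarrow> 0 < \<sigma>\<^sub>1 \<and> 0 < \<sigma>\<^sub>2 \<and>
     (\<forall>i\<in>{1..K}. \<forall>\<theta>.
        expectation_le (D i) (\<lambda>\<xi>. \<bar>loss \<theta> \<xi> - local_risk loss D i \<theta>\<bar>\<^sup>2) (\<sigma>\<^sub>1\<^sup>2) \<and>
        expectation_le (minibatch_law D B i)
          (\<lambda>x. (norm (minibatch_grad loss B \<theta> x - gradient (local_risk loss D i) \<theta>))\<^sup>2) (\<sigma>\<^sub>2\<^sup>2))"

definition function_bounded_assm ::
  "('a \<Rightarrow> 'b \<Rightarrow> real) \<Rightarrow> (nat \<Rightarrow> 'b measure) \<Rightarrow> nat \<Rightarrow> real \<Rightarrow> real \<Rightarrow> bool" where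
  "function_bounded_assm loss D K \<mu> M \<longleftrightarrow>
     bdd_below (range (robust_obj loss D K \<mu>)) \<and> 0 < M \<and>
     (\<forall>i\<in>{1..K}. \<forall>\<theta>. expectation_le (D i) (\<lambda>\<xi>. \<bar>loss \<theta> \<xi>\<bar>) M)"

definition scaled_loss_range ::
  "('a \<Rightarrow> 'b \<Rightarrow> real) \<Rightarrow> (nat \<Rightarrow> 'b measure) \<Rightarrow> nat \<Rightarrow> real \<Rightarrow> real set" where
  "scaled_loss_range loss D K \<mu> = {loss \<theta> \<xi> / \<mu> | \<theta> \<xi> i. i \<in> {1..K} \<and> \<xi> \<in> space (D i)}"

definition exp_lipschitz_const ::
  "('a \<Rightarrow> 'b \<Rightarrow> real) \<Rightarrow> (nat \<Rightarrow> 'b measure) \<Rightarrow> nat \<Rightarrow> real \<Rightarrow> real \<Rightarrow> bool" where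
  "exp_lipschitz_const loss D K \<mu> L\<^sub>2 \<longleftrightarrow>
     (\<forall>y\<^sub>1\<in>scaled_loss_range loss D K \<mu>. \<forall>y\<^sub>2\<in>scaled_loss_range loss D K \<mu>.
        \<bar>exp y\<^sub>1 - exp y\<^sub>2\<bar> \<le> L\<^sub>2 * \<bar>y\<^sub>1 - y\<^sub>2\<bar>)"

text \<open>\<open>\<xi> t i j\<close> is the \<open>j\<close>-th sample of device \<open>i\<close> at iteration \<open>t\<close>.\<close>

definition iid_sampling ::
  "'w measure \<Rightarrow> (nat \<Rightarrow> nat \<Rightarrow> nat \<Rightarrow> 'w \<Rightarrow> 'b) \<Rightarrow> (nat \<Rightarrow> 'b measure) \<Rightarrow> nat \<Rightarrow> nat \<Rightarrow> bool" where
  "iid_sampling P \<xi> D K B \<longleftrightarrow> prob_space P \<and>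
     prob_space.indep_vars P (\<lambda>(t, i, j). D i) (\<lambda>(t, i, j). \<xi> t i j) (UNIV \<times> {1..K} \<times> {1..B}) \<and>
     (\<forall>t. \<forall>i\<in>{1..K}. \<forall>j\<in>{1..B}. distr P (D i) (\<xi> t i j) = D i)"

text \<open>\<open>dr_dsgd loss K W \<mu> \<eta> B \<theta>\<^sub>0 x t i\<close> is \<open>\<theta>\<^sub>i\<^sup>t\<close> on the sample path \<open>x\<close>, all devices starting at \<open>\<theta>\<^sub>0\<close>.\<close>

primrec dr_dsgd ::
  "('a::real_inner \<Rightarrow> 'b \<Rightarrow> real) \<Rightarrow> nat \<Rightarrow> (nat \<Rightarrow> nat \<Rightarrow> real) \<Rightarrow> real \<Rightarrow> real \<Rightarrow> nat \<Rightarrow> 'a \<Rightarrow>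
   (nat \<Rightarrow> nat \<Rightarrow> nat \<Rightarrow> 'b) \<Rightarrow> nat \<Rightarrow> nat \<Rightarrow> 'a" where
  "dr_dsgd loss K W \<mu> \<eta> B \<theta>\<^sub>0 x 0 = (\<lambda>i. \<theta>\<^sub>0)"
| "dr_dsgd loss K W \<mu> \<eta> B \<theta>\<^sub>0 x (Suc t) =
     (let \<theta> = dr_dsgd loss K W \<mu> \<eta> B \<theta>\<^sub>0 x t;
          \<theta>_half = (\<lambda>i. \<theta> i -
            (\<eta> / \<mu> * minibatch_exp loss B \<mu> (\<theta> i) (x t i)) *\<^sub>R minibatch_grad loss B (\<theta> i) (x t i))
      in (\<lambda>i. \<Sum>j\<in>{1..K}. W i j *\<^sub>R \<theta>_half j))"

definition dr_dsgd_mean ::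
  "('a::real_inner \<Rightarrow> 'b \<Rightarrow> real) \<Rightarrow> nat \<Rightarrow> (nat \<Rightarrow> nat \<Rightarrow> real) \<Rightarrow> real \<Rightarrow> real \<Rightarrow> nat \<Rightarrow> 'a \<Rightarrow>
   (nat \<Rightarrow> nat \<Rightarrow> nat \<Rightarrow> 'b) \<Rightarrow> nat \<Rightarrow> 'a" where
  "dr_dsgd_mean loss K W \<mu> \<eta> B \<theta>\<^sub>0 x t =
     (1 / real K) *\<^sub>R (\<Sum>i\<in>{1..K}. dr_dsgd loss K W \<mu> \<eta> B \<theta>\<^sub>0 x t i)"

end

theory Submission
  imports Defs
begin

text \<open>Two points \<open>y\<close> of the range of \<open>loss / \<mu>\<close>, one of which is at most \<open>M + 1\<close> in absolute value, show
  that \<open>exp y\<close> grows at most linearly on that range; hence \<open>loss / \<mu>\<close> is bounded above by a constant \<open>Y\<close> and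
  the weights \<open>h\<close> by \<open>exp Y\<close>. Each device thus follows an estimator \<open>h g / \<mu>\<close> of \<open>\<nabla>F\<^sub>i\<close> with bounded second
  moment and with bias \<open>O(1 / sqrt B)\<close>, because \<open>E g = \<nabla>f\<^sub>i\<close> and \<open>h - F\<^sub>i\<close> has variance \<open>O(1 / B)\<close>. The mean
  iterate performs a gradient step on \<open>F\<close> whose centred noise has variance \<open>O(1 / K)\<close>, as the devices are
  independent, and the spectral gap keeps the mean squared distance of the local models to their average of
  order \<open>\<eta>\<^sup>2\<close>. The descent lemma, telescoped from \<open>t = 1\<close> to \<open>T\<close>, bounds the average of
  \<open>E \<parallel>\<nabla>F\<parallel>\<^sup>2\<close> by a constant times \<open>1 / (\<eta> T) + \<eta>\<^sup>2 + 1 / B + \<eta> / K\<close>.\<close>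

section \<open>Gradients and differentiation under the integral sign\<close>

text \<open>The unbiasedness on which the bias estimate rests is not among the assumptions. It
  amounts to differentiating under the integral with no integrable function dominating the gradients
  locally: there are only moment bounds at each fixed model. The interchange is therefore made by
  integrating along lines, which calls for joint measurability in model and sample. Smoothness is
  assumed for \<open>F\<close> and, in the mean, for the mini-batch gradients, while the devices
  query the single \<open>F_i\<close> at different models; Lipschitz continuity of each gradient of
  \<open>F_i\<close> has to be derived from \<open>L\<^sub>1\<close> and \<open>G\<^sub>1\<close>.
  The variance bound on \<open>g\<close> concerns the whole mini-batch and does not shrink with
  \<open>B\<close>, so only the loss can make the bias small. All constants have to be found before
  \<open>K\<close>, the loss, the distributions and \<open>\<mu>\<close> are chosen, which is why
  \<open>Y\<close> depends on \<open>M\<close> and \<open>L\<^sub>2\<close> alone. The choice of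
  \<open>\<eta>\<close> does two things: \<open>2 * L\<close> in its denominator gives
  \<open>L * \<eta> \<le> 1 / 2\<close>, and the root gives
  \<open>\<eta>\<^sup>2 \<le> K / T\<close> and
  \<open>\<eta> / K \<le> 1 / sqrt (K * T)\<close>.\<close>

lemma gradient_eq:
  assumes "GDERIV f x :> D"
  shows "gradient f x = D"
  unfolding gradient_def
proof (rule the_equality)
  fix D' assume "GDERIV f x :> D'"
  with assms have "(\<lambda>h. h \<bullet> D') = (\<lambda>h. h \<bullet> D)"
    unfolding gderiv_def by (rule has_derivative_unique[rotated])
  then show "D' = D"
    by (metis vector_eq_ldot)
qed (fact assms)

text \<open>The representing vector is read off the values of the derivative on the basis. This
  existence result gives the definite description in \<open>gradient\<close> its meaning.\<close>

lemma differentiable_imp_GDERIV: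
  fixes f :: "'a::euclidean_space \<Rightarrow> real"
  assumes "f differentiable at x"
  shows "GDERIV f x :> gradient f x"
proof -
  obtain f' where f': "(f has_derivative f') (at x)"
    using assms by (auto simp: differentiable_def)
  have lin: "linear f'"
    using f' has_derivative_linear by blast
  have "f' h = h \<bullet> (\<Sum>b\<in>Basis. f' b *\<^sub>R b)" for h
  proof -
    have "f' h = f' (\<Sum>b\<in>Basis. (h \<bullet> b) *\<^sub>R b)"
      by (simp add: euclidean_representation)
    also have "\<dots> = (\<Sum>b\<in>Basis. (h \<bullet> b) * f' b)"
      by (simp add: linear_sum[OF lin] linear_cmul[OF lin])
    finally show ?thesis
      by (simp add: inner_sum_right mult.commute)
  qed
  then have "f' = (\<lambda>h. h \<bullet> (\<Sum>b\<in>Basis. f' b *\<^sub>R b))"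
    by (rule ext)
  with f' have "GDERIV f x :> (\<Sum>b\<in>Basis. f' b *\<^sub>R b)"
    unfolding gderiv_def by simp
  with gradient_eq[OF this] show ?thesis by simp
qed

lemma GDERIV_imp_DERIV_line:
  assumes "GDERIV f (x + s *\<^sub>R v) :> D"
  shows "((\<lambda>s. f (x + s *\<^sub>R v)) has_real_derivative v \<bullet> D) (at s)"
proof -
  have "((\<lambda>s. x + s *\<^sub>R v) has_derivative (\<lambda>h. h *\<^sub>R v)) (at s)"
    by (auto intro!: derivative_eq_intros)
  then have "((\<lambda>s. f (x + s *\<^sub>R v)) has_derivative (\<lambda>h. (h *\<^sub>R v) \<bullet> D)) (at s)"
    using assms unfolding gderiv_def by (rule has_derivative_compose)
  then show ?thesis
    unfolding has_field_derivative_def by (simp add: mult.commute[of _ "v \<bullet> D"])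
qed

lemma smooth_upper_bound:
  fixes f :: "'a::euclidean_space \<Rightarrow> real"
  assumes diff: "\<And>x. f differentiable at x"
    and lip: "\<And>x y. norm (gradient f x - gradient f y) \<le> L * norm (x - y)"
  shows "f y \<le> f x + gradient f x \<bullet> (y - x) + L / 2 * (norm (y - x))\<^sup>2"
proof -
  define v where "v = y - x"
  \<comment> \<open>\<open>\<phi>\<close> is the gap along the segment between \<open>f\<close> and
    the asserted quadratic majorant. The Lipschitz bound makes its derivative nonpositive, and the
    claim is \<open>\<phi> 1 \<le> \<phi> 0\<close>.\<close>
  define \<phi> where "\<phi> s = f (x + s *\<^sub>R v) - s * (v \<bullet> gradient f x) - L / 2 * s\<^sup>2 * (norm v)\<^sup>2" for s
  have "\<phi> 1 \<le> \<phi> 0"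
  proof (rule DERIV_nonpos_imp_nonincreasing[where f=\<phi> and a=0 and b=1])
    fix s :: real assume s: "0 \<le> s" "s \<le> 1"
    have "(\<phi> has_real_derivative v \<bullet> gradient f (x + s *\<^sub>R v) - v \<bullet> gradient f x - L * s * (norm v)\<^sup>2) (at s)"
    proof -
      have "((\<lambda>s. f (x + s *\<^sub>R v)) has_real_derivative v \<bullet> gradient f (x + s *\<^sub>R v)) (at s)"
        by (intro GDERIV_imp_DERIV_line differentiable_imp_GDERIV diff)
      moreover have "((\<lambda>s. s * (v \<bullet> gradient f x) + L / 2 * s\<^sup>2 * (norm v)\<^sup>2) has_real_derivative
          v \<bullet> gradient f x + L * s * (norm v)\<^sup>2) (at s)"
        by (auto intro!: derivative_eq_intros)
      ultimately show ?thesis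
        unfolding \<phi>_def[abs_def] diff_diff_eq by (rule DERIV_diff)
    qed
    moreover have "v \<bullet> gradient f (x + s *\<^sub>R v) - v \<bullet> gradient f x \<le> L * s * (norm v)\<^sup>2"
    proof -
      have "v \<bullet> gradient f (x + s *\<^sub>R v) - v \<bullet> gradient f x
          \<le> norm v * norm (gradient f (x + s *\<^sub>R v) - gradient f x)"
        by (simp add: norm_cauchy_schwarz flip: inner_diff_right)
      also have "\<dots> \<le> norm v * (L * norm ((x + s *\<^sub>R v) - x))"
        by (intro mult_left_mono lip) auto
      finally show ?thesis
        using s by (simp add: power2_eq_square mult_ac)
    qed
    ultimately show "\<exists>y. (\<phi> has_real_derivative y) (at s) \<and> y \<le> 0"
      by (metis diff_le_0_iff_le)
  qed simp_all
  then show ?thesis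
    by (simp add: \<phi>_def v_def inner_commute)
qed

text \<open>Rounding the model to a grid of mesh \<open>1 / (n + 1)\<close> leaves countably many
  models, so joint measurability reduces to measurability in the sample; continuity in the model
  lets the mesh tend to 0.\<close>

lemma borel_measurable_Caratheodory:
  fixes f :: "'a::euclidean_space \<Rightarrow> 'b \<Rightarrow> real"
  assumes meas: "\<And>\<theta>. f \<theta> \<in> borel_measurable N"
    and cont: "\<And>x. x \<in> space N \<Longrightarrow> continuous_on UNIV (\<lambda>\<theta>. f \<theta> x)"
  shows "(\<lambda>(\<theta>, x). f \<theta> x) \<in> borel_measurable (borel \<Otimes>\<^sub>M N)"
proof -
  define q :: "nat \<Rightarrow> 'a \<Rightarrow> 'a"
    where "q n \<theta> = (\<Sum>b\<in>Basis. (real_of_int \<lfloor>real (Suc n) * (\<theta> \<bullet> b)\<rfloor> / real (Suc n)) *\<^sub>R b)" for n \<theta>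
  have [measurable]: "q n \<in> borel_measurable borel" for n
    unfolding q_def by measurable
  have countable_q: "countable (range (q n))" for n
  proof (rule countable_subset)
    show "range (q n) \<subseteq> (\<lambda>g. \<Sum>b\<in>Basis. (real_of_int (g b) / real (Suc n)) *\<^sub>R b) ` (PiE Basis (\<lambda>_. UNIV :: int set))"
    proof
      fix y assume "y \<in> range (q n)"
      then obtain \<theta> where y: "y = q n \<theta>" by auto
      show "y \<in> (\<lambda>g. \<Sum>b\<in>Basis. (real_of_int (g b) / real (Suc n)) *\<^sub>R b) ` (PiE Basis (\<lambda>_. UNIV :: int set))"
        by (rule image_eqI[where x="\<lambda>b\<in>Basis. \<lfloor>real (Suc n) * (\<theta> \<bullet> b)\<rfloor>"])
           (auto simp: y q_def intro!: sum.cong)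
    qed
    show "countable ((\<lambda>g. \<Sum>b\<in>Basis. (real_of_int (g b) / real (Suc n)) *\<^sub>R b) ` (PiE Basis (\<lambda>_. UNIV :: int set)))"
      by (intro countable_image countable_PiE) auto
  qed
  have q_lim: "(\<lambda>n. q n \<theta>) \<longlonglongrightarrow> \<theta>" for \<theta>
  proof -
    have lim: "(\<lambda>n. real_of_int \<lfloor>real (Suc n) * t\<rfloor> / real (Suc n)) \<longlonglongrightarrow> t" for t :: real
    proof (rule tendsto_sandwich[where f="\<lambda>n. t - 1 / real (Suc n)" and h="\<lambda>_. t"])
      show "\<forall>\<^sub>F n in sequentially. t - 1 / real (Suc n) \<le> real_of_int \<lfloor>real (Suc n) * t\<rfloor> / real (Suc n)"
      proof (rule always_eventually, rule allI)
        fix n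
        have "real (Suc n) * t - 1 \<le> real_of_int \<lfloor>real (Suc n) * t\<rfloor>"
          by linarith
        then show "t - 1 / real (Suc n) \<le> real_of_int \<lfloor>real (Suc n) * t\<rfloor> / real (Suc n)"
          by (simp add: le_divide_eq right_diff_distrib left_diff_distrib mult.commute del: of_nat_Suc)
      qed
      show "\<forall>\<^sub>F n in sequentially. real_of_int \<lfloor>real (Suc n) * t\<rfloor> / real (Suc n) \<le> t"
        by (rule always_eventually, rule allI) (simp add: divide_le_eq mult.commute)
      have "(\<lambda>n. t - 1 / real (Suc n)) \<longlonglongrightarrow> t - 0"
        by (intro tendsto_diff tendsto_const LIMSEQ_Suc[OF lim_1_over_n])
      then show "(\<lambda>n. t - 1 / real (Suc n)) \<longlonglongrightarrow> t" by simp
    qed simp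
    have "(\<lambda>n. q n \<theta>) \<longlonglongrightarrow> (\<Sum>b\<in>Basis. (\<theta> \<bullet> b) *\<^sub>R b)"
      unfolding q_def by (intro tendsto_sum tendsto_scaleR lim tendsto_const)
    then show ?thesis by (simp add: euclidean_representation)
  qed
  show ?thesis
  proof (rule borel_measurable_LIMSEQ_metric)
    fix n
    have "(\<lambda>p. f (q n (fst p)) (snd p)) \<in> borel_measurable (borel \<Otimes>\<^sub>M N)"
    proof (rule measurable_compose_countable'[where I="range (q n)" and f="\<lambda>i p. f i (snd p)"
          and g="\<lambda>p. q n (fst p)"])
      show "(\<lambda>x. f i (snd x)) \<in> borel_measurable (borel \<Otimes>\<^sub>M N)" for i
        by (intro measurable_compose[OF measurable_snd] meas)
      show "(\<lambda>p. q n (fst p)) \<in> borel \<Otimes>\<^sub>M N \<rightarrow>\<^sub>M count_space (range (q n))"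
        unfolding measurable_count_space_eq_countable[OF countable_q]
      proof (intro conjI ballI)
        fix a assume "a \<in> range (q n)"
        have "{a} \<in> sets borel" by simp
        then show "(\<lambda>p. q n (fst p)) -` {a} \<inter> space (borel \<Otimes>\<^sub>M N) \<in> sets (borel \<Otimes>\<^sub>M N)"
          by (rule measurable_sets[rotated]) measurable
      qed (auto simp: space_pair_measure)
    qed (fact countable_q)
    then show "(\<lambda>p. f (q n (fst p)) (snd p)) \<in> borel_measurable (borel \<Otimes>\<^sub>M N)" .
  next
    fix p assume "p \<in> space ((borel :: 'a measure) \<Otimes>\<^sub>M N)"
    then have p: "snd p \<in> space N" by (auto simp: space_pair_measure)
    have "isCont (\<lambda>\<theta>. f \<theta> (snd p)) (fst p)"
      using cont[OF p] by (simp add: continuous_on_eq_continuous_at)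
    then show "(\<lambda>n. f (q n (fst p)) (snd p)) \<longlonglongrightarrow> (case p of (\<theta>, x) \<Rightarrow> f \<theta> x)"
      using isCont_tendsto_compose[OF _ q_lim] by (simp add: case_prod_beta)
  qed
qed

lemma borel_measurable_pair_differentiable:
  fixes f :: "'a::euclidean_space \<Rightarrow> 'b \<Rightarrow> real"
  assumes "\<And>\<theta>. f \<theta> \<in> borel_measurable N"
    and "\<And>\<theta> x. x \<in> space N \<Longrightarrow> (\<lambda>\<theta>. f \<theta> x) differentiable at \<theta>"
  shows "(\<lambda>(\<theta>, x). f \<theta> x) \<in> borel_measurable (borel \<Otimes>\<^sub>M N)"
  by (intro borel_measurable_Caratheodory assms differentiable_imp_continuous_on)
     (simp add: differentiable_on_def assms(2) differentiable_at_withinI)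

text \<open>A coordinate of the gradient is the limit of the difference quotients with steps
  \<open>1 / (n + 1)\<close>, each of which is jointly measurable. This works without continuity of
  the gradient in the model.\<close>

lemma borel_measurable_pair_gradient:
  fixes f :: "'a::euclidean_space \<Rightarrow> 'b \<Rightarrow> real"
  assumes meas: "\<And>\<theta>. f \<theta> \<in> borel_measurable N"
    and diff: "\<And>\<theta> x. x \<in> space N \<Longrightarrow> (\<lambda>\<theta>. f \<theta> x) differentiable at \<theta>"
  shows "(\<lambda>(\<theta>, x). gradient (\<lambda>\<theta>. f \<theta> x) \<theta>) \<in> borel_measurable (borel \<Otimes>\<^sub>M N)"
proof (subst borel_measurable_euclidean_space, rule ballI)
  fix b :: 'a assume b: "b \<in> Basis"
  have f_meas: "(\<lambda>p. f (fst p) (snd p)) \<in> borel_measurable ((borel :: 'a measure) \<Otimes>\<^sub>M N)"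
    using borel_measurable_pair_differentiable[of f N, OF assms] by (simp add: case_prod_beta')
  show "(\<lambda>p. (case p of (\<theta>, x) \<Rightarrow> gradient (\<lambda>\<theta>. f \<theta> x) \<theta>) \<bullet> b) \<in> borel_measurable (borel \<Otimes>\<^sub>M N)"
  proof (rule borel_measurable_LIMSEQ_metric)
    fix n
    have "(\<lambda>p. (fst p + (1 / real (Suc n)) *\<^sub>R b, snd p)) \<in> (borel :: 'a measure) \<Otimes>\<^sub>M N \<rightarrow>\<^sub>M borel \<Otimes>\<^sub>M N"
      by measurable
    from measurable_compose[OF this f_meas]
    have "(\<lambda>p. f (fst p + (1 / real (Suc n)) *\<^sub>R b) (snd p)) \<in> borel_measurable (borel \<Otimes>\<^sub>M N)"
      by simp
    with f_meas
    show "(\<lambda>p. (f (fst p + (1 / real (Suc n)) *\<^sub>R b) (snd p) - f (fst p) (snd p)) / (1 / real (Suc n)))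
        \<in> borel_measurable ((borel :: 'a measure) \<Otimes>\<^sub>M N)"
      by measurable
  next
    fix p assume "p \<in> space ((borel :: 'a measure) \<Otimes>\<^sub>M N)"
    then have p: "snd p \<in> space N" by (auto simp: space_pair_measure)
    have "((\<lambda>s. f (fst p + s *\<^sub>R b) (snd p)) has_real_derivative
        b \<bullet> gradient (\<lambda>\<theta>. f \<theta> (snd p)) (fst p)) (at 0)"
      using GDERIV_imp_DERIV_line[of "\<lambda>\<theta>. f \<theta> (snd p)" "fst p" 0 b]
        differentiable_imp_GDERIV[OF diff[OF p, of "fst p"]] by simp
    then have lim: "(\<lambda>h. (f (fst p + h *\<^sub>R b) (snd p) - f (fst p) (snd p)) / h) \<midarrow>0\<rightarrow>
        b \<bullet> gradient (\<lambda>\<theta>. f \<theta> (snd p)) (fst p)"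
      by (simp add: DERIV_def)
    have "filterlim (\<lambda>n. 1 / real (Suc n)) (at 0) sequentially"
      unfolding filterlim_at using LIMSEQ_Suc[OF lim_1_over_n] by auto
    from filterlim_compose[OF lim this]
    show "(\<lambda>n. (f (fst p + (1 / real (Suc n)) *\<^sub>R b) (snd p) - f (fst p) (snd p)) / (1 / real (Suc n)))
        \<longlonglongrightarrow> (case p of (\<theta>, x) \<Rightarrow> gradient (\<lambda>\<theta>. f \<theta> x) \<theta>) \<bullet> b"
      by (simp add: case_prod_beta inner_commute)
  qed
qed

lemma norm_mono_nonneg:
  fixes a b :: real
  assumes "0 \<le> a" "a \<le> b"
  shows "norm a \<le> norm b"
  using assms by simp

text \<open>In place of a dominating function there is only the uniform bound \<open>c\<close> on
  the mean norm of the gradient. So the increment of \<open>F\<close> along a line is written as the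
  integral of the mean directional derivative, by the fundamental theorem of calculus for each
  sample and Fubini; continuity of the mean gradient then recovers the derivative at 0.\<close>

lemma gradient_lebesgue_integral:
  fixes f :: "'a::euclidean_space \<Rightarrow> 'b \<Rightarrow> real"
  assumes N: "sigma_finite_measure N"
    and int_f: "\<And>\<theta>. integrable N (f \<theta>)"
    and diff: "\<And>\<theta> x. x \<in> space N \<Longrightarrow> (\<lambda>\<theta>. f \<theta> x) differentiable at \<theta>"
    and int_g: "\<And>\<theta>. integrable N (\<lambda>x. gradient (\<lambda>\<theta>. f \<theta> x) \<theta>)"
    and bound: "\<And>\<theta>. (LINT x|N. norm (gradient (\<lambda>\<theta>. f \<theta> x) \<theta>)) \<le> c"
    and cont: "continuous_on UNIV (\<lambda>\<theta>. LINT x|N. gradient (\<lambda>\<theta>. f \<theta> x) \<theta>)"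
    and diff_int: "(\<lambda>\<theta>. LINT x|N. f \<theta> x) differentiable at \<theta>"
  shows "gradient (\<lambda>\<theta>. LINT x|N. f \<theta> x) \<theta> = (LINT x|N. gradient (\<lambda>\<theta>. f \<theta> x) \<theta>)"
proof -
  interpret N: sigma_finite_measure N by (fact N)
  interpret P: pair_sigma_finite lborel N ..
  define g where "g \<theta> x = gradient (\<lambda>\<theta>. f \<theta> x) \<theta>" for \<theta> x
  define m where "m \<theta> = (LINT x|N. g \<theta> x)" for \<theta>
  define F where "F \<theta> = (LINT x|N. f \<theta> x)" for \<theta>
  have dF: "F differentiable at \<theta>"
    using diff_int by (simp add: F_def[abs_def])
  have g_meas: "(\<lambda>p. g (fst p) (snd p)) \<in> borel_measurable (borel \<Otimes>\<^sub>M N)"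
    using borel_measurable_pair_gradient[of f N] int_f diff
    by (simp add: g_def case_prod_beta' borel_measurable_integrable)
  have "v \<bullet> gradient F \<theta> = v \<bullet> m \<theta>" for v
  proof -
    define k where "k s x = v \<bullet> g (\<theta> + s *\<^sub>R v) x" for s x
    have k_meas: "(\<lambda>p. k (fst p) (snd p)) \<in> borel_measurable (lborel \<Otimes>\<^sub>M N)"
      using measurable_compose[of "\<lambda>p. (\<theta> + fst p *\<^sub>R v, snd p)" "lborel \<Otimes>\<^sub>M N"
          "borel \<Otimes>\<^sub>M N" _ borel, OF _ g_meas]
      unfolding k_def by simp
    have int_k: "integrable N (k s)" for s
      unfolding k_def g_def by (intro integrable_inner_right int_g)
    have m_line: "continuous_on UNIV (\<lambda>s. v \<bullet> m (\<theta> + s *\<^sub>R v))"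
      using cont unfolding m_def g_def
      by (intro continuous_intros continuous_on_compose2[OF cont]) auto
    have line: "F (\<theta> + u *\<^sub>R v) - F \<theta> = integral {0..u} (\<lambda>s. v \<bullet> m (\<theta> + s *\<^sub>R v))"
      if u: "0 \<le> u" for u
    proof -
      let ?k = "\<lambda>s x. indicator {0..u} s *\<^sub>R k s x"
      have meas: "(\<lambda>p. ?k (fst p) (snd p)) \<in> borel_measurable (lborel \<Otimes>\<^sub>M N)"
        using k_meas by measurable
      \<comment> \<open>Joint integrability for Fubini: for each \<open>s\<close> the mean of the
        absolute value is at most \<open>norm v * c\<close>, and \<open>s\<close> ranges over a
        bounded interval.\<close>
      have int: "integrable (lborel \<Otimes>\<^sub>M N) (\<lambda>(s, x). ?k s x)"
      proof (rule P.Fubini_integrable)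
        show "(\<lambda>(s, x). ?k s x) \<in> borel_measurable (lborel \<Otimes>\<^sub>M N)"
          using meas by (simp add: case_prod_beta')
        show "integrable lborel (\<lambda>s. LINT x|N. norm (case (s, x) of (s, x) \<Rightarrow> ?k s x))"
        proof (rule Bochner_Integration.integrable_bound)
          show "integrable lborel (\<lambda>s. indicator {0..u} s * (norm v * c) :: real)"
            by (intro integrable_mult_left integrable_real_indicator) (auto simp: emeasure_lborel_Icc_eq)
          show "(\<lambda>s. LINT x|N. norm (case (s, x) of (s, x) \<Rightarrow> ?k s x)) \<in> borel_measurable lborel"
            using meas by (intro N.borel_measurable_lebesgue_integral) (simp add: case_prod_beta')
          have "(LINT x|N. norm (?k s x)) \<le> indicator {0..u} s * (norm v * c)" for s
          proof -
            have "(LINT x|N. norm (?k s x)) = indicator {0..u} s * (LINT x|N. \<bar>k s x\<bar>)"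
              by (simp add: abs_mult)
            also have "(LINT x|N. \<bar>k s x\<bar>) \<le> (LINT x|N. norm v * norm (g (\<theta> + s *\<^sub>R v) x))"
              using int_k by (intro integral_mono integrable_mult_right integrable_norm int_g integrable_abs)
                (auto simp: k_def Cauchy_Schwarz_ineq2 g_def int_g)
            also have "\<dots> \<le> norm v * c"
              using bound by (simp add: g_def mult_left_mono)
            finally show ?thesis
              by (simp add: mult_left_mono)
          qed
          moreover have "0 \<le> (LINT x|N. norm (?k s x))" for s
            by (rule integral_nonneg_AE) simp
          ultimately have "norm (LINT x|N. norm (?k s x)) \<le> norm (indicator {0..u} s * (norm v * c) :: real)" for s
            by (intro norm_mono_nonneg)
          then
          show "AE s in lborel. norm (LINT x|N. norm (case (s, x) of (s, x) \<Rightarrow> ?k s x))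
              \<le> norm (indicator {0..u} s * (norm v * c) :: real)"
            unfolding prod.case by (rule AE_I2)
        qed
        show "AE s in lborel. integrable N (\<lambda>x. case (s, x) of (s, x) \<Rightarrow> ?k s x)"
          using int_k by (intro AE_I2) simp
      qed
      have "AE x in N. (LINT s|lborel. ?k s x) = f (\<theta> + u *\<^sub>R v) x - f \<theta> x"
        using P.AE_integrable_snd[OF int] AE_space
      proof eventually_elim
        case (elim x)
        \<comment> \<open>For the gauge integral a derivative at every point is enough, continuous
          or not. The Lebesgue integrability that Fubini provides for almost every sample identifies
          the two integrals.\<close>
        have "((\<lambda>s. k s x) has_integral f (\<theta> + u *\<^sub>R v) x - f (\<theta> + 0 *\<^sub>R v) x) {0..u}"
        proof (rule fundamental_theorem_of_calculus[OF u])
          fix s assume "s \<in> {0..u}"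
          show "((\<lambda>s. f (\<theta> + s *\<^sub>R v) x) has_vector_derivative k s x) (at s within {0..u})"
            unfolding k_def g_def
            using GDERIV_imp_DERIV_line[OF differentiable_imp_GDERIV[OF diff[OF elim(2)]]]
            by (simp add: has_real_derivative_iff_has_vector_derivative has_vector_derivative_at_within)
        qed
        moreover have "set_integrable lborel {0..u} (\<lambda>s. k s x)"
          using elim(1) by (simp add: set_integrable_def)
        ultimately show ?case
          using set_borel_integral_eq_integral(2)[of "{0..u}" "\<lambda>s. k s x"]
          by (simp add: set_lebesgue_integral_def integral_unique)
      qed
      then have "(LINT x|N. LINT s|lborel. ?k s x) = (LINT x|N. f (\<theta> + u *\<^sub>R v) x - f \<theta> x)"
        using P.integrable_snd[OF int] int_f by (intro integral_cong_AE) auto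
      also have "\<dots> = F (\<theta> + u *\<^sub>R v) - F \<theta>"
        unfolding F_def using int_f by simp
      finally have "F (\<theta> + u *\<^sub>R v) - F \<theta> = (LINT x|N. LINT s|lborel. ?k s x)" ..
      also have "\<dots> = (LINT s|lborel. LINT x|N. ?k s x)"
        using P.integral_snd[OF int] P.integral_fst[OF int] by simp
      also have "\<dots> = (LINT s:{0..u}|lborel. v \<bullet> m (\<theta> + s *\<^sub>R v))"
        unfolding set_lebesgue_integral_def k_def m_def g_def using int_g by simp
      also have "\<dots> = integral {0..u} (\<lambda>s. v \<bullet> m (\<theta> + s *\<^sub>R v))"
        by (intro set_borel_integral_eq_integral(2) borel_integrable_atLeastAtMost'
            continuous_on_subset[OF m_line]) auto
      finally show ?thesis .
    qed
    \<comment> \<open>Only \<open>u \<ge> 0\<close> has been treated, so one-sided derivatives at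
      the left end of \<open>{0..1}\<close> are compared. That is enough, since \<open>F\<close> is
      known to be differentiable at \<open>\<theta>\<close>.\<close>
    have "((\<lambda>u. integral {0..u} (\<lambda>s. v \<bullet> m (\<theta> + s *\<^sub>R v))) has_vector_derivative v \<bullet> m (\<theta> + 0 *\<^sub>R v))
        (at 0 within {0..1})"
      by (intro integral_has_vector_derivative continuous_on_subset[OF m_line]) auto
    then have "((\<lambda>u. F (\<theta> + u *\<^sub>R v) - F \<theta>) has_vector_derivative v \<bullet> m (\<theta> + 0 *\<^sub>R v)) (at 0 within {0..1})"
      by (rule has_vector_derivative_transform[rotated 2]) (auto simp: line)
    moreover have "((\<lambda>u. F (\<theta> + u *\<^sub>R v)) has_real_derivative v \<bullet> gradient F \<theta>) (at 0)"
      using GDERIV_imp_DERIV_line[of F \<theta> 0 v] differentiable_imp_GDERIV[OF dF] by simp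
    then have "((\<lambda>u. F (\<theta> + u *\<^sub>R v) - F \<theta>) has_vector_derivative v \<bullet> gradient F \<theta>) (at 0 within {0..1})"
      unfolding has_real_derivative_iff_has_vector_derivative[symmetric]
      using DERIV_diff[OF has_field_derivative_at_within DERIV_const] by fastforce
    ultimately have "v \<bullet> m (\<theta> + 0 *\<^sub>R v) = v \<bullet> gradient F \<theta>"
      by (intro vector_derivative_unique_within_closed_interval[of 0 1 0]) auto
    then show ?thesis by simp
  qed
  then have "gradient F \<theta> = m \<theta>"
    by (metis vector_eq_ldot)
  then show ?thesis
    by (simp add: F_def[abs_def] m_def g_def)
qed

section \<open>Spectral contraction and fresh mini-batches\<close>

lemma L2_set_le_spectral_norm:
  "L2_set (\<lambda>i. \<Sum>j\<in>{1..K}. A i j * x j) {1..K} \<le> spectral_norm K A * L2_set x {1..K}"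
proof -
  let ?f = "\<lambda>x. L2_set (\<lambda>i. \<Sum>j\<in>{1..K}. A i j * x j) {1..K}"
  \<comment> \<open>A supremum of reals is an upper bound only once the set is known to be bounded
    above; the sum of the absolute values of the entries serves.\<close>
  have bdd: "bdd_above (?f ` {x. L2_set x {1..K} \<le> 1})"
  proof (rule bdd_aboveI2)
    fix x assume "x \<in> {x. L2_set x {1..K} \<le> 1}"
    then have x: "\<bar>x j\<bar> \<le> 1" if "j \<in> {1..K}" for j
    proof -
      have "\<bar>x j\<bar> \<le> L2_set (\<lambda>j. \<bar>x j\<bar>) {1..K}"
        using that by (intro member_le_L2_set) auto
      also have "\<dots> \<le> 1"
        using \<open>x \<in> _\<close> by (simp add: L2_set_def)
      finally show ?thesis .
    qed
    have "?f x \<le> (\<Sum>i\<in>{1..K}. \<bar>\<Sum>j\<in>{1..K}. A i j * x j\<bar>)"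
      by (rule L2_set_le_sum_abs)
    also have "\<dots> \<le> (\<Sum>i\<in>{1..K}. \<Sum>j\<in>{1..K}. \<bar>A i j\<bar>)"
    proof (rule sum_mono)
      fix i
      have "\<bar>\<Sum>j\<in>{1..K}. A i j * x j\<bar> \<le> (\<Sum>j\<in>{1..K}. \<bar>A i j * x j\<bar>)"
        by (rule sum_abs)
      also have "\<dots> \<le> (\<Sum>j\<in>{1..K}. \<bar>A i j\<bar>)"
        using x by (intro sum_mono) (simp add: abs_mult mult_left_le)
      finally show "\<bar>\<Sum>j\<in>{1..K}. A i j * x j\<bar> \<le> (\<Sum>j\<in>{1..K}. \<bar>A i j\<bar>)" .
    qed
    finally show "?f x \<le> (\<Sum>i\<in>{1..K}. \<Sum>j\<in>{1..K}. \<bar>A i j\<bar>)" .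
  qed
  show ?thesis
  proof (cases "L2_set x {1..K} = 0")
    case True
    then have "x j = 0" if "j \<in> {1..K}" for j
      using that by (simp add: L2_set_eq_0_iff)
    then have "?f x = L2_set (\<lambda>_. 0) {1..K}"
      by (intro L2_set_cong refl sum.neutral) simp
    with True show ?thesis
      by (simp add: L2_set_def)
  next
    case False
    define r where "r = L2_set x {1..K}"
    have r: "0 < r"
      using False by (simp add: r_def less_le)
    define y where "y j = (1 / r) * x j" for j
    have "L2_set y {1..K} = 1"
      unfolding y_def using r by (subst L2_set_right_distrib[symmetric]) (auto simp: r_def)
    then have "?f y \<le> spectral_norm K A"
      unfolding spectral_norm_def by (intro cSUP_upper bdd) simp
    have "?f x = r * ?f y"
      unfolding y_def using r
      by (subst L2_set_right_distrib) (auto simp: sum_distrib_left intro!: L2_set_cong)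
    also have "\<dots> \<le> r * spectral_norm K A"
      using \<open>?f y \<le> _\<close> r by (intro mult_left_mono) auto
    finally show ?thesis
      unfolding r_def mult.commute[of "L2_set x {1..K}"] .
  qed
qed

text \<open>\<open>\<rho>\<close> is merely an upper bound of a norm, so its sign is found by
  testing on a unit vector, which exists because \<open>K\<close> is positive. The recursion for the
  consensus error multiplies inequalities by \<open>\<rho>\<close>.\<close>

lemma spectral_assm_nonneg:
  assumes "spectral_assm K W \<rho>" "1 \<le> K"
  shows "0 \<le> \<rho>"
proof -
  let ?A = "\<lambda>i j. (\<Sum>k\<in>{1..K}. W k i * W k j) - 1 / real K"
  define e where "e = (\<lambda>j::nat. if j = 1 then 1 else 0 :: real)"
  have e: "L2_set e {1..K} = 1"
    using assms(2) unfolding L2_set_def e_def by (simp add: if_distrib[of "\<lambda>x. x ^ 2"] sum.delta cong: if_cong)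
  have "0 \<le> L2_set (\<lambda>i. \<Sum>j\<in>{1..K}. ?A i j * e j) {1..K}"
    by simp
  also have "\<dots> \<le> spectral_norm K ?A * L2_set e {1..K}"
    by (rule L2_set_le_spectral_norm)
  also have "\<dots> \<le> \<rho>"
    using assms(1) unfolding spectral_assm_def e by simp
  finally show ?thesis .
qed

text \<open>On vectors with zero sum \<open>J\<close> vanishes, so the squared norm of
  \<open>W x\<close> is the quadratic form of \<open>W^T W - J\<close> at \<open>x\<close>, and
  Cauchy-Schwarz bounds it. The factor for the squares is hence \<open>\<rho>\<close> and not its
  square.\<close>

lemma spectral_contraction_real:
  fixes x :: "nat \<Rightarrow> real"
  assumes spec: "spectral_assm K W \<rho>" and x: "(\<Sum>j\<in>{1..K}. x j) = 0"
  shows "(\<Sum>i\<in>{1..K}. (\<Sum>j\<in>{1..K}. W i j * x j)\<^sup>2) \<le> \<rho> * (\<Sum>i\<in>{1..K}. (x i)\<^sup>2)"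
proof -
  let ?A = "\<lambda>i j. (\<Sum>k\<in>{1..K}. W k i * W k j) - 1 / real K"
  let ?Ax = "\<lambda>i. \<Sum>j\<in>{1..K}. ?A i j * x j"
  have "(\<Sum>k\<in>{1..K}. (\<Sum>j\<in>{1..K}. W k j * x j)\<^sup>2)
      = (\<Sum>k\<in>{1..K}. \<Sum>i\<in>{1..K}. \<Sum>j\<in>{1..K}. x i * (W k i * W k j) * x j)"
    unfolding power2_eq_square sum_product by (intro sum.cong refl) simp
  also have "\<dots> = (\<Sum>i\<in>{1..K}. \<Sum>k\<in>{1..K}. \<Sum>j\<in>{1..K}. x i * (W k i * W k j) * x j)"
    by (rule sum.swap)
  also have "\<dots> = (\<Sum>i\<in>{1..K}. \<Sum>j\<in>{1..K}. \<Sum>k\<in>{1..K}. x i * (W k i * W k j) * x j)"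
    by (intro sum.cong refl sum.swap)
  also have "\<dots> = (\<Sum>i\<in>{1..K}. x i * (\<Sum>j\<in>{1..K}. (\<Sum>k\<in>{1..K}. W k i * W k j) * x j))"
    unfolding sum_distrib_left sum_distrib_right by (intro sum.cong refl) simp
  also have "\<dots> = (\<Sum>i\<in>{1..K}. x i * ?Ax i)"
  proof (intro sum.cong refl)
    fix i
    have "?Ax i = (\<Sum>j\<in>{1..K}. (\<Sum>k\<in>{1..K}. W k i * W k j) * x j) - 1 / real K * (\<Sum>j\<in>{1..K}. x j)"
      unfolding left_diff_distrib sum_subtractf sum_distrib_left ..
    with x show "x i * (\<Sum>j\<in>{1..K}. (\<Sum>k\<in>{1..K}. W k i * W k j) * x j) = x i * ?Ax i"
      by simp
  qed
  also have "\<dots> \<le> (\<Sum>i\<in>{1..K}. \<bar>x i\<bar> * \<bar>?Ax i\<bar>)"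
    by (intro sum_mono) (subst abs_mult[symmetric], rule abs_ge_self)
  also have "\<dots> \<le> L2_set x {1..K} * L2_set ?Ax {1..K}"
    by (rule L2_set_mult_ineq)
  also have "\<dots> \<le> L2_set x {1..K} * (\<rho> * L2_set x {1..K})"
  proof (intro mult_left_mono)
    have "L2_set ?Ax {1..K} \<le> spectral_norm K ?A * L2_set x {1..K}"
      by (rule L2_set_le_spectral_norm)
    also have "\<dots> \<le> \<rho> * L2_set x {1..K}"
      using spec by (intro mult_right_mono) (auto simp: spectral_assm_def)
    finally show "L2_set ?Ax {1..K} \<le> \<rho> * L2_set x {1..K}" .
  qed simp
  also have "\<dots> = \<rho> * (L2_set x {1..K})\<^sup>2"
    by (simp add: power2_eq_square)
  also have "(L2_set x {1..K})\<^sup>2 = (\<Sum>i\<in>{1..K}. (x i)\<^sup>2)"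
    unfolding L2_set_def by (intro real_sqrt_pow2 sum_nonneg) simp
  finally show ?thesis .
qed

text \<open>\<open>W\<close> acts on the device index alone, so the real case applies to each
  coordinate separately.\<close>

lemma spectral_contraction:
  fixes v :: "nat \<Rightarrow> 'a::euclidean_space"
  assumes spec: "spectral_assm K W \<rho>" and v: "(\<Sum>j\<in>{1..K}. v j) = 0"
  shows "(\<Sum>i\<in>{1..K}. (norm (\<Sum>j\<in>{1..K}. W i j *\<^sub>R v j))\<^sup>2) \<le> \<rho> * (\<Sum>i\<in>{1..K}. (norm (v i))\<^sup>2)"
proof -
  have norm_sq: "(norm w)\<^sup>2 = (\<Sum>b\<in>Basis. (w \<bullet> b)\<^sup>2)" for w :: 'a
    unfolding power2_norm_eq_inner by (subst euclidean_inner) (simp add: power2_eq_square)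
  have "(\<Sum>i\<in>{1..K}. (norm (\<Sum>j\<in>{1..K}. W i j *\<^sub>R v j))\<^sup>2)
      = (\<Sum>b\<in>Basis. \<Sum>i\<in>{1..K}. (\<Sum>j\<in>{1..K}. W i j * (v j \<bullet> b))\<^sup>2)"
    unfolding norm_sq by (subst sum.swap) (simp add: inner_sum_left)
  also have "\<dots> \<le> (\<Sum>b\<in>Basis. \<rho> * (\<Sum>i\<in>{1..K}. (v i \<bullet> b)\<^sup>2))"
    using v by (intro sum_mono spectral_contraction_real[OF spec]) (simp flip: inner_sum_left)
  also have "\<dots> = \<rho> * (\<Sum>i\<in>{1..K}. (norm (v i))\<^sup>2)"
    unfolding norm_sq sum_distrib_left by (rule sum.swap)
  finally show ?thesis .
qed

section \<open>Expectation bounds and second moments\<close>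

lemma expectation_leI_nn_integral:
  assumes "X \<in> borel_measurable N" "\<And>x. x \<in> space N \<Longrightarrow> 0 \<le> X x" "0 \<le> c"
    and "(\<integral>\<^sup>+x. ennreal (X x) \<partial>N) \<le> ennreal c"
  shows "expectation_le N X c"
proof -
  have nn: "AE x in N. 0 \<le> X x"
    using assms(2) by (intro AE_I2)
  have int: "integrable N X"
    using assms(1) nn le_less_trans[OF assms(4) ennreal_less_top] by (simp add: integrableI_nonneg)
  with nn have "ennreal (LINT x|N. X x) \<le> ennreal c"
    using assms(4) by (simp add: nn_integral_eq_integral)
  then have "(LINT x|N. X x) \<le> c"
    using assms(3) by (simp add: ennreal_le_iff)
  with int show ?thesis
    by (simp add: expectation_le_def)
qed

lemma expectation_le_mono:
  assumes "expectation_le N Y c" "X \<in> borel_measurable N"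
    and "\<And>x. x \<in> space N \<Longrightarrow> \<bar>X x\<bar> \<le> Y x"
  shows "expectation_le N X c"
  unfolding expectation_le_def
proof
  have Y: "integrable N Y"
    using assms(1) by (simp add: expectation_le_def)
  have bound: "norm (X x) \<le> norm (Y x)" if "x \<in> space N" for x
    using assms(3)[OF that] by simp
  show int: "integrable N X"
    using bound by (intro Bochner_Integration.integrable_bound[OF Y assms(2)] AE_I2)
  have "(LINT x|N. X x) \<le> (LINT x|N. Y x)"
    using assms(3) by (intro integral_mono int Y) (simp add: abs_le_iff)
  then show "(LINT x|N. X x) \<le> c"
    using assms(1) by (simp add: expectation_le_def)
qed

lemma expectation_le_add:
  assumes "expectation_le N X a" "expectation_le N Y b"
  shows "expectation_le N (\<lambda>x. X x + Y x) (a + b)"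
  using assms by (auto simp: expectation_le_def)

lemma expectation_le_cmult:
  assumes "expectation_le N X a" "0 \<le> c"
  shows "expectation_le N (\<lambda>x. c * X x) (c * a)"
  using assms by (auto simp: expectation_le_def mult_left_mono)

lemma expectation_le_sum:
  assumes "\<And>i. i \<in> I \<Longrightarrow> expectation_le N (X i) (c i)"
  shows "expectation_le N (\<lambda>x. \<Sum>i\<in>I. X i x) (\<Sum>i\<in>I. c i)"
  using assms by (auto simp: expectation_le_def intro!: sum_mono)

lemma (in prob_space) expectation_le_const: "expectation_le M (\<lambda>_. c) c"
  by (simp add: expectation_le_def prob_space)

lemma (in prob_space) integrable_of_square:
  fixes X :: "'a \<Rightarrow> 'c::{banach, second_countable_topology}"
  assumes "X \<in> borel_measurable M" "integrable M (\<lambda>x. (norm (X x))\<^sup>2)"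
  shows "integrable M X"
proof (rule Bochner_Integration.integrable_bound[OF _ assms(1)])
  show "integrable M (\<lambda>x. 1 + (norm (X x))\<^sup>2)"
    using assms(2) by simp
  have "norm (X x) \<le> norm (1 + (norm (X x))\<^sup>2)" for x
  proof -
    have "0 \<le> (norm (X x) - 1)\<^sup>2" by simp
    then have "2 * norm (X x) \<le> (norm (X x))\<^sup>2 + 1" by (simp add: power2_diff)
    with zero_le_power2[of "norm (X x)"] show ?thesis unfolding real_norm_def by linarith
  qed
  then show "AE x in M. norm (X x) \<le> norm (1 + (norm (X x))\<^sup>2)"
    by simp
qed

lemma norm_add_square_le:
  fixes a b :: "'a::real_inner"
  shows "(norm (a + b))\<^sup>2 \<le> 2 * (norm a)\<^sup>2 + 2 * (norm b)\<^sup>2"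
proof -
  have "0 \<le> (norm (a - b))\<^sup>2" by simp
  then show ?thesis
    by (simp add: power2_norm_eq_inner inner_add_left inner_add_right inner_diff_left inner_diff_right inner_commute)
qed

lemma integrable_inner_of_square:
  fixes X Y :: "'w \<Rightarrow> 'a::euclidean_space"
  assumes "X \<in> borel_measurable M" "Y \<in> borel_measurable M"
    and "integrable M (\<lambda>x. (norm (X x))\<^sup>2)" "integrable M (\<lambda>x. (norm (Y x))\<^sup>2)"
  shows "integrable M (\<lambda>x. X x \<bullet> Y x)"
proof (rule Bochner_Integration.integrable_bound)
  show "integrable M (\<lambda>x. (norm (X x))\<^sup>2 + (norm (Y x))\<^sup>2)"
    using assms by simp
  show "(\<lambda>x. X x \<bullet> Y x) \<in> borel_measurable M"
    using assms by simp
  have "\<bar>X x \<bullet> Y x\<bar> \<le> (norm (X x))\<^sup>2 + (norm (Y x))\<^sup>2" for x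
  proof -
    have "\<bar>X x \<bullet> Y x\<bar> \<le> norm (X x) * norm (Y x)"
      by (rule Cauchy_Schwarz_ineq2)
    moreover have "2 * (norm (X x) * norm (Y x)) \<le> (norm (X x))\<^sup>2 + (norm (Y x))\<^sup>2"
      using sum_squares_bound[of "norm (X x)" "norm (Y x)"] by (simp add: mult.assoc)
    moreover have "0 \<le> norm (X x) * norm (Y x)" by simp
    ultimately show ?thesis by linarith
  qed
  then show "AE x in M. norm (X x \<bullet> Y x) \<le> norm ((norm (X x))\<^sup>2 + (norm (Y x))\<^sup>2)"
    by simp
qed

text \<open>Under the product law the centred samples are uncorrelated, so of the
  \<open>B\<^sup>2\<close> products in the expanded square only the \<open>B\<close> diagonal ones
  contribute.\<close>

lemma variance_sample_mean:
  fixes X :: "'b \<Rightarrow> real"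
  assumes D: "prob_space D" and X: "integrable D X" and B: "1 \<le> B"
    and var: "expectation_le D (\<lambda>x. (X x - m)\<^sup>2) s" and m: "m = (LINT x|D. X x)"
  shows "expectation_le (Pi\<^sub>M {1..B} (\<lambda>_. D)) (\<lambda>x. (1 / real B * (\<Sum>j\<in>{1..B}. X (x j)) - m)\<^sup>2) (s / real B)"
proof -
  interpret D: prob_space D by (fact D)
  interpret product_prob_space "\<lambda>_. D" "{1..B}" ..
  let ?N = "Pi\<^sub>M {1..B} (\<lambda>_. D)"
  define Y where "Y x = X x - m" for x
  have Y: "integrable D Y"
    unfolding Y_def using X by simp
  have Y_mean: "(LINT x|D. Y x) = 0"
    unfolding Y_def using X by (simp add: m D.prob_space)
  have Y2: "integrable D (\<lambda>x. Y x * Y x)" "(LINT x|D. Y x * Y x) \<le> s"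
    using var by (auto simp: Y_def expectation_le_def power2_eq_square)
  have pair: "integrable ?N (\<lambda>x. Y (x j) * Y (x k)) \<and>
      (LINT x|?N. Y (x j) * Y (x k)) = (if j = k then LINT x|D. Y x * Y x else 0)"
    if jk: "j \<in> {1..B}" "k \<in> {1..B}" for j k
  proof (cases "j = k")
    case True
    have distr: "distr ?N D (\<lambda>x. x k) = D"
      using jk D by (intro distr_PiM_component) auto
    have "integrable (distr ?N D (\<lambda>x. x k)) (\<lambda>x. Y x * Y x)"
      unfolding distr by (fact Y2)
    then have "integrable ?N (\<lambda>x. Y (x k) * Y (x k))"
      using jk by (subst (asm) integrable_distr_eq) (auto intro: borel_measurable_integrable Y2(1))
    moreover have "(LINT x|distr ?N D (\<lambda>x. x k). Y x * Y x) = (LINT x|?N. Y (x k) * Y (x k))"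
      using jk by (subst integral_distr) (auto intro: borel_measurable_integrable Y2(1))
    ultimately show ?thesis
      using True unfolding distr by simp
  next
    case False
    \<comment> \<open>Padding with the constant 1 turns the product of two coordinates into one over
      all of \<open>{1..B}\<close>, whose integral factorizes; the factor at \<open>j\<close> is
      zero.\<close>
    define g where "g i = (if i \<in> {j, k} then Y else (\<lambda>_. 1))" for i
    have prod: "(\<Prod>i\<in>{1..B}. g i (x i)) = Y (x j) * Y (x k)" for x
    proof -
      have "(\<Prod>i\<in>{1..B}. g i (x i)) = (\<Prod>i\<in>{j, k}. g i (x i))"
        using jk by (intro prod.mono_neutral_right) (auto simp: g_def)
      then show ?thesis
        using False by (simp add: g_def)
    qed
    have g: "integrable D (g i)" for i
      using Y by (auto simp: g_def)
    have "integrable ?N (\<lambda>x. \<Prod>i\<in>{1..B}. g i (x i))"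
      using g by (intro product_integrable_prod) auto
    moreover have "(LINT x|?N. (\<Prod>i\<in>{1..B}. g i (x i))) = (\<Prod>i\<in>{1..B}. LINT x|D. g i x)"
      using g by (intro product_integral_prod) auto
    moreover have "(\<Prod>i\<in>{1..B}. LINT x|D. g i x) = 0"
      using jk Y_mean by (intro prod_zero bexI[of _ j]) (auto simp: g_def)
    ultimately show ?thesis
      using False unfolding prod by simp
  qed
  have eq: "(1 / real B * (\<Sum>j\<in>{1..B}. X (x j)) - m)\<^sup>2
      = (\<Sum>j\<in>{1..B}. \<Sum>k\<in>{1..B}. Y (x j) * Y (x k)) / (real B)\<^sup>2" for x
  proof -
    have "1 / real B * (\<Sum>j\<in>{1..B}. X (x j)) - m = (\<Sum>j\<in>{1..B}. Y (x j)) / real B"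
      using B by (simp add: Y_def sum_subtractf diff_divide_distrib)
    then show ?thesis
      by (simp add: power_divide) (simp add: power2_eq_square sum_product)
  qed
  have "(LINT x|?N. (\<Sum>j\<in>{1..B}. \<Sum>k\<in>{1..B}. Y (x j) * Y (x k)))
      = (\<Sum>j\<in>{1..B}. \<Sum>k\<in>{1..B}. LINT x|?N. Y (x j) * Y (x k))"
    using pair by (subst Bochner_Integration.integral_sum; (intro sum.cong refl Bochner_Integration.integral_sum Bochner_Integration.integrable_sum)?) auto
  also have "\<dots> = (\<Sum>j\<in>{1..B}. \<Sum>k\<in>{1..B}. if j = k then LINT x|D. Y x * Y x else 0)"
    using pair by (intro sum.cong refl) simp
  also have "\<dots> = real B * (LINT x|D. Y x * Y x)"
    by simp
  also have "\<dots> \<le> real B * s"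
    using Y2(2) by (intro mult_left_mono) auto
  finally have "(LINT x|?N. (\<Sum>j\<in>{1..B}. \<Sum>k\<in>{1..B}. Y (x j) * Y (x k))) / (real B)\<^sup>2 \<le> real B * s / (real B)\<^sup>2"
    by (rule divide_right_mono) simp
  moreover have "real B * s / (real B)\<^sup>2 = s / real B"
    using B by (simp add: power2_eq_square)
  moreover have "integrable ?N (\<lambda>x. \<Sum>j\<in>{1..B}. \<Sum>k\<in>{1..B}. Y (x j) * Y (x k))"
    using pair by (intro Bochner_Integration.integrable_sum) blast
  ultimately show ?thesis
    unfolding expectation_le_def eq by simp
qed

section \<open>Independence of a fresh mini-batch from other samples\<close>

definition sample_space :: "(nat \<Rightarrow> 'b measure) \<Rightarrow> nat \<times> nat \<times> nat \<Rightarrow> 'b measure" where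
  "sample_space D = (\<lambda>(t, i, j). D i)"

text \<open>Restricting to \<open>A\<close> makes the values extensional, so that they are points of
  the product space over \<open>A\<close>, where independence of disjoint blocks can be
  stated.\<close>

definition samples ::
  "(nat \<Rightarrow> nat \<Rightarrow> nat \<Rightarrow> 'w \<Rightarrow> 'b) \<Rightarrow> (nat \<times> nat \<times> nat) set \<Rightarrow> 'w \<Rightarrow> nat \<times> nat \<times> nat \<Rightarrow> 'b" where
  "samples \<xi> A \<omega> = (\<lambda>(t, i, j)\<in>A. \<xi> t i j \<omega>)"

definition minibatch ::
  "(nat \<Rightarrow> nat \<Rightarrow> nat \<Rightarrow> 'w \<Rightarrow> 'b) \<Rightarrow> nat \<Rightarrow> nat \<Rightarrow> nat \<Rightarrow> 'w \<Rightarrow> nat \<Rightarrow> 'b" where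
  "minibatch \<xi> B t i \<omega> = (\<lambda>j\<in>{1..B}. \<xi> t i j \<omega>)"

lemma iid_sampling_measurable:
  assumes "iid_sampling P \<xi> D K B" "i \<in> {1..K}" "j \<in> {1..B}"
  shows "\<xi> t i j \<in> measurable P (D i)"
proof -
  interpret prob_space P using assms(1) by (simp add: iid_sampling_def)
  have "indep_vars (\<lambda>(t, i, j). D i) (\<lambda>(t, i, j). \<xi> t i j) (UNIV \<times> {1..K} \<times> {1..B})"
    using assms(1) by (simp add: iid_sampling_def)
  then have "\<forall>p\<in>UNIV \<times> {1..K} \<times> {1..B}. (case p of (t, i, j) \<Rightarrow> \<xi> t i j) \<in> measurable P (case p of (t, i, j) \<Rightarrow> D i)"
    by (simp add: indep_vars_def2)
  from bspec[OF this, of "(t, i, j)"] show ?thesis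
    using assms(2,3) by simp
qed

lemma measurable_samples:
  assumes "iid_sampling P \<xi> D K B" "A \<subseteq> UNIV \<times> {1..K} \<times> {1..B}"
  shows "samples \<xi> A \<in> measurable P (Pi\<^sub>M A (sample_space D))"
  unfolding samples_def[abs_def]
proof (rule measurable_restrict)
  fix p assume "p \<in> A"
  with assms show "(\<lambda>\<omega>. case p of (t, i, j) \<Rightarrow> \<xi> t i j \<omega>) \<in> measurable P (sample_space D p)"
    using iid_sampling_measurable[OF assms(1)] by (cases p) (auto simp: sample_space_def)
qed

lemma measurable_minibatch:
  assumes "iid_sampling P \<xi> D K B" "i \<in> {1..K}"
  shows "minibatch \<xi> B t i \<in> measurable P (minibatch_law D B i)"
  unfolding minibatch_def[abs_def] minibatch_law_def
  by (rule measurable_restrict) (use iid_sampling_measurable[OF assms] in auto)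

text \<open>\<open>A\<close> and the index block of the mini-batch are disjoint parts of an
  independent family, so the joint law is a product. The law of the block is the product of its
  marginals, and dropping the fixed \<open>t\<close> and \<open>i\<close> from the indices turns it
  into \<open>minibatch_law\<close>.\<close>

lemma distr_samples_minibatch:
  assumes iid: "iid_sampling P \<xi> D K B" and A: "A \<subseteq> UNIV \<times> {1..K} \<times> {1..B}"
    and i: "i \<in> {1..K}" and B: "1 \<le> B" and D: "\<And>i. i \<in> {1..K} \<Longrightarrow> prob_space (D i)"
    and fresh: "\<And>j. (t, i, j) \<notin> A"
  shows "distr P (Pi\<^sub>M A (sample_space D) \<Otimes>\<^sub>M minibatch_law D B i) (\<lambda>\<omega>. (samples \<xi> A \<omega>, minibatch \<xi> B t i \<omega>))
    = distr P (Pi\<^sub>M A (sample_space D)) (samples \<xi> A) \<Otimes>\<^sub>M minibatch_law D B i"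
proof -
  interpret prob_space P using iid by (simp add: iid_sampling_def)
  let ?I = "UNIV \<times> {1..K} \<times> {1..B}"
  define C where "C = (\<lambda>j. (t, i, j)) ` {1..B}"
  let ?X = "\<lambda>(t, i, j). \<xi> t i j"
  let ?r = "\<lambda>x. \<lambda>j\<in>{1..B}. x (t, i, j)"
  have C: "C \<subseteq> ?I" "C \<noteq> {}" "A \<inter> C = {}"
    using i B fresh by (auto simp: C_def)
  have ind: "indep_vars (sample_space D) ?X ?I"
    using iid by (simp add: iid_sampling_def sample_space_def)
  have samples_eq: "samples \<xi> S = (\<lambda>\<omega>. restrict (\<lambda>p. ?X p \<omega>) S)" for S
    by (auto simp: samples_def fun_eq_iff split: prod.split)
  have r: "?r \<in> measurable (Pi\<^sub>M C (sample_space D)) (minibatch_law D B i)"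
    unfolding minibatch_law_def
  proof (rule measurable_restrict)
    fix j assume "j \<in> {1..B}"
    then have "(\<lambda>x. x (t, i, j)) \<in> measurable (Pi\<^sub>M C (sample_space D)) (sample_space D (t, i, j))"
      by (intro measurable_component_singleton) (simp add: C_def)
    then show "(\<lambda>x. x (t, i, j)) \<in> measurable (Pi\<^sub>M C (sample_space D)) (D i)"
      by (simp add: sample_space_def)
  qed
  have mb: "?r \<circ> samples \<xi> C = minibatch \<xi> B t i"
    by (auto simp: fun_eq_iff samples_def minibatch_def C_def)
  have "indep_var (Pi\<^sub>M A (sample_space D)) (samples \<xi> A) (Pi\<^sub>M C (sample_space D)) (samples \<xi> C)"
    unfolding samples_eq by (rule indep_var_restrict[OF ind C(3) A C(1)])
  then have prod: "distr P (Pi\<^sub>M A (sample_space D)) (samples \<xi> A) \<Otimes>\<^sub>M distr P (Pi\<^sub>M C (sample_space D)) (samples \<xi> C)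
      = distr P (Pi\<^sub>M A (sample_space D) \<Otimes>\<^sub>M Pi\<^sub>M C (sample_space D)) (\<lambda>\<omega>. (samples \<xi> A \<omega>, samples \<xi> C \<omega>))"
    unfolding indep_var_distribution_eq by simp
  have "distr P (Pi\<^sub>M C (sample_space D)) (samples \<xi> C) = Pi\<^sub>M C (\<lambda>p. distr P (sample_space D p) (?X p))"
    unfolding samples_eq
  proof (subst indep_vars_iff_distr_eq_PiM'[symmetric])
    show "random_variable (sample_space D p) (?X p)" if "p \<in> C" for p
      using that C(1) iid_sampling_measurable[OF iid] by (auto simp: sample_space_def)
    show "indep_vars (sample_space D) ?X C"
      using ind C(1) by (rule indep_vars_subset)
  qed (use C(2) in auto)
  also have "\<dots> = Pi\<^sub>M C (sample_space D)"
    using iid C(1) by (intro PiM_cong refl) (auto simp: iid_sampling_def sample_space_def)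
  finally have law_C: "distr P (Pi\<^sub>M C (sample_space D)) (samples \<xi> C) = Pi\<^sub>M C (sample_space D)" .
  have law_eq: "minibatch_law D B i = (\<Pi>\<^sub>M j\<in>{1..B}. sample_space D (t, i, j))"
    by (simp add: minibatch_law_def sample_space_def)
  have law_r: "distr (Pi\<^sub>M C (sample_space D)) (minibatch_law D B i) ?r = minibatch_law D B i"
    unfolding law_eq
  proof (rule distr_PiM_reindex)
    show "prob_space (sample_space D p)" if "p \<in> C" for p
      using that i D by (auto simp: C_def sample_space_def)
  qed (auto simp: C_def inj_on_def)
  interpret N: prob_space "minibatch_law D B i"
    unfolding minibatch_law_def using D[OF i] by (intro prob_space_PiM)
  \<comment> \<open>Writing the first factor as its own image under the identity brings both factors
    into the form to which the rule for products of image measures applies.\<close>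
  have id: "distr (distr P (Pi\<^sub>M A (sample_space D)) (samples \<xi> A)) (Pi\<^sub>M A (sample_space D)) (\<lambda>x. x)
      = distr P (Pi\<^sub>M A (sample_space D)) (samples \<xi> A)"
    by (rule distr_id2) simp
  have "distr P (Pi\<^sub>M A (sample_space D)) (samples \<xi> A) \<Otimes>\<^sub>M minibatch_law D B i
      = distr (distr P (Pi\<^sub>M A (sample_space D)) (samples \<xi> A)) (Pi\<^sub>M A (sample_space D)) (\<lambda>x. x)
        \<Otimes>\<^sub>M distr (Pi\<^sub>M C (sample_space D)) (minibatch_law D B i) ?r"
    unfolding law_r id ..
  also have "\<dots> = distr (distr P (Pi\<^sub>M A (sample_space D)) (samples \<xi> A) \<Otimes>\<^sub>M Pi\<^sub>M C (sample_space D))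
      (Pi\<^sub>M A (sample_space D) \<Otimes>\<^sub>M minibatch_law D B i) (\<lambda>(x, y). (x, ?r y))"
  proof (rule pair_measure_distr)
    show "sigma_finite_measure (distr (Pi\<^sub>M C (sample_space D)) (minibatch_law D B i) ?r)"
      unfolding law_r by unfold_locales
  qed (simp, rule r)
  also have "\<dots> = distr P (Pi\<^sub>M A (sample_space D) \<Otimes>\<^sub>M minibatch_law D B i)
      ((\<lambda>(x, y). (x, ?r y)) \<circ> (\<lambda>\<omega>. (samples \<xi> A \<omega>, samples \<xi> C \<omega>)))"
    unfolding prod[unfolded law_C]
  proof (rule distr_distr)
    show "(\<lambda>(x, y). (x, ?r y)) \<in> Pi\<^sub>M A (sample_space D) \<Otimes>\<^sub>M Pi\<^sub>M C (sample_space D) \<rightarrow>\<^sub>M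
        Pi\<^sub>M A (sample_space D) \<Otimes>\<^sub>M minibatch_law D B i"
      unfolding case_prod_beta' by (intro measurable_Pair measurable_fst measurable_compose[OF measurable_snd r])
    show "(\<lambda>\<omega>. (samples \<xi> A \<omega>, samples \<xi> C \<omega>)) \<in> P \<rightarrow>\<^sub>M Pi\<^sub>M A (sample_space D) \<Otimes>\<^sub>M Pi\<^sub>M C (sample_space D)"
      by (intro measurable_Pair measurable_samples[OF iid] A C(1))
  qed
  also have "(\<lambda>(x, y). (x, ?r y)) \<circ> (\<lambda>\<omega>. (samples \<xi> A \<omega>, samples \<xi> C \<omega>))
      = (\<lambda>\<omega>. (samples \<xi> A \<omega>, minibatch \<xi> B t i \<omega>))"
    unfolding mb[symmetric] by (simp add: comp_def)
  finally show ?thesis ..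
qed

lemma prob_space_minibatch_law:
  "prob_space (D i) \<Longrightarrow> prob_space (minibatch_law D B i)"
  unfolding minibatch_law_def by (intro prob_space_PiM)

context
  fixes P :: "'w measure" and \<xi> :: "nat \<Rightarrow> nat \<Rightarrow> nat \<Rightarrow> 'w \<Rightarrow> 'b" and D K B A t i
    and \<tau> :: "(nat \<times> nat \<times> nat \<Rightarrow> 'b) \<Rightarrow> 'a::euclidean_space"
  assumes iid: "iid_sampling P \<xi> D K B" and A: "A \<subseteq> UNIV \<times> {1..K} \<times> {1..B}"
    and i: "i \<in> {1..K}" and B: "1 \<le> B" and D: "\<And>i. i \<in> {1..K} \<Longrightarrow> prob_space (D i)"
    and fresh: "\<And>j. (t, i, j) \<notin> A"
    and \<tau>: "\<tau> \<in> borel_measurable (Pi\<^sub>M A (sample_space D))"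
begin

text \<open>\<open>\<tau>\<close> produces the query point from samples in \<open>A\<close>, none of
  which belongs to the mini-batch. Under the product law the mini-batch can be integrated first,
  with the query point frozen, and \<open>c\<close> bounds this inner integral at every point; this
  takes the place of conditional expectation. The nonnegative integral yields integrability along
  with the bound.\<close>

lemma expectation_le_fresh_minibatch:
  fixes z :: "'a \<Rightarrow> (nat \<Rightarrow> 'b) \<Rightarrow> real"
  assumes meas: "(\<lambda>(\<theta>, y). z \<theta> y) \<in> borel_measurable (borel \<Otimes>\<^sub>M minibatch_law D B i)"
    and nonneg: "\<And>\<theta> y. 0 \<le> z \<theta> y" and c: "\<And>\<theta>. expectation_le (minibatch_law D B i) (z \<theta>) c"
  shows "expectation_le P (\<lambda>\<omega>. z (\<tau> (samples \<xi> A \<omega>)) (minibatch \<xi> B t i \<omega>)) c"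
proof (rule expectation_leI_nn_integral)
  let ?S = "Pi\<^sub>M A (sample_space D)" and ?N = "minibatch_law D B i"
  interpret P: prob_space P using iid by (simp add: iid_sampling_def)
  interpret N: prob_space ?N using D[OF i] by (rule prob_space_minibatch_law)
  interpret S: prob_space "distr P ?S (samples \<xi> A)"
    by (intro P.prob_space_distr measurable_samples[OF iid A])
  have pair: "(\<lambda>\<omega>. (samples \<xi> A \<omega>, minibatch \<xi> B t i \<omega>)) \<in> measurable P (?S \<Otimes>\<^sub>M ?N)"
    using measurable_samples[OF iid A] measurable_minibatch[OF iid i] by measurable
  have "(\<lambda>p. (\<tau> (fst p), snd p)) \<in> measurable (?S \<Otimes>\<^sub>M ?N) (borel \<Otimes>\<^sub>M ?N)"
    using \<tau> by measurable
  from measurable_compose[OF this meas]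
  have z: "(\<lambda>p. z (\<tau> (fst p)) (snd p)) \<in> borel_measurable (?S \<Otimes>\<^sub>M ?N)"
    by simp
  show "(\<lambda>\<omega>. z (\<tau> (samples \<xi> A \<omega>)) (minibatch \<xi> B t i \<omega>)) \<in> borel_measurable P"
    using measurable_compose[OF pair z] by simp
  show "0 \<le> c"
    using c[of 0] order_trans[OF integral_nonneg_AE[of "z 0" ?N, OF AE_I2]] nonneg
    by (simp add: expectation_le_def)
  have joint: "distr P (?S \<Otimes>\<^sub>M ?N) (\<lambda>\<omega>. (samples \<xi> A \<omega>, minibatch \<xi> B t i \<omega>)) = distr P ?S (samples \<xi> A) \<Otimes>\<^sub>M ?N"
    by (rule distr_samples_minibatch[OF iid A i B D fresh])
  have "(\<integral>\<^sup>+\<omega>. ennreal (z (\<tau> (samples \<xi> A \<omega>)) (minibatch \<xi> B t i \<omega>)) \<partial>P)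
      = (\<integral>\<^sup>+p. ennreal (z (\<tau> (fst p)) (snd p)) \<partial>distr P (?S \<Otimes>\<^sub>M ?N) (\<lambda>\<omega>. (samples \<xi> A \<omega>, minibatch \<xi> B t i \<omega>)))"
    using z by (subst nn_integral_distr[OF pair]) auto
  also have "\<dots> = (\<integral>\<^sup>+v. \<integral>\<^sup>+y. ennreal (z (\<tau> v) y) \<partial>?N \<partial>distr P ?S (samples \<xi> A))"
    unfolding joint
    using z by (subst N.nn_integral_fst[symmetric]) (auto cong: measurable_cong_sets)
  also have "\<dots> \<le> (\<integral>\<^sup>+v. ennreal c \<partial>distr P ?S (samples \<xi> A))"
  proof (rule nn_integral_mono)
    fix v
    have "(\<integral>\<^sup>+y. ennreal (z (\<tau> v) y) \<partial>?N) = ennreal (LINT y|?N. z (\<tau> v) y)"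
      using c nonneg by (intro nn_integral_eq_integral) (auto simp: expectation_le_def)
    also have "\<dots> \<le> ennreal c"
      using c by (intro ennreal_leI) (auto simp: expectation_le_def)
    finally show "(\<integral>\<^sup>+y. ennreal (z (\<tau> v) y) \<partial>?N) \<le> ennreal c" .
  qed
  also have "\<dots> = ennreal c"
    using S.emeasure_space_1 by simp
  finally show "(\<integral>\<^sup>+\<omega>. ennreal (z (\<tau> (samples \<xi> A \<omega>)) (minibatch \<xi> B t i \<omega>)) \<partial>P) \<le> ennreal c" .
qed (use nonneg in auto)

text \<open>With the samples in \<open>A\<close> frozen, the mini-batch contributes the inner
  product of \<open>\<alpha> v\<close> with a mean that is zero. Fubini asks for integrability
  beforehand, which comes from the two square integrabilities. \<open>\<alpha>\<close> may depend on
  everything in \<open>A\<close>, hence on more than the query point, for instance on the mini-batch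
  of another device.\<close>

lemma fresh_minibatch_orthogonal:
  fixes w :: "'a \<Rightarrow> (nat \<Rightarrow> 'b) \<Rightarrow> 'a"
  assumes meas: "(\<lambda>(\<theta>, y). w \<theta> y) \<in> borel_measurable (borel \<Otimes>\<^sub>M minibatch_law D B i)"
    and c: "\<And>\<theta>. expectation_le (minibatch_law D B i) (\<lambda>y. (norm (w \<theta> y))\<^sup>2) c"
    and centered: "\<And>\<theta>. (LINT y|minibatch_law D B i. w \<theta> y) = 0"
    and \<alpha>: "\<alpha> \<in> borel_measurable (Pi\<^sub>M A (sample_space D))"
    and \<alpha>_int: "integrable P (\<lambda>\<omega>. (norm (\<alpha> (samples \<xi> A \<omega>)))\<^sup>2)"
  shows "integrable P (\<lambda>\<omega>. \<alpha> (samples \<xi> A \<omega>) \<bullet> w (\<tau> (samples \<xi> A \<omega>)) (minibatch \<xi> B t i \<omega>))"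
    and "(LINT \<omega>|P. \<alpha> (samples \<xi> A \<omega>) \<bullet> w (\<tau> (samples \<xi> A \<omega>)) (minibatch \<xi> B t i \<omega>)) = 0"
proof -
  let ?S = "Pi\<^sub>M A (sample_space D)" and ?N = "minibatch_law D B i"
  interpret P: prob_space P using iid by (simp add: iid_sampling_def)
  interpret N: prob_space ?N using D[OF i] by (rule prob_space_minibatch_law)
  interpret S: prob_space "distr P ?S (samples \<xi> A)"
    by (intro P.prob_space_distr measurable_samples[OF iid A])
  have joint: "distr P (?S \<Otimes>\<^sub>M ?N) (\<lambda>\<omega>. (samples \<xi> A \<omega>, minibatch \<xi> B t i \<omega>)) = distr P ?S (samples \<xi> A) \<Otimes>\<^sub>M ?N"
    by (rule distr_samples_minibatch[OF iid A i B D fresh])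
  interpret SN: pair_sigma_finite "distr P ?S (samples \<xi> A)" ?N ..
  have pair: "(\<lambda>\<omega>. (samples \<xi> A \<omega>, minibatch \<xi> B t i \<omega>)) \<in> measurable P (?S \<Otimes>\<^sub>M ?N)"
    using measurable_samples[OF iid A] measurable_minibatch[OF iid i] by measurable
  have "(\<lambda>p. (\<tau> (fst p), snd p)) \<in> measurable (?S \<Otimes>\<^sub>M ?N) (borel \<Otimes>\<^sub>M ?N)"
    using \<tau> by measurable
  from measurable_compose[OF this meas]
  have w: "(\<lambda>p. w (\<tau> (fst p)) (snd p)) \<in> borel_measurable (?S \<Otimes>\<^sub>M ?N)"
    by simp
  have \<phi>: "(\<lambda>p. \<alpha> (fst p) \<bullet> w (\<tau> (fst p)) (snd p)) \<in> borel_measurable (?S \<Otimes>\<^sub>M ?N)"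
    using w \<alpha> by measurable
  have "(\<lambda>(\<theta>, y). (norm (w \<theta> y))\<^sup>2) \<in> borel_measurable (borel \<Otimes>\<^sub>M ?N)"
    using meas by (simp add: case_prod_beta')
  then have "expectation_le P (\<lambda>\<omega>. (norm (w (\<tau> (samples \<xi> A \<omega>)) (minibatch \<xi> B t i \<omega>)))\<^sup>2) c"
    by (rule expectation_le_fresh_minibatch) (auto intro: c)
  then show int: "integrable P (\<lambda>\<omega>. \<alpha> (samples \<xi> A \<omega>) \<bullet> w (\<tau> (samples \<xi> A \<omega>)) (minibatch \<xi> B t i \<omega>))"
    using measurable_compose[OF pair w] measurable_compose[OF measurable_samples[OF iid A] \<alpha>] \<alpha>_int
    by (intro integrable_inner_of_square) (auto simp: expectation_le_def)
  have int': "integrable (distr P ?S (samples \<xi> A) \<Otimes>\<^sub>M ?N) (\<lambda>p. \<alpha> (fst p) \<bullet> w (\<tau> (fst p)) (snd p))"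
    using int integrable_distr_eq[OF pair \<phi>] unfolding joint by simp
  have "(LINT \<omega>|P. \<alpha> (samples \<xi> A \<omega>) \<bullet> w (\<tau> (samples \<xi> A \<omega>)) (minibatch \<xi> B t i \<omega>))
      = (LINT p|distr P (?S \<Otimes>\<^sub>M ?N) (\<lambda>\<omega>. (samples \<xi> A \<omega>, minibatch \<xi> B t i \<omega>)). \<alpha> (fst p) \<bullet> w (\<tau> (fst p)) (snd p))"
    by (subst integral_distr[OF pair \<phi>]) simp
  also have "\<dots> = (LINT v|distr P ?S (samples \<xi> A). LINT y|?N. \<alpha> v \<bullet> w (\<tau> v) y)"
    unfolding joint
    using SN.integral_fst'[OF int'] by simp
  also have "\<dots> = 0"
  proof -
    have "integrable ?N (w \<theta>)" for \<theta>
    proof (rule N.integrable_of_square)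
      show "w \<theta> \<in> borel_measurable ?N"
        using measurable_compose[OF measurable_Pair1' meas, of \<theta>] by simp
    qed (use c in \<open>auto simp: expectation_le_def\<close>)
    then show ?thesis
      using centered by simp
  qed
  finally show "(LINT \<omega>|P. \<alpha> (samples \<xi> A \<omega>) \<bullet> w (\<tau> (samples \<xi> A \<omega>)) (minibatch \<xi> B t i \<omega>)) = 0" .
qed

end

section \<open>Decentralized SGD with a biased estimator\<close>

text \<open>With \<open>m\<close> the mean, \<open>E |X - m|^2 = E |X|^2 - |m|^2\<close>. Both
  conclusions follow because neither \<open>E |X - m|^2\<close> nor \<open>|m|^2\<close> is
  negative.\<close>

lemma (in prob_space) second_moment_centered:
  fixes X :: "'a \<Rightarrow> 'c::euclidean_space"
  assumes X: "X \<in> borel_measurable M" and s: "expectation_le M (\<lambda>x. (norm (X x))\<^sup>2) s"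
  shows "expectation_le M (\<lambda>x. (norm (X x - expectation X))\<^sup>2) s"
    and "(norm (expectation X))\<^sup>2 \<le> s"
proof -
  let ?m = "expectation X"
  have X2: "integrable M (\<lambda>x. (norm (X x))\<^sup>2)"
    using s by (simp add: expectation_le_def)
  have int: "integrable M X"
    using X X2 by (rule integrable_of_square)
  have eq: "(norm (X x - ?m))\<^sup>2 = (norm (X x))\<^sup>2 - 2 * (X x \<bullet> ?m) + (norm ?m)\<^sup>2" for x
    by (simp add: power2_norm_eq_inner inner_diff_left inner_diff_right inner_commute)
  have int2: "integrable M (\<lambda>x. (norm (X x - ?m))\<^sup>2)"
    unfolding eq using int X2 by simp
  have "expectation (\<lambda>x. (norm (X x - ?m))\<^sup>2) = expectation (\<lambda>x. (norm (X x))\<^sup>2) - (norm ?m)\<^sup>2"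
    unfolding eq using int X2 by (simp add: prob_space power2_norm_eq_inner)
  moreover have "0 \<le> expectation (\<lambda>x. (norm (X x - ?m))\<^sup>2)"
    by (rule integral_nonneg_AE) simp
  ultimately show "(norm ?m)\<^sup>2 \<le> s" "expectation_le M (\<lambda>x. (norm (X x - ?m))\<^sup>2) s"
    using s int2 zero_le_power2[of "norm ?m"] unfolding expectation_le_def by linarith+
qed

text \<open>The same variance identity, for the uniform distribution on the devices.\<close>

lemma sum_square_deviation_le:
  fixes v :: "nat \<Rightarrow> 'a::real_inner"
  assumes "1 \<le> K"
  shows "(\<Sum>i\<in>{1..K}. (norm (v i - (1 / real K) *\<^sub>R (\<Sum>j\<in>{1..K}. v j)))\<^sup>2) \<le> (\<Sum>i\<in>{1..K}. (norm (v i))\<^sup>2)"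
proof -
  define m where "m = (1 / real K) *\<^sub>R (\<Sum>j\<in>{1..K}. v j)"
  have m: "(\<Sum>j\<in>{1..K}. v j) = real K *\<^sub>R m"
    using assms by (simp add: m_def)
  have "(\<Sum>i\<in>{1..K}. (norm (v i - m))\<^sup>2) = (\<Sum>i\<in>{1..K}. (norm (v i))\<^sup>2 - 2 * (v i \<bullet> m) + (norm m)\<^sup>2)"
    by (intro sum.cong refl)
       (simp add: power2_norm_eq_inner inner_diff_left inner_diff_right inner_commute)
  also have "\<dots> = (\<Sum>i\<in>{1..K}. (norm (v i))\<^sup>2) - 2 * ((\<Sum>i\<in>{1..K}. v i) \<bullet> m) + real K * (norm m)\<^sup>2"
    by (simp add: sum.distrib sum_subtractf inner_sum_left sum_distrib_left)
  also have "\<dots> = (\<Sum>i\<in>{1..K}. (norm (v i))\<^sup>2) - real K * (norm m)\<^sup>2"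
    unfolding m by (simp add: power2_norm_eq_inner)
  also have "\<dots> \<le> (\<Sum>i\<in>{1..K}. (norm (v i))\<^sup>2)"
    by simp
  finally show ?thesis
    unfolding m_def .
qed

lemma square_mean_le:
  fixes a :: "nat \<Rightarrow> real"
  shows "(1 / real K * (\<Sum>i\<in>{1..K}. a i))\<^sup>2 \<le> 1 / real K * (\<Sum>i\<in>{1..K}. (a i)\<^sup>2)"
proof (cases "K = 0")
  case False
  have "(\<Sum>i\<in>{1..K}. a i)\<^sup>2 \<le> (\<Sum>i\<in>{1..K}. (a i)\<^sup>2) * real K"
    using Cauchy_Schwarz_ineq_sum[of a "\<lambda>_. 1" "{1..K}"] by simp
  then have "(\<Sum>i\<in>{1..K}. a i)\<^sup>2 / (real K)\<^sup>2 \<le> (\<Sum>i\<in>{1..K}. (a i)\<^sup>2) * real K / (real K)\<^sup>2"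
    by (rule divide_right_mono) simp
  then show ?thesis
    using False by (simp add: power2_eq_square)
qed simp

text \<open>Young's inequality with a free weight: a small \<open>a\<close> keeps the factor of
  \<open>x\<close> near 1 at the expense of \<open>y\<close>, so that a contraction applied to
  \<open>x\<close> survives the splitting.\<close>

lemma norm_add_square_weighted:
  fixes x y :: "'a::real_inner"
  assumes "0 < a"
  shows "(norm (x + y))\<^sup>2 \<le> (1 + a) * (norm x)\<^sup>2 + (1 + 1 / a) * (norm y)\<^sup>2"
proof -
  have "2 * (x \<bullet> y) \<le> 2 * (norm x * norm y)"
    using norm_cauchy_schwarz by simp
  also have "\<dots> = 2 * (sqrt a * norm x) * (norm y / sqrt a)"
    using assms by simp
  also have "\<dots> \<le> (sqrt a * norm x)\<^sup>2 + (norm y / sqrt a)\<^sup>2"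
    by (rule sum_squares_bound)
  also have "\<dots> = a * (norm x)\<^sup>2 + 1 / a * (norm y)\<^sup>2"
    using assms by (simp add: power_mult_distrib power_divide)
  finally show ?thesis
    by (simp add: power2_norm_eq_inner inner_add_left inner_add_right inner_commute algebra_simps)
qed

text \<open>The local models at iteration \<open>t\<close> are functions of these samples alone; the
  mini-batches of iteration \<open>t\<close> itself lie outside and are therefore fresh.\<close>

definition past :: "nat \<Rightarrow> nat \<Rightarrow> nat \<Rightarrow> (nat \<times> nat \<times> nat) set" where
  "past K B t = {..<t} \<times> {1..K} \<times> {1..B}"

text \<open>Decentralized SGD with a biased gradient estimator: \<open>z i \<theta> y\<close> is the answer of device \<open>i\<close> at \<open>\<theta>\<close>
  on the mini-batch \<open>y\<close>, and \<open>\<beta>\<close> bounds its bias as an estimator of \<open>\<Phi> i \<theta>\<close>.\<close>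

locale decentralized_sgd =
  fixes P :: "'w measure" and \<xi> :: "nat \<Rightarrow> nat \<Rightarrow> nat \<Rightarrow> 'w \<Rightarrow> 'b" and D :: "nat \<Rightarrow> 'b measure"
    and K B :: nat and E and W :: "nat \<Rightarrow> nat \<Rightarrow> real" and \<rho> \<eta> :: real
    and z :: "nat \<Rightarrow> 'a::euclidean_space \<Rightarrow> (nat \<Rightarrow> 'b) \<Rightarrow> 'a" and \<theta>\<^sub>0 :: 'a
    and F :: "'a \<Rightarrow> real" and \<Phi> :: "nat \<Rightarrow> 'a \<Rightarrow> 'a" and L s \<beta> \<Lambda> H G :: real
  assumes iid: "iid_sampling P \<xi> D K B"
    and K: "1 \<le> K" and B: "1 \<le> B"
    and D: "\<And>i. i \<in> {1..K} \<Longrightarrow> prob_space (D i)"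
    and W: "mixing_matrix K E W" and spec: "spectral_assm K W \<rho>"
    and z_meas: "\<And>i. i \<in> {1..K} \<Longrightarrow> (\<lambda>(\<theta>, y). z i \<theta> y) \<in> borel_measurable (borel \<Otimes>\<^sub>M minibatch_law D B i)"
    and z_square: "\<And>i \<theta>. i \<in> {1..K} \<Longrightarrow> expectation_le (minibatch_law D B i) (\<lambda>y. (norm (z i \<theta> y))\<^sup>2) s"
    and bias: "\<And>i \<theta>. i \<in> {1..K} \<Longrightarrow> norm ((LINT y|minibatch_law D B i. z i \<theta> y) - \<Phi> i \<theta>) \<le> \<beta>"
    and \<Phi>_lipschitz: "\<And>i \<theta> \<theta>'. i \<in> {1..K} \<Longrightarrow> norm (\<Phi> i \<theta> - \<Phi> i \<theta>') \<le> \<Lambda> * norm (\<theta> - \<theta>')"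
    and F_diff: "\<And>\<theta>. F differentiable at \<theta>"
    and F_smooth: "\<And>\<theta> \<theta>'. norm (gradient F \<theta> - gradient F \<theta>') \<le> L * norm (\<theta> - \<theta>')"
    and F_gradient: "\<And>\<theta>. gradient F \<theta> = (1 / real K) *\<^sub>R (\<Sum>i\<in>{1..K}. \<Phi> i \<theta>)"
    and F_gradient_bound: "\<And>\<theta>. norm (gradient F \<theta>) \<le> G"
    and F_nonneg: "\<And>\<theta>. 0 \<le> F \<theta>" and F_bound: "\<And>\<theta>. F \<theta> \<le> H"
    and L: "0 \<le> L" and \<eta>: "0 < \<eta>" "L * \<eta> \<le> 1 / 2"
begin

sublocale prob_space P
  using iid by (simp add: iid_sampling_def)

text \<open>The argument is a family of samples instead of an outcome of \<open>P\<close>. The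
  iterates can thus be evaluated on a restricted family, and they are measurable on the product
  space over any index set that contains the past.\<close>

primrec state :: "(nat \<times> nat \<times> nat \<Rightarrow> 'b) \<Rightarrow> nat \<Rightarrow> nat \<Rightarrow> 'a" where
  "state x 0 = (\<lambda>i. \<theta>\<^sub>0)"
| "state x (Suc t) = (\<lambda>i. \<Sum>j\<in>{1..K}. W i j *\<^sub>R
     (state x t j - \<eta> *\<^sub>R z j (state x t j) (\<lambda>k\<in>{1..B}. x (t, j, k))))"

text \<open>The mean answer at a frozen model. At a model determined by the past it is the
  conditional mean given the past, so subtracting it in \<open>noise\<close> leaves a centred
  term.\<close>

definition u :: "nat \<Rightarrow> 'a \<Rightarrow> 'a" where
  "u i \<theta> = (LINT y|minibatch_law D B i. z i \<theta> y)"

definition \<Theta> :: "nat \<Rightarrow> nat \<Rightarrow> 'w \<Rightarrow> 'a" where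
  "\<Theta> t i \<omega> = state (\<lambda>(t, i, j). \<xi> t i j \<omega>) t i"

definition Z :: "nat \<Rightarrow> nat \<Rightarrow> 'w \<Rightarrow> 'a" where
  "Z t i \<omega> = z i (\<Theta> t i \<omega>) (minibatch \<xi> B t i \<omega>)"

definition mean_\<Theta> :: "nat \<Rightarrow> 'w \<Rightarrow> 'a" where
  "mean_\<Theta> t \<omega> = (1 / real K) *\<^sub>R (\<Sum>i\<in>{1..K}. \<Theta> t i \<omega>)"

definition mean_Z :: "nat \<Rightarrow> 'w \<Rightarrow> 'a" where
  "mean_Z t \<omega> = (1 / real K) *\<^sub>R (\<Sum>i\<in>{1..K}. Z t i \<omega>)"

definition noise :: "nat \<Rightarrow> nat \<Rightarrow> 'w \<Rightarrow> 'a" where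
  "noise t i \<omega> = Z t i \<omega> - u i (\<Theta> t i \<omega>)"

definition mean_noise :: "nat \<Rightarrow> 'w \<Rightarrow> 'a" where
  "mean_noise t \<omega> = (1 / real K) *\<^sub>R (\<Sum>i\<in>{1..K}. noise t i \<omega>)"

text \<open>A sum over the devices and not an average, so its bounds carry a factor
  \<open>real K\<close>.\<close>

definition discrepancy :: "nat \<Rightarrow> 'w \<Rightarrow> real" where
  "discrepancy t \<omega> = (\<Sum>i\<in>{1..K}. (norm (\<Theta> t i \<omega> - mean_\<Theta> t \<omega>))\<^sup>2)"

section \<open>Measurability, moments and noise of the iterates\<close>

lemma prob_space_law: "i \<in> {1..K} \<Longrightarrow> prob_space (minibatch_law D B i)"
  by (intro prob_space_minibatch_law D)

text \<open>The recursion up to \<open>t\<close> reads only samples with index in the past, so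
  forgetting all indices outside a larger \<open>A\<close> changes nothing.\<close>

lemma state_eq_\<Theta>:
  assumes "past K B t \<subseteq> A"
  shows "state (samples \<xi> A \<omega>) t i = \<Theta> t i \<omega>"
proof -
  have "state (samples \<xi> A \<omega>) t i = state (\<lambda>(t, i, j). \<xi> t i j \<omega>) t i"
    using assms
  proof (induction t arbitrary: i)
    case (Suc t)
    have "past K B t \<subseteq> A"
      using Suc.prems by (auto simp: past_def)
    then have IH: "state (samples \<xi> A \<omega>) t i = state (\<lambda>(t, i, j). \<xi> t i j \<omega>) t i" for i
      by (rule Suc.IH)
    have batch: "(\<lambda>k\<in>{1..B}. samples \<xi> A \<omega> (t, j, k)) = (\<lambda>k\<in>{1..B}. \<xi> t j k \<omega>)" if "j \<in> {1..K}" for j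
    proof (rule restrict_ext)
      fix k assume "k \<in> {1..B}"
      with that have "(t, j, k) \<in> A"
        by (intro subsetD[OF Suc.prems]) (simp add: past_def)
      then show "samples \<xi> A \<omega> (t, j, k) = \<xi> t j k \<omega>"
        by (simp add: samples_def)
    qed
    show ?case
      unfolding state.simps IH by (intro sum.cong refl) (simp only: batch prod.case)
  qed simp
  then show ?thesis
    by (simp add: \<Theta>_def)
qed

lemma measurable_batch:
  assumes "{t} \<times> {j} \<times> {1..B} \<subseteq> A"
  shows "(\<lambda>x. \<lambda>k\<in>{1..B}. x (t, j, k)) \<in> Pi\<^sub>M A (sample_space D) \<rightarrow>\<^sub>M minibatch_law D B j"
  unfolding minibatch_law_def
proof (rule measurable_restrict)
  fix k assume "k \<in> {1..B}"
  with assms have "(\<lambda>x. x (t, j, k)) \<in> Pi\<^sub>M A (sample_space D) \<rightarrow>\<^sub>M sample_space D (t, j, k)"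
    by (intro measurable_component_singleton) auto
  then show "(\<lambda>x. x (t, j, k)) \<in> Pi\<^sub>M A (sample_space D) \<rightarrow>\<^sub>M D j"
    by (simp add: sample_space_def)
qed

lemma measurable_z:
  assumes "j \<in> {1..K}" "f \<in> borel_measurable N" "g \<in> N \<rightarrow>\<^sub>M minibatch_law D B j"
  shows "(\<lambda>x. z j (f x) (g x)) \<in> borel_measurable N"
  using measurable_compose[OF measurable_Pair[OF assms(2,3)] z_meas[OF assms(1)]] by simp

lemma measurable_state:
  assumes "past K B t \<subseteq> A"
  shows "(\<lambda>x. state x t i) \<in> borel_measurable (Pi\<^sub>M A (sample_space D))"
  using assms
proof (induction t arbitrary: i)
  case (Suc t)
  have "past K B t \<subseteq> A"
    using Suc.prems by (auto simp: past_def)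
  then have IH: "(\<lambda>x. state x t i) \<in> borel_measurable (Pi\<^sub>M A (sample_space D))" for i
    by (rule Suc.IH)
  show ?case
    unfolding state.simps
  proof (intro borel_measurable_sum borel_measurable_scaleR borel_measurable_diff borel_measurable_const IH
      measurable_z measurable_batch)
    fix j assume "j \<in> {1..K}"
    then show "{t} \<times> {j} \<times> {1..B} \<subseteq> A"
      using Suc.prems by (auto simp: past_def)
  qed
qed simp

lemma measurable_u:
  assumes "i \<in> {1..K}"
  shows "u i \<in> borel_measurable borel"
proof -
  interpret N: prob_space "minibatch_law D B i" using assms by (rule prob_space_law)
  show ?thesis
    unfolding u_def[abs_def] using z_meas[OF assms] by (rule N.borel_measurable_lebesgue_integral)
qed

lemma past_subset: "past K B t \<subseteq> UNIV \<times> {1..K} \<times> {1..B}"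
  by (auto simp: past_def)

lemma measurable_\<Theta> [measurable]: "\<Theta> t i \<in> borel_measurable P"
  using measurable_compose[OF measurable_samples[OF iid past_subset[of t]] measurable_state[OF order_refl]]
  unfolding state_eq_\<Theta>[OF order_refl] by simp

lemma Z_square:
  assumes i: "i \<in> {1..K}"
  shows "expectation_le P (\<lambda>\<omega>. (norm (Z t i \<omega>))\<^sup>2) s"
proof -
  have "expectation_le P (\<lambda>\<omega>. (norm (z i (state (samples \<xi> (past K B t) \<omega>) t i) (minibatch \<xi> B t i \<omega>)))\<^sup>2) s"
  proof (rule expectation_le_fresh_minibatch[OF iid past_subset i B D _ measurable_state[OF order_refl]])
    show "(\<lambda>(\<theta>, y). (norm (z i \<theta> y))\<^sup>2) \<in> borel_measurable (borel \<Otimes>\<^sub>M minibatch_law D B i)"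
      using z_meas[OF i] by (simp add: case_prod_beta')
    show "expectation_le (minibatch_law D B i) (\<lambda>y. (norm (z i \<theta> y))\<^sup>2) s" for \<theta>
      by (rule z_square[OF i])
  qed (simp_all add: past_def)
  then show ?thesis
    unfolding state_eq_\<Theta>[OF order_refl] Z_def .
qed

lemma measurable_z_section:
  assumes "i \<in> {1..K}"
  shows "z i \<theta> \<in> borel_measurable (minibatch_law D B i)"
  by (intro measurable_z[OF assms, of "\<lambda>_. \<theta>" _ "\<lambda>y. y"] borel_measurable_const measurable_ident_sets refl)

lemma centered_z:
  assumes i: "i \<in> {1..K}"
  shows "expectation_le (minibatch_law D B i) (\<lambda>y. (norm (z i \<theta> y - u i \<theta>))\<^sup>2) s"
    and "(LINT y|minibatch_law D B i. z i \<theta> y - u i \<theta>) = 0"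
    and "(norm (u i \<theta>))\<^sup>2 \<le> s"
proof -
  interpret N: prob_space "minibatch_law D B i" using i by (rule prob_space_law)
  note meas = measurable_z_section[OF i, of \<theta>]
  show "expectation_le (minibatch_law D B i) (\<lambda>y. (norm (z i \<theta> y - u i \<theta>))\<^sup>2) s" "(norm (u i \<theta>))\<^sup>2 \<le> s"
    unfolding u_def
    using N.second_moment_centered(1)[OF meas z_square[OF i]] N.second_moment_centered(2)[OF meas z_square[OF i]] .
  have "integrable (minibatch_law D B i) (\<lambda>y. (norm (z i \<theta> y))\<^sup>2)"
    using z_square[OF i, of \<theta>] by (simp add: expectation_le_def)
  then have "integrable (minibatch_law D B i) (z i \<theta>)"
    by (rule N.integrable_of_square[OF meas])
  then have "(LINT y|minibatch_law D B i. z i \<theta> y - u i \<theta>)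
      = (LINT y|minibatch_law D B i. z i \<theta> y) - (LINT y|minibatch_law D B i. u i \<theta>)"
    by (rule Bochner_Integration.integral_diff) simp
  then show "(LINT y|minibatch_law D B i. z i \<theta> y - u i \<theta>) = 0"
    using N.prob_space by (simp add: u_def)
qed

lemma measurable_centered_z:
  assumes i: "i \<in> {1..K}"
  shows "(\<lambda>(\<theta>, y). z i \<theta> y - u i \<theta>) \<in> borel_measurable (borel \<Otimes>\<^sub>M minibatch_law D B i)"
  using z_meas[OF i] unfolding case_prod_beta'
  by (intro borel_measurable_diff measurable_compose[OF measurable_fst measurable_u[OF i]])

lemma noise_square:
  assumes i: "i \<in> {1..K}"
  shows "expectation_le P (\<lambda>\<omega>. (norm (noise t i \<omega>))\<^sup>2) s"
proof -
  let ?w = "\<lambda>\<theta> y. z i \<theta> y - u i \<theta>"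
  have "expectation_le P (\<lambda>\<omega>. (norm (?w (state (samples \<xi> (past K B t) \<omega>) t i) (minibatch \<xi> B t i \<omega>)))\<^sup>2) s"
  proof (rule expectation_le_fresh_minibatch[OF iid past_subset i B D _ measurable_state[OF order_refl]])
    show "(\<lambda>(\<theta>, y). (norm (?w \<theta> y))\<^sup>2) \<in> borel_measurable (borel \<Otimes>\<^sub>M minibatch_law D B i)"
      using measurable_centered_z[OF i] by (simp add: case_prod_beta')
    show "expectation_le (minibatch_law D B i) (\<lambda>y. (norm (?w \<theta> y))\<^sup>2) s" for \<theta>
      by (rule centered_z(1)[OF i])
  qed (simp_all add: past_def)
  then show ?thesis
    unfolding state_eq_\<Theta>[OF order_refl] noise_def Z_def .
qed

lemma noise_orthogonal:
  assumes i: "i \<in> {1..K}" and A: "past K B t \<subseteq> A" "A \<subseteq> UNIV \<times> {1..K} \<times> {1..B}" "\<And>j. (t, i, j) \<notin> A"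
    and \<alpha>: "\<alpha> \<in> borel_measurable (Pi\<^sub>M A (sample_space D))"
    and \<alpha>_int: "integrable P (\<lambda>\<omega>. (norm (\<alpha> (samples \<xi> A \<omega>)))\<^sup>2)"
  shows "integrable P (\<lambda>\<omega>. \<alpha> (samples \<xi> A \<omega>) \<bullet> noise t i \<omega>)"
    and "expectation (\<lambda>\<omega>. \<alpha> (samples \<xi> A \<omega>) \<bullet> noise t i \<omega>) = 0"
  using fresh_minibatch_orthogonal[OF iid A(2) i B D A(3) measurable_state[OF A(1), of i]
      measurable_centered_z[OF i] centered_z(1)[OF i] centered_z(2)[OF i] \<alpha> \<alpha>_int]
  unfolding state_eq_\<Theta>[OF A(1)] noise_def Z_def by auto

text \<open>Adding the mini-batch of device \<open>j\<close> at iteration \<open>t\<close> to the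
  past makes the noise of \<open>j\<close> a function of the samples in \<open>A\<close>, while the
  mini-batch of \<open>i\<close> is still fresh.\<close>

lemma noise_uncorrelated:
  assumes i: "i \<in> {1..K}" and j: "j \<in> {1..K}" and "i \<noteq> j"
  shows "integrable P (\<lambda>\<omega>. noise t j \<omega> \<bullet> noise t i \<omega>)"
    and "expectation (\<lambda>\<omega>. noise t j \<omega> \<bullet> noise t i \<omega>) = 0"
proof -
  define A where "A = past K B t \<union> {t} \<times> {j} \<times> {1..B}"
  define \<alpha> where "\<alpha> x = z j (state x t j) (\<lambda>k\<in>{1..B}. x (t, j, k)) - u j (state x t j)" for x
  have A: "past K B t \<subseteq> A" "A \<subseteq> UNIV \<times> {1..K} \<times> {1..B}" "\<And>k. (t, i, k) \<notin> A"
    using assms by (auto simp: A_def past_def)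
  have "(\<lambda>k\<in>{1..B}. samples \<xi> A \<omega> (t, j, k)) = minibatch \<xi> B t j \<omega>" for \<omega>
    unfolding minibatch_def by (intro restrict_ext) (simp add: samples_def A_def)
  then have \<alpha>_eq: "\<alpha> (samples \<xi> A \<omega>) = noise t j \<omega>" for \<omega>
    unfolding \<alpha>_def state_eq_\<Theta>[OF A(1)] noise_def Z_def by simp
  have \<alpha>: "\<alpha> \<in> borel_measurable (Pi\<^sub>M A (sample_space D))"
    unfolding \<alpha>_def[abs_def]
    by (intro borel_measurable_diff measurable_z measurable_batch measurable_state A(1) j
        measurable_compose[OF _ measurable_u[OF j]]) (simp add: A_def)
  show "integrable P (\<lambda>\<omega>. noise t j \<omega> \<bullet> noise t i \<omega>)" "expectation (\<lambda>\<omega>. noise t j \<omega> \<bullet> noise t i \<omega>) = 0"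
    using noise_orthogonal[OF i A \<alpha>] noise_square[OF j] unfolding \<alpha>_eq by (auto simp: expectation_le_def)
qed

text \<open>The mixed products vanish in expectation, which leaves \<open>K\<close> terms of size at
  most \<open>s\<close>, divided by \<open>K\<^sup>2\<close>. This is the gain from averaging over
  the devices.\<close>

lemma mean_noise_square: "expectation_le P (\<lambda>\<omega>. (norm (mean_noise t \<omega>))\<^sup>2) (s / real K)"
proof -
  have eq: "(norm (mean_noise t \<omega>))\<^sup>2
      = (\<Sum>j\<in>{1..K}. \<Sum>i\<in>{1..K}. noise t i \<omega> \<bullet> noise t j \<omega>) / (real K)\<^sup>2" for \<omega>
  proof -
    have "(norm (mean_noise t \<omega>))\<^sup>2 = (norm (\<Sum>i\<in>{1..K}. noise t i \<omega>))\<^sup>2 / (real K)\<^sup>2"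
      unfolding mean_noise_def by (simp add: power_divide)
    then show ?thesis
      unfolding power2_norm_eq_inner[of "\<Sum>i\<in>{1..K}. noise t i \<omega>"] inner_sum_left inner_sum_right .
  qed
  have pair: "integrable P (\<lambda>\<omega>. noise t i \<omega> \<bullet> noise t j \<omega>) \<and>
      expectation (\<lambda>\<omega>. noise t i \<omega> \<bullet> noise t j \<omega>) \<le> (if j = i then s else 0)"
    if "j \<in> {1..K}" "i \<in> {1..K}" for i j
  proof (cases "j = i")
    case True
    then show ?thesis
      using noise_square[OF that(1), of t] by (simp add: expectation_le_def power2_norm_eq_inner)
  next
    case False
    then show ?thesis
      using noise_uncorrelated[OF that False, of t] by simp
  qed
  have "expectation_le P (\<lambda>\<omega>. \<Sum>j\<in>{1..K}. \<Sum>i\<in>{1..K}. noise t i \<omega> \<bullet> noise t j \<omega>)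
      (\<Sum>j\<in>{1..K}. \<Sum>i\<in>{1..K}. if j = i then s else 0)"
    using pair by (intro expectation_le_sum) (simp add: expectation_le_def)
  then have "expectation_le P (\<lambda>\<omega>. 1 / (real K)\<^sup>2 * (\<Sum>j\<in>{1..K}. \<Sum>i\<in>{1..K}. noise t i \<omega> \<bullet> noise t j \<omega>))
      (1 / (real K)\<^sup>2 * (\<Sum>j\<in>{1..K}. \<Sum>i\<in>{1..K}. if j = i then s else 0))"
    by (rule expectation_le_cmult) simp
  moreover have "1 / (real K)\<^sup>2 * (\<Sum>j\<in>{1..K}. \<Sum>i\<in>{1..K}. if j = i then s else 0) = s / real K"
    using K by (simp add: power2_eq_square)
  ultimately show ?thesis
    unfolding eq by simp
qed

section \<open>Evolution of the average and of the consensus error\<close>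

lemma \<Theta>_Suc: "\<Theta> (Suc t) i \<omega> = (\<Sum>j\<in>{1..K}. W i j *\<^sub>R (\<Theta> t j \<omega> - \<eta> *\<^sub>R Z t j \<omega>))"
  by (simp add: \<Theta>_def Z_def minibatch_def)

lemma W_rows: "i \<in> {1..K} \<Longrightarrow> (\<Sum>j\<in>{1..K}. W i j) = 1"
  and W_columns: "j \<in> {1..K} \<Longrightarrow> (\<Sum>i\<in>{1..K}. W i j) = 1"
  using W by (simp_all add: mixing_matrix_def)

text \<open>Mixing preserves the average because the columns of \<open>W\<close> sum to 1, so only
  the gradient step is visible in it.\<close>

lemma mean_\<Theta>_Suc: "mean_\<Theta> (Suc t) \<omega> = mean_\<Theta> t \<omega> - \<eta> *\<^sub>R mean_Z t \<omega>"
proof -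
  have "(\<Sum>i\<in>{1..K}. \<Theta> (Suc t) i \<omega>)
      = (\<Sum>j\<in>{1..K}. \<Sum>i\<in>{1..K}. W i j *\<^sub>R (\<Theta> t j \<omega> - \<eta> *\<^sub>R Z t j \<omega>))"
    unfolding \<Theta>_Suc by (rule sum.swap)
  also have "\<dots> = (\<Sum>j\<in>{1..K}. \<Theta> t j \<omega> - \<eta> *\<^sub>R Z t j \<omega>)"
    by (intro sum.cong refl) (simp only: scaleR_sum_left[symmetric] W_columns scaleR_one)
  finally show ?thesis
    unfolding mean_\<Theta>_def mean_Z_def
    by (simp only: sum_subtractf scaleR_diff_right scaleR_sum_right[symmetric]
        scaleR_left_commute[of "1 / real K" \<eta>])
qed

lemma measurable_mean_\<Theta> [measurable]: "mean_\<Theta> t \<in> borel_measurable P"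
  unfolding mean_\<Theta>_def[abs_def] by measurable

lemma measurable_discrepancy: "discrepancy t \<in> borel_measurable P"
  unfolding discrepancy_def[abs_def] by measurable

lemma discrepancy_nonneg: "0 \<le> discrepancy t \<omega>"
  unfolding discrepancy_def by (intro sum_nonneg) simp

lemma \<rho>_less_1: "\<rho> < 1"
  using spec by (simp add: spectral_assm_def)

lemma discrepancy_Suc:
  "discrepancy (Suc t) \<omega> \<le> (1 + \<rho>) / 2 * discrepancy t \<omega>
    + (1 + 2 / (1 - \<rho>)) * \<eta>\<^sup>2 * (\<Sum>i\<in>{1..K}. (norm (Z t i \<omega>))\<^sup>2)"
proof -
  \<comment> \<open>Deviations of the half steps from their average, which is also the new average
    because mixing preserves it. They sum to zero, as the spectral contraction requires.\<close>
  define v where "v i = (\<Theta> t i \<omega> - \<eta> *\<^sub>R Z t i \<omega>) - mean_\<Theta> (Suc t) \<omega>" for i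
  \<comment> \<open>With this weight \<open>\<rho> * (1 + a)\<close> stays below
    \<open>(1 + \<rho>) / 2\<close>, by \<open>(1 - \<rho>)\<^sup>2 / 2\<close>, and
    \<open>1 + 1 / a\<close> is \<open>1 + 2 / (1 - \<rho>)\<close>.\<close>
  define a where "a = (1 - \<rho>) / 2"
  have a: "0 < a" using \<rho>_less_1 by (simp add: a_def)
  have \<rho>: "0 \<le> \<rho>" using spec K by (rule spectral_assm_nonneg)
  have sum_half: "(\<Sum>i\<in>{1..K}. \<Theta> t i \<omega> - \<eta> *\<^sub>R Z t i \<omega>) = real K *\<^sub>R mean_\<Theta> (Suc t) \<omega>"
  proof -
    have "real K *\<^sub>R mean_\<Theta> t \<omega> = (\<Sum>i\<in>{1..K}. \<Theta> t i \<omega>)" "real K *\<^sub>R mean_Z t \<omega> = (\<Sum>i\<in>{1..K}. Z t i \<omega>)"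
      using K by (simp_all add: mean_\<Theta>_def mean_Z_def)
    then show ?thesis
      by (simp only: mean_\<Theta>_Suc sum_subtractf scaleR_sum_right[symmetric] scaleR_diff_right
          scaleR_left_commute[of "real K" \<eta>])
  qed
  have "(\<Sum>i\<in>{1..K}. v i) = (\<Sum>i\<in>{1..K}. \<Theta> t i \<omega> - \<eta> *\<^sub>R Z t i \<omega>) - (\<Sum>i\<in>{1..K}. mean_\<Theta> (Suc t) \<omega>)"
    unfolding v_def by (rule sum_subtractf)
  then have sum_v: "(\<Sum>i\<in>{1..K}. v i) = 0"
    unfolding sum_half by (simp add: sum_constant_scaleR)
  have dev: "\<Theta> (Suc t) i \<omega> - mean_\<Theta> (Suc t) \<omega> = (\<Sum>j\<in>{1..K}. W i j *\<^sub>R v j)" if "i \<in> {1..K}" for i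
    unfolding \<Theta>_Suc v_def scaleR_diff_right[of _ _ "mean_\<Theta> (Suc t) \<omega>"] sum_subtractf
      scaleR_sum_left[symmetric] W_rows[OF that] by simp
  have v_eq: "v i = (\<Theta> t i \<omega> - mean_\<Theta> t \<omega>) + (- \<eta>) *\<^sub>R (Z t i \<omega> - mean_Z t \<omega>)" for i
    unfolding v_def mean_\<Theta>_Suc by (simp add: scaleR_diff_right)
  have "discrepancy (Suc t) \<omega> = (\<Sum>i\<in>{1..K}. (norm (\<Sum>j\<in>{1..K}. W i j *\<^sub>R v j))\<^sup>2)"
    unfolding discrepancy_def by (intro sum.cong refl) (simp only: dev)
  also have "\<dots> \<le> \<rho> * (\<Sum>i\<in>{1..K}. (norm (v i))\<^sup>2)"
    by (rule spectral_contraction[OF spec sum_v])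
  also have "\<dots> \<le> \<rho> * (\<Sum>i\<in>{1..K}. (1 + a) * (norm (\<Theta> t i \<omega> - mean_\<Theta> t \<omega>))\<^sup>2
      + (1 + 1 / a) * \<eta>\<^sup>2 * (norm (Z t i \<omega> - mean_Z t \<omega>))\<^sup>2)"
  proof (intro mult_left_mono sum_mono \<rho>)
    fix i
    show "(norm (v i))\<^sup>2 \<le> (1 + a) * (norm (\<Theta> t i \<omega> - mean_\<Theta> t \<omega>))\<^sup>2
        + (1 + 1 / a) * \<eta>\<^sup>2 * (norm (Z t i \<omega> - mean_Z t \<omega>))\<^sup>2"
      unfolding v_eq using norm_add_square_weighted[OF a, of "\<Theta> t i \<omega> - mean_\<Theta> t \<omega>" "(- \<eta>) *\<^sub>R (Z t i \<omega> - mean_Z t \<omega>)"]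
      by (simp add: power_mult_distrib mult.assoc)
  qed
  also have "\<dots> = \<rho> * (1 + a) * discrepancy t \<omega>
      + \<rho> * ((1 + 1 / a) * \<eta>\<^sup>2 * (\<Sum>i\<in>{1..K}. (norm (Z t i \<omega> - mean_Z t \<omega>))\<^sup>2))"
    unfolding discrepancy_def sum.distrib sum_distrib_left[symmetric] by (simp add: algebra_simps)
  also have "\<dots> \<le> (1 + \<rho>) / 2 * discrepancy t \<omega>
      + 1 * ((1 + 1 / a) * \<eta>\<^sup>2 * (\<Sum>i\<in>{1..K}. (norm (Z t i \<omega>))\<^sup>2))"
  proof (rule add_mono)
    have "\<rho> * (1 + a) \<le> (1 + \<rho>) / 2"
    proof -
      have "0 \<le> (1 - \<rho>) * (1 - \<rho>)" by simp
      then show ?thesis by (simp add: a_def field_simps)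
    qed
    then show "\<rho> * (1 + a) * discrepancy t \<omega> \<le> (1 + \<rho>) / 2 * discrepancy t \<omega>"
      by (intro mult_right_mono discrepancy_nonneg)
    have "(\<Sum>i\<in>{1..K}. (norm (Z t i \<omega> - mean_Z t \<omega>))\<^sup>2) \<le> (\<Sum>i\<in>{1..K}. (norm (Z t i \<omega>))\<^sup>2)"
      unfolding mean_Z_def by (rule sum_square_deviation_le[OF K])
    then show "\<rho> * ((1 + 1 / a) * \<eta>\<^sup>2 * (\<Sum>i\<in>{1..K}. (norm (Z t i \<omega> - mean_Z t \<omega>))\<^sup>2))
        \<le> 1 * ((1 + 1 / a) * \<eta>\<^sup>2 * (\<Sum>i\<in>{1..K}. (norm (Z t i \<omega>))\<^sup>2))"
      using a \<rho> \<rho>_less_1 by (intro mult_mono mult_nonneg_nonneg sum_nonneg) auto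
  qed
  finally show ?thesis
    by (simp add: a_def)
qed

text \<open>Chosen so that \<open>\<gamma> * \<eta>\<^sup>2 * s * K\<close> is the fixed point of
  \<open>x = (1 + \<rho>) / 2 * x + (1 + 2 / (1 - \<rho>)) * \<eta>\<^sup>2 * s * K\<close>, the
  recursion that \<open>discrepancy_Suc\<close> gives in expectation.\<close>

definition \<gamma> :: real where
  "\<gamma> = 2 * (1 + 2 / (1 - \<rho>)) / (1 - \<rho>)"

text \<open>The devices share \<open>\<theta>\<^sub>0\<close>, so the discrepancy starts at 0;
  afterwards the bound reproduces itself, being a fixed point, and does not grow with
  \<open>t\<close>.\<close>

lemma discrepancy_expectation: "expectation_le P (discrepancy t) (\<gamma> * \<eta>\<^sup>2 * s * real K)"
proof (induction t)
  case 0
  have "discrepancy 0 = (\<lambda>_. 0)"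
    using K by (simp add: discrepancy_def[abs_def] mean_\<Theta>_def \<Theta>_def sum_constant_scaleR)
  moreover have "0 \<le> s"
    using Z_square[of 1 0] K order_trans[OF integral_nonneg_AE[of "\<lambda>\<omega>. (norm (Z 0 1 \<omega>))\<^sup>2" P, OF AE_I2]]
    by (simp add: expectation_le_def)
  moreover have "0 \<le> \<gamma>"
    using \<rho>_less_1 by (simp add: \<gamma>_def)
  ultimately show ?case
    by (simp add: expectation_le_def)
next
  case (Suc t)
  define \<kappa> where "\<kappa> = 1 + 2 / (1 - \<rho>)"
  have \<rho>: "0 \<le> \<rho>" using spec K by (rule spectral_assm_nonneg)
  have \<kappa>: "0 \<le> \<kappa>" using \<rho>_less_1 by (simp add: \<kappa>_def)
  have "expectation_le P (\<lambda>\<omega>. (1 + \<rho>) / 2 * discrepancy t \<omega> + \<kappa> * \<eta>\<^sup>2 * (\<Sum>i\<in>{1..K}. (norm (Z t i \<omega>))\<^sup>2))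
      ((1 + \<rho>) / 2 * (\<gamma> * \<eta>\<^sup>2 * s * real K) + \<kappa> * \<eta>\<^sup>2 * (\<Sum>i\<in>{1..K}. s))"
    using \<rho> \<kappa> by (intro expectation_le_add expectation_le_cmult expectation_le_sum Suc Z_square) auto
  then have "expectation_le P (discrepancy (Suc t)) ((1 + \<rho>) / 2 * (\<gamma> * \<eta>\<^sup>2 * s * real K) + \<kappa> * \<eta>\<^sup>2 * (\<Sum>i\<in>{1..K}. s))"
    using measurable_discrepancy discrepancy_nonneg discrepancy_Suc[of t]
    by (elim expectation_le_mono) (auto simp: \<kappa>_def)
  moreover have "(1 + \<rho>) / 2 * (\<gamma> * \<eta>\<^sup>2 * s * real K) + \<kappa> * \<eta>\<^sup>2 * (\<Sum>i\<in>{1..K}. s) = \<gamma> * \<eta>\<^sup>2 * s * real K"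
  proof -
    have "\<gamma> = 2 * \<kappa> / (1 - \<rho>)"
      by (simp add: \<gamma>_def \<kappa>_def)
    then have \<kappa>_eq: "\<kappa> = (1 - \<rho>) / 2 * \<gamma>"
      using \<rho>_less_1 by simp
    show ?thesis
      unfolding \<kappa>_eq by (simp add: algebra_simps add_divide_distrib diff_divide_distrib)
  qed
  ultimately show ?case by simp
qed

text \<open>There are two sources of error: querying the local models instead of their average costs
  \<open>\<Lambda>\<close> times the distance, and the bias costs \<open>\<beta>\<close>. Convexity
  of the square then bounds the squared mean distance by the discrepancy.\<close>

lemma gradient_error:
  "(norm (gradient F (mean_\<Theta> t \<omega>) - (1 / real K) *\<^sub>R (\<Sum>i\<in>{1..K}. u i (\<Theta> t i \<omega>))))\<^sup>2
    \<le> 2 * \<Lambda>\<^sup>2 / real K * discrepancy t \<omega> + 2 * \<beta>\<^sup>2"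
proof -
  let ?d = "\<lambda>i. norm (\<Theta> t i \<omega> - mean_\<Theta> t \<omega>)"
  have "gradient F (mean_\<Theta> t \<omega>) - (1 / real K) *\<^sub>R (\<Sum>i\<in>{1..K}. u i (\<Theta> t i \<omega>))
      = (1 / real K) *\<^sub>R (\<Sum>i\<in>{1..K}. \<Phi> i (mean_\<Theta> t \<omega>) - u i (\<Theta> t i \<omega>))"
    unfolding F_gradient by (simp add: sum_subtractf scaleR_diff_right)
  then have "norm (gradient F (mean_\<Theta> t \<omega>) - (1 / real K) *\<^sub>R (\<Sum>i\<in>{1..K}. u i (\<Theta> t i \<omega>)))
      = 1 / real K * norm (\<Sum>i\<in>{1..K}. \<Phi> i (mean_\<Theta> t \<omega>) - u i (\<Theta> t i \<omega>))"
    by simp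
  also have "\<dots> \<le> 1 / real K * (\<Sum>i\<in>{1..K}. \<Lambda> * ?d i + \<beta>)"
  proof (intro mult_left_mono sum_norm_le)
    fix i assume i: "i \<in> {1..K}"
    have "\<Phi> i (mean_\<Theta> t \<omega>) - u i (\<Theta> t i \<omega>)
        = (\<Phi> i (mean_\<Theta> t \<omega>) - \<Phi> i (\<Theta> t i \<omega>)) - (u i (\<Theta> t i \<omega>) - \<Phi> i (\<Theta> t i \<omega>))"
      by simp
    also have "norm \<dots> \<le> norm (\<Phi> i (mean_\<Theta> t \<omega>) - \<Phi> i (\<Theta> t i \<omega>)) + norm (u i (\<Theta> t i \<omega>) - \<Phi> i (\<Theta> t i \<omega>))"
      by (rule norm_triangle_ineq4)
    also have "\<dots> \<le> \<Lambda> * ?d i + \<beta>"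
      unfolding u_def norm_minus_commute[of "\<Theta> t i \<omega>" "mean_\<Theta> t \<omega>"]
      by (intro add_mono \<Phi>_lipschitz bias i)
    finally show "norm (\<Phi> i (mean_\<Theta> t \<omega>) - u i (\<Theta> t i \<omega>)) \<le> \<Lambda> * ?d i + \<beta>" .
  qed simp
  finally have "(norm (gradient F (mean_\<Theta> t \<omega>) - (1 / real K) *\<^sub>R (\<Sum>i\<in>{1..K}. u i (\<Theta> t i \<omega>))))\<^sup>2
      \<le> (1 / real K * (\<Sum>i\<in>{1..K}. \<Lambda> * ?d i + \<beta>))\<^sup>2"
    by (intro power_mono) auto
  also have "\<dots> \<le> 1 / real K * (\<Sum>i\<in>{1..K}. (\<Lambda> * ?d i + \<beta>)\<^sup>2)"
    by (rule square_mean_le)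
  also have "\<dots> \<le> 1 / real K * (\<Sum>i\<in>{1..K}. 2 * \<Lambda>\<^sup>2 * (?d i)\<^sup>2 + 2 * \<beta>\<^sup>2)"
  proof (intro mult_left_mono sum_mono)
    fix i
    have "(\<Lambda> * ?d i + \<beta>)\<^sup>2 \<le> 2 * (\<Lambda> * ?d i)\<^sup>2 + 2 * \<beta>\<^sup>2"
      using norm_add_square_le[of "\<Lambda> * ?d i" \<beta>] by simp
    then show "(\<Lambda> * ?d i + \<beta>)\<^sup>2 \<le> 2 * \<Lambda>\<^sup>2 * (?d i)\<^sup>2 + 2 * \<beta>\<^sup>2"
      by (simp add: power_mult_distrib)
  qed simp
  also have "\<dots> = 1 / real K * (2 * \<Lambda>\<^sup>2 * discrepancy t \<omega> + real K * (2 * \<beta>\<^sup>2))"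
    unfolding discrepancy_def sum.distrib sum_distrib_left[symmetric] by simp
  also have "\<dots> = 2 * \<Lambda>\<^sup>2 / real K * discrepancy t \<omega> + 2 * \<beta>\<^sup>2"
    using K by (simp add: field_simps)
  finally show ?thesis .
qed

text \<open>The averaged answer splits into its mean \<open>m\<close> at the local models and the
  noise \<open>e\<close>. Polarization writes \<open>g \<bullet> m\<close> in terms of squares, and
  its \<open>(norm m)\<^sup>2\<close> absorbs the one from the curvature term. The noise terms are
  kept, as they are controlled only in expectation.\<close>

lemma descent_pointwise:
  "F (mean_\<Theta> (Suc t) \<omega>) + \<eta> / 2 * (norm (gradient F (mean_\<Theta> t \<omega>)))\<^sup>2
    \<le> F (mean_\<Theta> t \<omega>) + \<eta> * (\<Lambda>\<^sup>2 / real K * discrepancy t \<omega> + \<beta>\<^sup>2)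
      - \<eta> * (gradient F (mean_\<Theta> t \<omega>) \<bullet> mean_noise t \<omega>) + L * \<eta>\<^sup>2 * (norm (mean_noise t \<omega>))\<^sup>2"
proof -
  define g where "g = gradient F (mean_\<Theta> t \<omega>)"
  define m where "m = (1 / real K) *\<^sub>R (\<Sum>i\<in>{1..K}. u i (\<Theta> t i \<omega>))"
  define e where "e = mean_noise t \<omega>"
  have Z_eq: "mean_Z t \<omega> = m + e"
    by (simp add: mean_Z_def m_def e_def mean_noise_def noise_def sum_subtractf scaleR_diff_right)
  have step: "mean_\<Theta> (Suc t) \<omega> - mean_\<Theta> t \<omega> = (- \<eta>) *\<^sub>R (m + e)"
    by (simp add: mean_\<Theta>_Suc Z_eq)
  have "F (mean_\<Theta> (Suc t) \<omega>) \<le> F (mean_\<Theta> t \<omega>) + g \<bullet> (mean_\<Theta> (Suc t) \<omega> - mean_\<Theta> t \<omega>)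
      + L / 2 * (norm (mean_\<Theta> (Suc t) \<omega> - mean_\<Theta> t \<omega>))\<^sup>2"
    unfolding g_def by (intro smooth_upper_bound F_diff F_smooth)
  also have "\<dots> = F (mean_\<Theta> t \<omega>) - \<eta> * (g \<bullet> m) - \<eta> * (g \<bullet> e) + L / 2 * \<eta>\<^sup>2 * (norm (m + e))\<^sup>2"
    unfolding step by (simp add: power_mult_distrib inner_add_right distrib_left)
  also have "\<dots> \<le> F (mean_\<Theta> t \<omega>) - \<eta> * (g \<bullet> m) - \<eta> * (g \<bullet> e)
      + L / 2 * \<eta>\<^sup>2 * (2 * (norm m)\<^sup>2 + 2 * (norm e)\<^sup>2)"
    using L by (intro add_left_mono mult_left_mono norm_add_square_le) auto
  also have "\<dots> = F (mean_\<Theta> t \<omega>) - \<eta> * (g \<bullet> m) - \<eta> * (g \<bullet> e)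
      + \<eta> * ((L * \<eta>) * (norm m)\<^sup>2) + L * \<eta>\<^sup>2 * (norm e)\<^sup>2"
    by (simp add: algebra_simps power2_eq_square)
  \<comment> \<open>Here \<open>L * \<eta> \<le> 1 / 2\<close> enters: the curvature term in
    \<open>m\<close> is enlarged to exactly the amount that polarization of
    \<open>g \<bullet> m\<close> takes away again.\<close>
  also have "\<dots> \<le> F (mean_\<Theta> t \<omega>) - \<eta> * (g \<bullet> m) - \<eta> * (g \<bullet> e)
      + \<eta> * (1 / 2 * (norm m)\<^sup>2) + L * \<eta>\<^sup>2 * (norm e)\<^sup>2"
    using \<eta> by (intro add_left_mono add_right_mono mult_left_mono mult_right_mono) auto
  also have "g \<bullet> m = ((norm g)\<^sup>2 + (norm m)\<^sup>2 - (norm (g - m))\<^sup>2) / 2"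
    by (simp add: power2_norm_eq_inner inner_diff_left inner_diff_right inner_commute)
  finally have "F (mean_\<Theta> (Suc t) \<omega>) + \<eta> / 2 * (norm g)\<^sup>2
      \<le> F (mean_\<Theta> t \<omega>) + \<eta> / 2 * (norm (g - m))\<^sup>2 - \<eta> * (g \<bullet> e) + L * \<eta>\<^sup>2 * (norm e)\<^sup>2"
    by (simp add: algebra_simps diff_divide_distrib add_divide_distrib)
  also have "\<eta> / 2 * (norm (g - m))\<^sup>2 \<le> \<eta> / 2 * (2 * \<Lambda>\<^sup>2 / real K * discrepancy t \<omega> + 2 * \<beta>\<^sup>2)"
    unfolding g_def m_def using \<eta> by (intro mult_left_mono gradient_error) auto
  also have "\<dots> = \<eta> * (\<Lambda>\<^sup>2 / real K * discrepancy t \<omega> + \<beta>\<^sup>2)"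
    by (simp add: algebra_simps)
  finally show ?thesis
    unfolding g_def e_def by simp
qed

lemma measurable_gradient_F: "gradient F \<in> borel_measurable borel"
proof (rule borel_measurable_continuous_onI)
  have "L-lipschitz_on UNIV (gradient F)"
    using F_smooth L by (intro lipschitz_onI) (auto simp: dist_norm)
  then show "continuous_on UNIV (gradient F)"
    by (rule lipschitz_on_continuous_on)
qed

lemma integrable_F: "integrable P (\<lambda>\<omega>. F (mean_\<Theta> t \<omega>))"
proof (rule integrable_const_bound)
  have "F \<in> borel_measurable borel"
    using F_diff by (intro borel_measurable_continuous_onI differentiable_imp_continuous_on)
      (simp add: differentiable_on_def differentiable_at_withinI)
  then show "(\<lambda>\<omega>. F (mean_\<Theta> t \<omega>)) \<in> borel_measurable P"
    by measurable
  show "AE \<omega> in P. norm (F (mean_\<Theta> t \<omega>)) \<le> H"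
    using F_nonneg F_bound by (intro AE_I2) simp
qed

lemma integrable_gradient_square: "integrable P (\<lambda>\<omega>. (norm (gradient F (mean_\<Theta> t \<omega>)))\<^sup>2)"
proof (rule integrable_const_bound)
  show "(\<lambda>\<omega>. (norm (gradient F (mean_\<Theta> t \<omega>)))\<^sup>2) \<in> borel_measurable P"
    using measurable_gradient_F by measurable
  show "AE \<omega> in P. norm ((norm (gradient F (mean_\<Theta> t \<omega>)))\<^sup>2) \<le> G\<^sup>2"
    using F_gradient_bound by (intro AE_I2) (simp add: power_mono)
qed

text \<open>The gradient at the average is determined by the past and is square integrable thanks to
  the bound \<open>G\<close>, so the noise of every device is orthogonal to it.\<close>

lemma gradient_noise_orthogonal:
  shows "integrable P (\<lambda>\<omega>. gradient F (mean_\<Theta> t \<omega>) \<bullet> mean_noise t \<omega>)"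
    and "expectation (\<lambda>\<omega>. gradient F (mean_\<Theta> t \<omega>) \<bullet> mean_noise t \<omega>) = 0"
proof -
  define \<alpha> where "\<alpha> x = gradient F ((1 / real K) *\<^sub>R (\<Sum>i\<in>{1..K}. state x t i))" for x
  have \<alpha>: "\<alpha> \<in> borel_measurable (Pi\<^sub>M (past K B t) (sample_space D))"
    unfolding \<alpha>_def[abs_def]
    by (intro measurable_compose[OF _ measurable_gradient_F] borel_measurable_scaleR borel_measurable_const
        borel_measurable_sum measurable_state order_refl)
  have \<alpha>_eq: "\<alpha> (samples \<xi> (past K B t) \<omega>) = gradient F (mean_\<Theta> t \<omega>)" for \<omega>
    unfolding \<alpha>_def mean_\<Theta>_def
    by (intro arg_cong[of _ _ "\<lambda>v. gradient F ((1 / real K) *\<^sub>R v)"] sum.cong refl state_eq_\<Theta> order_refl)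
  have noise: "integrable P (\<lambda>\<omega>. gradient F (mean_\<Theta> t \<omega>) \<bullet> noise t i \<omega>)"
      "expectation (\<lambda>\<omega>. gradient F (mean_\<Theta> t \<omega>) \<bullet> noise t i \<omega>) = 0" if "i \<in> {1..K}" for i
    using noise_orthogonal[OF that order_refl past_subset _ \<alpha>] integrable_gradient_square[of t]
    unfolding \<alpha>_eq by (auto simp: past_def)
  have eq: "gradient F (mean_\<Theta> t \<omega>) \<bullet> mean_noise t \<omega>
      = 1 / real K * (\<Sum>i\<in>{1..K}. gradient F (mean_\<Theta> t \<omega>) \<bullet> noise t i \<omega>)" for \<omega>
    by (simp add: mean_noise_def inner_sum_right)
  show "integrable P (\<lambda>\<omega>. gradient F (mean_\<Theta> t \<omega>) \<bullet> mean_noise t \<omega>)"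
    unfolding eq by (intro integrable_mult_right Bochner_Integration.integrable_sum noise)
  have "expectation (\<lambda>\<omega>. \<Sum>i\<in>{1..K}. gradient F (mean_\<Theta> t \<omega>) \<bullet> noise t i \<omega>)
      = (\<Sum>i\<in>{1..K}. expectation (\<lambda>\<omega>. gradient F (mean_\<Theta> t \<omega>) \<bullet> noise t i \<omega>))"
    by (intro Bochner_Integration.integral_sum noise)
  also have "\<dots> = 0"
    by (intro sum.neutral ballI noise)
  finally show "expectation (\<lambda>\<omega>. gradient F (mean_\<Theta> t \<omega>) \<bullet> mean_noise t \<omega>) = 0"
    unfolding eq integral_mult_right_zero by simp
qed

lemma descent_expectation:
  "expectation (\<lambda>\<omega>. F (mean_\<Theta> (Suc t) \<omega>)) + \<eta> / 2 * expectation (\<lambda>\<omega>. (norm (gradient F (mean_\<Theta> t \<omega>)))\<^sup>2)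
    \<le> expectation (\<lambda>\<omega>. F (mean_\<Theta> t \<omega>)) + \<eta> * (\<Lambda>\<^sup>2 * \<gamma> * \<eta>\<^sup>2 * s + \<beta>\<^sup>2) + L * \<eta>\<^sup>2 * (s / real K)"
proof -
  have disc: "integrable P (discrepancy t)" "expectation (discrepancy t) \<le> \<gamma> * \<eta>\<^sup>2 * s * real K"
    using discrepancy_expectation[of t] by (auto simp: expectation_le_def)
  have noise: "integrable P (\<lambda>\<omega>. (norm (mean_noise t \<omega>))\<^sup>2)" "expectation (\<lambda>\<omega>. (norm (mean_noise t \<omega>))\<^sup>2) \<le> s / real K"
    using mean_noise_square[of t] by (auto simp: expectation_le_def)
  note int = integrable_F integrable_gradient_square gradient_noise_orthogonal(1) disc(1) noise(1)
  have "expectation (\<lambda>\<omega>. F (mean_\<Theta> (Suc t) \<omega>)) + \<eta> / 2 * expectation (\<lambda>\<omega>. (norm (gradient F (mean_\<Theta> t \<omega>)))\<^sup>2)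
      = expectation (\<lambda>\<omega>. F (mean_\<Theta> (Suc t) \<omega>) + \<eta> / 2 * (norm (gradient F (mean_\<Theta> t \<omega>)))\<^sup>2)"
    using int by simp
  also have "\<dots> \<le> expectation (\<lambda>\<omega>. F (mean_\<Theta> t \<omega>) + \<eta> * (\<Lambda>\<^sup>2 / real K * discrepancy t \<omega> + \<beta>\<^sup>2)
      - \<eta> * (gradient F (mean_\<Theta> t \<omega>) \<bullet> mean_noise t \<omega>) + L * \<eta>\<^sup>2 * (norm (mean_noise t \<omega>))\<^sup>2)"
    using int by (intro integral_mono descent_pointwise) auto
  also have "\<dots> = expectation (\<lambda>\<omega>. F (mean_\<Theta> t \<omega>)) + \<eta> * (\<Lambda>\<^sup>2 / real K * expectation (discrepancy t) + \<beta>\<^sup>2)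
      + L * \<eta>\<^sup>2 * expectation (\<lambda>\<omega>. (norm (mean_noise t \<omega>))\<^sup>2)"
    using int gradient_noise_orthogonal(2)[of t] by (simp add: prob_space)
  also have "\<dots> \<le> expectation (\<lambda>\<omega>. F (mean_\<Theta> t \<omega>)) + \<eta> * (\<Lambda>\<^sup>2 / real K * (\<gamma> * \<eta>\<^sup>2 * s * real K) + \<beta>\<^sup>2)
      + L * \<eta>\<^sup>2 * (s / real K)"
    using \<eta> L by (intro add_mono mult_left_mono disc noise order_refl) auto
  also have "\<Lambda>\<^sup>2 / real K * (\<gamma> * \<eta>\<^sup>2 * s * real K) = \<Lambda>\<^sup>2 * \<gamma> * \<eta>\<^sup>2 * s"
    using K by simp
  finally show ?thesis .
qed

text \<open>The sum starts at \<open>t = 1\<close>, so the telescoped initial value is that of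
  \<open>F\<close> at a random point and not at \<open>\<theta>\<^sub>0\<close>. The uniform bound
  \<open>H\<close> covers it, and nonnegativity of \<open>F\<close> disposes of the last value, at
  \<open>Suc T\<close>.\<close>

theorem average_gradient_bound:
  assumes T: "1 \<le> T"
  shows "1 / real T * (\<Sum>t = 1..T. expectation (\<lambda>\<omega>. (norm (gradient F (mean_\<Theta> t \<omega>)))\<^sup>2))
    \<le> 2 * H / (\<eta> * real T) + 2 * \<Lambda>\<^sup>2 * \<gamma> * \<eta>\<^sup>2 * s + 2 * \<beta>\<^sup>2 + 2 * L * \<eta> * (s / real K)"
proof -
  define a where "a t = expectation (\<lambda>\<omega>. F (mean_\<Theta> t \<omega>))" for t
  define b where "b t = expectation (\<lambda>\<omega>. (norm (gradient F (mean_\<Theta> t \<omega>)))\<^sup>2)" for t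
  define c where "c = \<eta> * (\<Lambda>\<^sup>2 * \<gamma> * \<eta>\<^sup>2 * s + \<beta>\<^sup>2) + L * \<eta>\<^sup>2 * (s / real K)"
  have "\<eta> / 2 * (\<Sum>t = 1..T. b t) = (\<Sum>t = 1..T. \<eta> / 2 * b t)"
    by (rule sum_distrib_left)
  also have "\<dots> \<le> (\<Sum>t = 1..T. (a t - a (Suc t)) + c)"
  proof (rule sum_mono)
    fix t
    show "\<eta> / 2 * b t \<le> a t - a (Suc t) + c"
      using descent_expectation[of t] unfolding a_def b_def c_def by linarith
  qed
  also have "\<dots> = a 1 - a (Suc T) + real T * c"
    by (induction T) (simp_all add: algebra_simps)
  also have "\<dots> \<le> H + real T * c"
  proof -
    have "a 1 \<le> expectation (\<lambda>_. H)"
      unfolding a_def using F_bound by (intro integral_mono integrable_F) auto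
    moreover have "0 \<le> a (Suc T)"
      unfolding a_def using F_nonneg by (intro integral_nonneg_AE AE_I2)
    ultimately show ?thesis
      by (simp add: prob_space)
  qed
  finally have "2 / (\<eta> * real T) * (\<eta> / 2 * (\<Sum>t = 1..T. b t)) \<le> 2 / (\<eta> * real T) * (H + real T * c)"
    using \<eta> by (intro mult_left_mono) auto
  moreover have "2 / (\<eta> * real T) * (\<eta> / 2 * (\<Sum>t = 1..T. b t)) = 1 / real T * (\<Sum>t = 1..T. b t)"
    using \<eta> by simp
  moreover have "2 / (\<eta> * real T) * (H + real T * c)
      = 2 * H / (\<eta> * real T) + 2 * \<Lambda>\<^sup>2 * \<gamma> * \<eta>\<^sup>2 * s + 2 * \<beta>\<^sup>2 + 2 * L * \<eta> * (s / real K)"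
  proof -
    have "2 / (\<eta> * real T) * (H + real T * c) = 2 * H / (\<eta> * real T) + 2 * (c / \<eta>)"
      using T \<eta> by (simp add: distrib_left)
    moreover have "c / \<eta> = \<Lambda>\<^sup>2 * \<gamma> * \<eta>\<^sup>2 * s + \<beta>\<^sup>2 + L * \<eta> * (s / real K)"
      using \<eta> by (simp add: c_def add_divide_distrib power2_eq_square)
    ultimately show ?thesis
      by simp
  qed
  ultimately show ?thesis
    unfolding b_def by (simp only:)
qed

end

section \<open>The DR-DSGD estimator\<close>

text \<open>The tangent bound for \<open>exp (y - x)\<close> gives
  \<open>exp x - exp y \<le> exp x * (x - y)\<close>. Bounds from above on the two points suffice,
  because \<open>exp\<close> flattens to the left.\<close>

lemma exp_diff_le:
  fixes a b c :: real
  assumes "a \<le> c" "b \<le> c"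
  shows "\<bar>exp a - exp b\<bar> \<le> exp c * \<bar>a - b\<bar>"
proof -
  have *: "exp x - exp y \<le> exp c * \<bar>x - y\<bar>" if "x \<le> c" for x y :: real
  proof -
    have "exp x - exp y = exp x * (1 - exp (y - x))"
      by (simp add: right_diff_distrib exp_diff)
    also have "\<dots> \<le> exp x * (x - y)"
      using exp_ge_add_one_self[of "y - x"] by (intro mult_left_mono) (linarith, simp)
    also have "\<dots> \<le> exp x * \<bar>x - y\<bar>"
      by (intro mult_left_mono) auto
    also have "\<dots> \<le> exp c * \<bar>x - y\<bar>"
      using that by (intro mult_right_mono) auto
    finally show ?thesis .
  qed
  from *[OF assms(1), of b] *[OF assms(2), of a] show ?thesis
    by (simp add: abs_le_iff abs_minus_commute)
qed

text \<open>The bound depends on \<open>a\<close> and \<open>l\<close> only, so that one constant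
  serves all losses, distributions, numbers of devices and \<open>\<mu>\<close> at once.\<close>

lemma bounded_if_exp_le_affine:
  fixes a l :: real
  obtains b where "\<And>y. exp y \<le> a + l * \<bar>y\<bar> \<Longrightarrow> y \<le> b"
proof
  fix y :: real assume y: "exp y \<le> a + l * \<bar>y\<bar>"
  \<comment> \<open>Beyond this value \<open>y\<^sup>2 / 2\<close> exceeds
    \<open>(\<bar>a\<bar> + \<bar>l\<bar> + 1) * y\<close>, so the quadratic Taylor bound of
    \<open>exp\<close> already beats the affine function.\<close>
  show "y \<le> 2 * (\<bar>a\<bar> + \<bar>l\<bar>) + 2"
  proof (rule ccontr)
    assume "\<not> ?thesis"
    then have large: "2 * (\<bar>a\<bar> + \<bar>l\<bar>) + 2 < y" by simp
    then have "0 \<le> y" "1 \<le> y" by auto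
    have "(\<bar>a\<bar> + \<bar>l\<bar> + 1) * y \<le> y / 2 * y"
      using large \<open>0 \<le> y\<close> by (intro mult_right_mono) auto
    moreover have "\<bar>a\<bar> * 1 \<le> \<bar>a\<bar> * y"
      using \<open>1 \<le> y\<close> by (intro mult_left_mono) auto
    moreover have "l * y \<le> \<bar>l\<bar> * y"
      using \<open>0 \<le> y\<close> by (intro mult_right_mono) auto
    moreover have "1 + y + y\<^sup>2 / 2 \<le> exp y"
      using \<open>0 \<le> y\<close> by (rule exp_lower_Taylor_quadratic)
    moreover have "exp y \<le> a + l * y"
      using y \<open>0 \<le> y\<close> by simp
    ultimately show False
      using \<open>1 \<le> y\<close> abs_ge_self[of a] unfolding power2_eq_square distrib_right by linarith
  qed
qed

text \<open>Otherwise the mean of the absolute value would be at least \<open>c + 1\<close>. The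
  slack of 1 spares a strict inequality between integrals.\<close>

lemma (in prob_space) ex_abs_le_if_expectation_le:
  assumes "expectation_le M (\<lambda>x. \<bar>X x\<bar>) c"
  shows "\<exists>x\<in>space M. \<bar>X x\<bar> \<le> c + 1"
proof (rule ccontr)
  assume "\<not> ?thesis"
  then have "c + 1 \<le> \<bar>X x\<bar>" if "x \<in> space M" for x
    using that by force
  then have "expectation (\<lambda>_. c + 1) \<le> expectation (\<lambda>x. \<bar>X x\<bar>)"
    using assms by (intro integral_mono) (auto simp: expectation_le_def)
  then show False
    using assms by (simp add: prob_space expectation_le_def)
qed

lemma GDERIV_sum:
  assumes "\<And>i. i \<in> I \<Longrightarrow> GDERIV (f i) x :> D i"
  shows "GDERIV (\<lambda>x. \<Sum>i\<in>I. f i x) x :> (\<Sum>i\<in>I. D i)"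
  using assms unfolding gderiv_def inner_sum_right by (rule has_derivative_sum)

lemma GDERIV_cmult:
  assumes "GDERIV f x :> D"
  shows "GDERIV (\<lambda>x. c * f x) x :> c *\<^sub>R D"
  using assms unfolding gderiv_def inner_scaleR_right by (rule has_derivative_mult_right)

lemma GDERIV_imp_differentiable: "GDERIV f x :> D \<Longrightarrow> f differentiable at x"
  unfolding gderiv_def by (rule differentiableI)

lemma abs_diff_le_of_gradient_bound:
  fixes f :: "'a::euclidean_space \<Rightarrow> real"
  assumes "\<And>x. f differentiable at x" "\<And>x. norm (gradient f x) \<le> c"
  shows "\<bar>f x - f y\<bar> \<le> c * norm (x - y)"
proof -
  have "norm (f x - f y) \<le> c * norm (x - y)"
  proof (rule differentiable_bound[OF convex_UNIV])
    fix w :: 'a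
    show "(f has_derivative (\<lambda>h. h \<bullet> gradient f w)) (at w within UNIV)"
      using differentiable_imp_GDERIV[OF assms(1)] by (simp add: gderiv_def)
    show "onorm (\<lambda>h. h \<bullet> gradient f w) \<le> c"
    proof (rule onorm_le)
      fix h
      have "norm (h \<bullet> gradient f w) \<le> norm h * norm (gradient f w)"
        by (simp add: Cauchy_Schwarz_ineq2)
      also have "\<dots> \<le> norm h * c"
        by (intro mult_left_mono assms) simp
      finally show "norm (h \<bullet> gradient f w) \<le> c * norm h"
        by (simp add: mult.commute)
    qed
  qed auto
  then show ?thesis by simp
qed

section \<open>The estimator, its target and the standing bounds\<close>

definition minibatch_loss :: "('a \<Rightarrow> 'b \<Rightarrow> real) \<Rightarrow> nat \<Rightarrow> 'a \<Rightarrow> (nat \<Rightarrow> 'b) \<Rightarrow> real" where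
  "minibatch_loss loss B \<theta> x = 1 / real B * (\<Sum>j\<in>{1..B}. loss \<theta> (x j))"

text \<open>The step direction with \<open>\<eta>\<close> left out. The weight belongs to the answer
  of the device, which makes DR-DSGD an instance of decentralized SGD.\<close>

definition estimator :: "('a::real_inner \<Rightarrow> 'b \<Rightarrow> real) \<Rightarrow> nat \<Rightarrow> real \<Rightarrow> 'a \<Rightarrow> (nat \<Rightarrow> 'b) \<Rightarrow> 'a" where
  "estimator loss B \<mu> \<theta> x = (minibatch_exp loss B \<mu> \<theta> x / \<mu>) *\<^sub>R minibatch_grad loss B \<theta> x"

text \<open>By the chain rule, the gradient of \<open>exp (f_i / \<mu>)\<close>, the contribution of
  device \<open>i\<close> to the objective.\<close>

definition target :: "('a::real_inner \<Rightarrow> 'b \<Rightarrow> real) \<Rightarrow> (nat \<Rightarrow> 'b measure) \<Rightarrow> real \<Rightarrow> nat \<Rightarrow> 'a \<Rightarrow> 'a" where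
  "target loss D \<mu> i \<theta> = (exp (local_risk loss D i \<theta> / \<mu>) / \<mu>) *\<^sub>R gradient (local_risk loss D i) \<theta>"

lemma minibatch_exp_eq: "minibatch_exp loss B \<mu> \<theta> x = exp (minibatch_loss loss B \<theta> x / \<mu>)"
  by (simp add: minibatch_exp_def minibatch_loss_def)

text \<open>\<open>dr_dsgd\<close> hands over an unrestricted function of the sample index, whereas
  a point of \<open>minibatch_law\<close> is extensional on \<open>{1..B}\<close>; the estimator
  does not see the difference.\<close>

lemma estimator_restrict: "estimator loss B \<mu> \<theta> (restrict x {1..B}) = estimator loss B \<mu> \<theta> x"
proof -
  have "(\<Sum>j\<in>{1..B}. loss \<theta> (restrict x {1..B} j)) = (\<Sum>j\<in>{1..B}. loss \<theta> (x j))"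
    by (intro sum.cong) auto
  moreover have "(\<Sum>j\<in>{1..B}. gradient (\<lambda>\<theta>. loss \<theta> (restrict x {1..B} j)) \<theta>)
      = (\<Sum>j\<in>{1..B}. gradient (\<lambda>\<theta>. loss \<theta> (x j)) \<theta>)"
    by (intro sum.cong) auto
  ultimately show ?thesis
    unfolding estimator_def minibatch_exp_def minibatch_grad_def by (simp only:)
qed

text \<open>\<open>Y\<close> bounds the scaled losses from above at every sample and dominates
  \<open>M\<close>, hence also the scaled risks. An upper bound is enough, since the losses enter
  through exponentials.\<close>

locale dr_dsgd_model =
  fixes loss :: "'a::euclidean_space \<Rightarrow> 'b \<Rightarrow> real" and D :: "nat \<Rightarrow> 'b measure" and K B :: nat
    and \<mu> L\<^sub>F L\<^sub>1 G\<^sub>1 \<sigma>\<^sub>1 \<sigma>\<^sub>2 M Y :: real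
  assumes model: "loss_model loss D K"
    and smooth: "smoothness_assm loss D K \<mu> B L\<^sub>F L\<^sub>1"
    and gradient_bounded: "gradient_bounded_assm loss D K G\<^sub>1"
    and variance: "variance_assm loss D K B \<sigma>\<^sub>1 \<sigma>\<^sub>2"
    and function_bounded: "function_bounded_assm loss D K \<mu> M"
    and \<mu>: "1 \<le> \<mu>" and K: "1 \<le> K" and B: "1 \<le> B"
    and MY: "M \<le> Y" and range: "\<And>y. y \<in> scaled_loss_range loss D K \<mu> \<Longrightarrow> y \<le> Y"
begin

lemma prob_D: "i \<in> {1..K} \<Longrightarrow> prob_space (D i)"
  using model by (simp add: loss_model_def)

lemma G\<^sub>1_nonneg: "0 \<le> G\<^sub>1"
  using gradient_bounded K norm_ge_zero[of "gradient (local_risk loss D 1) undefined"]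
  unfolding gradient_bounded_assm_def by (meson atLeastAtMost_iff order_refl order_trans)

context
  fixes i assumes i: "i \<in> {1..K}"
begin

interpretation Di: prob_space "D i"
  using i by (rule prob_D)

interpretation N: prob_space "minibatch_law D B i"
  using prob_D[OF i] by (rule prob_space_minibatch_law)

lemma integrable_loss: "integrable (D i) (loss \<theta>)"
  and differentiable_loss: "x \<in> space (D i) \<Longrightarrow> (\<lambda>\<theta>. loss \<theta> x) differentiable at \<theta>"
  and differentiable_risk: "local_risk loss D i differentiable at \<theta>"
  using model i by (auto simp: loss_model_def)

lemma gradient_risk_bound: "norm (gradient (local_risk loss D i) \<theta>) \<le> G\<^sub>1"
  using gradient_bounded i by (simp add: gradient_bounded_assm_def)

lemma risk_bound: "\<bar>local_risk loss D i \<theta>\<bar> \<le> M"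
proof -
  have "\<bar>local_risk loss D i \<theta>\<bar> \<le> (LINT x|D i. \<bar>loss \<theta> x\<bar>)"
    unfolding local_risk_def by (rule integral_abs_bound)
  also have "\<dots> \<le> M"
    using function_bounded i by (simp add: function_bounded_assm_def expectation_le_def)
  finally show ?thesis .
qed

lemma scaled_risk_le: "local_risk loss D i \<theta> / \<mu> \<le> Y"
proof -
  have "local_risk loss D i \<theta> / \<mu> \<le> \<bar>local_risk loss D i \<theta>\<bar> / \<mu>"
    using \<mu> by (intro divide_right_mono) auto
  also have "\<dots> \<le> \<bar>local_risk loss D i \<theta>\<bar> / 1"
    using \<mu> by (intro divide_left_mono) auto
  also have "\<dots> \<le> Y"
    using risk_bound[of \<theta>] MY by simp
  finally show ?thesis .
qed

lemma sample_in_space: "x \<in> space (minibatch_law D B i) \<Longrightarrow> j \<in> {1..B} \<Longrightarrow> x j \<in> space (D i)"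
  unfolding minibatch_law_def space_PiM by (rule PiE_mem)

lemma measurable_sample: "j \<in> {1..B} \<Longrightarrow> (\<lambda>x. x j) \<in> minibatch_law D B i \<rightarrow>\<^sub>M D i"
  unfolding minibatch_law_def by (rule measurable_component_singleton)

lemma sample_integral:
  fixes X :: "'b \<Rightarrow> real"
  assumes "integrable (D i) X" "j \<in> {1..B}"
  shows "integrable (minibatch_law D B i) (\<lambda>x. X (x j))"
    and "(LINT x|minibatch_law D B i. X (x j)) = (LINT x|D i. X x)"
proof -
  have distr: "distr (minibatch_law D B i) (D i) (\<lambda>x. x j) = D i"
    unfolding minibatch_law_def using assms(2) prob_D[OF i] by (intro distr_PiM_component) auto
  note X = borel_measurable_integrable[OF assms(1)]
  show "integrable (minibatch_law D B i) (\<lambda>x. X (x j))"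
    using assms(1) integrable_distr_eq[OF measurable_sample[OF assms(2)] X] unfolding distr by simp
  show "(LINT x|minibatch_law D B i. X (x j)) = (LINT x|D i. X x)"
    using integral_distr[OF measurable_sample[OF assms(2)] X] unfolding distr by simp
qed

lemma integrable_minibatch_loss: "integrable (minibatch_law D B i) (minibatch_loss loss B \<theta>)"
  unfolding minibatch_loss_def[abs_def]
  by (intro integrable_mult_right Bochner_Integration.integrable_sum sample_integral(1) integrable_loss)

lemma integral_minibatch_loss:
  "(LINT x|minibatch_law D B i. minibatch_loss loss B \<theta> x) = local_risk loss D i \<theta>"
proof -
  have "(LINT x|minibatch_law D B i. (\<Sum>j\<in>{1..B}. loss \<theta> (x j)))
      = (\<Sum>j\<in>{1..B}. LINT x|minibatch_law D B i. loss \<theta> (x j))"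
    by (intro Bochner_Integration.integral_sum sample_integral(1) integrable_loss)
  also have "\<dots> = (\<Sum>j\<in>{1..B}. local_risk loss D i \<theta>)"
    unfolding local_risk_def by (intro sum.cong refl sample_integral(2) integrable_loss)
  finally show ?thesis
    unfolding minibatch_loss_def integral_mult_right_zero using B by simp
qed

section \<open>Measurability and unbiasedness of the mini-batch gradient\<close>

lemma minibatch_loss_gradient:
  assumes "x \<in> space (minibatch_law D B i)"
  shows "GDERIV (\<lambda>\<theta>. minibatch_loss loss B \<theta> x) \<theta> :> minibatch_grad loss B \<theta> x"
  unfolding minibatch_loss_def minibatch_grad_def
  by (intro GDERIV_cmult GDERIV_sum differentiable_imp_GDERIV differentiable_loss sample_in_space[OF assms])

lemma differentiable_minibatch_loss:
  "x \<in> space (minibatch_law D B i) \<Longrightarrow> (\<lambda>\<theta>. minibatch_loss loss B \<theta> x) differentiable at \<theta>"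
  by (rule GDERIV_imp_differentiable[OF minibatch_loss_gradient])

lemma gradient_minibatch_loss:
  "x \<in> space (minibatch_law D B i) \<Longrightarrow> gradient (\<lambda>\<theta>. minibatch_loss loss B \<theta> x) \<theta> = minibatch_grad loss B \<theta> x"
  by (rule gradient_eq[OF minibatch_loss_gradient])

lemma measurable_pair_minibatch_grad:
  "(\<lambda>(\<theta>, x). minibatch_grad loss B \<theta> x) \<in> borel_measurable (borel \<Otimes>\<^sub>M minibatch_law D B i)"
proof -
  have "(\<lambda>(\<theta>, x). gradient (\<lambda>\<theta>. minibatch_loss loss B \<theta> x) \<theta>) \<in> borel_measurable (borel \<Otimes>\<^sub>M minibatch_law D B i)"
    by (intro borel_measurable_pair_gradient differentiable_minibatch_loss
        borel_measurable_integrable[OF integrable_minibatch_loss])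
  then show ?thesis
    by (subst measurable_cong[where g="\<lambda>(\<theta>, x). gradient (\<lambda>\<theta>. minibatch_loss loss B \<theta> x) \<theta>"])
       (auto simp: space_pair_measure gradient_minibatch_loss)
qed

lemma measurable_pair_minibatch_loss:
  "(\<lambda>(\<theta>, x). minibatch_loss loss B \<theta> x) \<in> borel_measurable (borel \<Otimes>\<^sub>M minibatch_law D B i)"
  by (intro borel_measurable_pair_differentiable differentiable_minibatch_loss
      borel_measurable_integrable[OF integrable_minibatch_loss])

lemma measurable_minibatch_grad: "minibatch_grad loss B \<theta> \<in> borel_measurable (minibatch_law D B i)"
  using measurable_compose[OF measurable_Pair1' measurable_pair_minibatch_grad, of \<theta>] by simp

lemma measurable_pair_estimator:
  "(\<lambda>(\<theta>, x). estimator loss B \<mu> \<theta> x) \<in> borel_measurable (borel \<Otimes>\<^sub>M minibatch_law D B i)"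
  using measurable_pair_minibatch_grad measurable_pair_minibatch_loss
  unfolding estimator_def minibatch_exp_eq case_prod_beta' by measurable

lemma measurable_estimator: "estimator loss B \<mu> \<theta> \<in> borel_measurable (minibatch_law D B i)"
  using measurable_compose[OF measurable_Pair1' measurable_pair_estimator, of \<theta>] by simp

lemma gradient_variance:
  "expectation_le (minibatch_law D B i) (\<lambda>x. (norm (minibatch_grad loss B \<theta> x - gradient (local_risk loss D i) \<theta>))\<^sup>2) (\<sigma>\<^sub>2\<^sup>2)"
  using variance i by (simp add: variance_assm_def)

lemma minibatch_grad_square:
  "expectation_le (minibatch_law D B i) (\<lambda>x. (norm (minibatch_grad loss B \<theta> x))\<^sup>2) (2 * \<sigma>\<^sub>2\<^sup>2 + 2 * G\<^sub>1\<^sup>2)"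
proof (rule expectation_le_mono)
  let ?d = "\<lambda>x. minibatch_grad loss B \<theta> x - gradient (local_risk loss D i) \<theta>"
  show "expectation_le (minibatch_law D B i) (\<lambda>x. 2 * (norm (?d x))\<^sup>2 + 2 * G\<^sub>1\<^sup>2) (2 * \<sigma>\<^sub>2\<^sup>2 + 2 * G\<^sub>1\<^sup>2)"
    by (intro expectation_le_add expectation_le_cmult gradient_variance N.expectation_le_const) simp
  show "(\<lambda>x. (norm (minibatch_grad loss B \<theta> x))\<^sup>2) \<in> borel_measurable (minibatch_law D B i)"
    using measurable_minibatch_grad by measurable
  fix x
  have "(norm (minibatch_grad loss B \<theta> x))\<^sup>2 \<le> 2 * (norm (?d x))\<^sup>2 + 2 * (norm (gradient (local_risk loss D i) \<theta>))\<^sup>2"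
    using norm_add_square_le[of "?d x" "gradient (local_risk loss D i) \<theta>"] by simp
  also have "\<dots> \<le> 2 * (norm (?d x))\<^sup>2 + 2 * G\<^sub>1\<^sup>2"
    by (intro add_left_mono mult_left_mono power_mono gradient_risk_bound) auto
  finally show "\<bar>(norm (minibatch_grad loss B \<theta> x))\<^sup>2\<bar> \<le> 2 * (norm (?d x))\<^sup>2 + 2 * G\<^sub>1\<^sup>2"
    by simp
qed

lemma integrable_minibatch_grad: "integrable (minibatch_law D B i) (minibatch_grad loss B \<theta>)"
  using minibatch_grad_square[of \<theta>] N.integrable_of_square[OF measurable_minibatch_grad[of \<theta>]]
  by (simp add: expectation_le_def)

text \<open>Smoothness in the mean passes to the mean gradient by the norm bound for integrals. The
  absolute value makes the constant nonnegative without a separate argument on the sign of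
  \<open>L\<^sub>1\<close>.\<close>

lemma integral_minibatch_grad_lipschitz:
  "norm ((LINT x|minibatch_law D B i. minibatch_grad loss B \<theta> x) - (LINT x|minibatch_law D B i. minibatch_grad loss B \<theta>' x))
    \<le> \<bar>L\<^sub>1\<bar> * norm (\<theta> - \<theta>')"
proof -
  have "norm ((LINT x|minibatch_law D B i. minibatch_grad loss B \<theta> x) - (LINT x|minibatch_law D B i. minibatch_grad loss B \<theta>' x))
      = norm (LINT x|minibatch_law D B i. minibatch_grad loss B \<theta> x - minibatch_grad loss B \<theta>' x)"
    by (subst Bochner_Integration.integral_diff) (intro integrable_minibatch_grad refl)+
  also have "\<dots> \<le> (LINT x|minibatch_law D B i. norm (minibatch_grad loss B \<theta> x - minibatch_grad loss B \<theta>' x))"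
    by (rule integral_norm_bound)
  also have "\<dots> \<le> L\<^sub>1 * norm (\<theta> - \<theta>')"
    using smooth i by (simp add: smoothness_assm_def expectation_le_def)
  also have "\<dots> \<le> \<bar>L\<^sub>1\<bar> * norm (\<theta> - \<theta>')"
    by (intro mult_right_mono) auto
  finally show ?thesis .
qed

text \<open>Differentiation under the integral is applied to the mini-batch loss directly, because
  smoothness and variance of the gradients are assumed for the mini-batch. The second moment bounds
  the mean norm, and the Lipschitz bound on the mean gradient gives its continuity.\<close>

lemma minibatch_grad_unbiased:
  "(LINT x|minibatch_law D B i. minibatch_grad loss B \<theta> x) = gradient (local_risk loss D i) \<theta>"
proof -
  let ?N = "minibatch_law D B i" and ?l = "minibatch_loss loss B"
  have grad_cong: "(LINT x|?N. gradient (\<lambda>\<theta>. ?l \<theta> x) \<theta>) = (LINT x|?N. minibatch_grad loss B \<theta> x)" for \<theta>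
    by (intro Bochner_Integration.integral_cong refl gradient_minibatch_loss)
  have risk: "(\<lambda>\<theta>. LINT x|?N. ?l \<theta> x) = local_risk loss D i"
    using integral_minibatch_loss by (intro ext)
  have "gradient (\<lambda>\<theta>. LINT x|?N. ?l \<theta> x) \<theta> = (LINT x|?N. gradient (\<lambda>\<theta>. ?l \<theta> x) \<theta>)"
  proof (rule gradient_lebesgue_integral)
    show "sigma_finite_measure ?N" ..
    show "integrable ?N (?l \<theta>)" for \<theta>
      by (rule integrable_minibatch_loss)
    show "(\<lambda>\<theta>. ?l \<theta> x) differentiable at \<theta>" if "x \<in> space ?N" for \<theta> x
      using that by (rule differentiable_minibatch_loss)
    show "integrable ?N (\<lambda>x. gradient (\<lambda>\<theta>. ?l \<theta> x) \<theta>)" for \<theta>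
      using integrable_minibatch_grad[of \<theta>]
      by (subst Bochner_Integration.integrable_cong[OF refl gradient_minibatch_loss])
    show "(LINT x|?N. norm (gradient (\<lambda>\<theta>. ?l \<theta> x) \<theta>)) \<le> 1 + (2 * \<sigma>\<^sub>2\<^sup>2 + 2 * G\<^sub>1\<^sup>2)" for \<theta>
    proof -
      have "(LINT x|?N. norm (gradient (\<lambda>\<theta>. ?l \<theta> x) \<theta>)) = (LINT x|?N. norm (minibatch_grad loss B \<theta> x))"
        by (intro Bochner_Integration.integral_cong refl arg_cong[of _ _ norm] gradient_minibatch_loss)
      also have "\<dots> \<le> (LINT x|?N. 1 + (norm (minibatch_grad loss B \<theta> x))\<^sup>2)"
      proof (rule integral_mono)
        show "norm (minibatch_grad loss B \<theta> x) \<le> 1 + (norm (minibatch_grad loss B \<theta> x))\<^sup>2" for x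
        proof -
          have "0 \<le> (norm (minibatch_grad loss B \<theta> x) - 1)\<^sup>2" by simp
          then have "2 * norm (minibatch_grad loss B \<theta> x) \<le> (norm (minibatch_grad loss B \<theta> x))\<^sup>2 + 1"
            by (simp add: power2_diff)
          then show ?thesis
            using norm_ge_zero[of "minibatch_grad loss B \<theta> x"] by linarith
        qed
      qed (use integrable_minibatch_grad[of \<theta>] minibatch_grad_square[of \<theta>] in \<open>auto simp: expectation_le_def\<close>)
      also have "\<dots> \<le> 1 + (2 * \<sigma>\<^sub>2\<^sup>2 + 2 * G\<^sub>1\<^sup>2)"
        using minibatch_grad_square[of \<theta>] N.prob_space by (simp add: expectation_le_def)
      finally show ?thesis .
    qed
    show "continuous_on UNIV (\<lambda>\<theta>. LINT x|?N. gradient (\<lambda>\<theta>. ?l \<theta> x) \<theta>)"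
      unfolding grad_cong
      by (intro lipschitz_on_continuous_on[of "\<bar>L\<^sub>1\<bar>"] lipschitz_onI)
         (simp_all add: dist_norm integral_minibatch_grad_lipschitz)
    show "(\<lambda>\<theta>. LINT x|?N. ?l \<theta> x) differentiable at \<theta>"
      unfolding risk by (rule differentiable_risk)
  qed
  then show ?thesis
    unfolding grad_cong risk ..
qed

lemma risk_lipschitz: "\<bar>local_risk loss D i \<theta> - local_risk loss D i \<theta>'\<bar> \<le> G\<^sub>1 * norm (\<theta> - \<theta>')"
  by (intro abs_diff_le_of_gradient_bound differentiable_risk gradient_risk_bound)

lemma scaled_le:
  fixes a b c :: real
  assumes "a \<le> c" "0 \<le> c"
  shows "a / \<mu> \<le> c"
proof -
  have "a / \<mu> \<le> c / \<mu>"
    using assms \<mu> by (intro divide_right_mono) auto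
  also have "\<dots> \<le> c / 1"
    using assms \<mu> by (intro divide_left_mono) auto
  finally show ?thesis by simp
qed

lemma exp_scaled_diff_le:
  assumes "a / \<mu> \<le> Y" "b / \<mu> \<le> Y"
  shows "\<bar>exp (a / \<mu>) - exp (b / \<mu>)\<bar> \<le> exp Y * \<bar>a - b\<bar>"
proof -
  have "\<bar>exp (a / \<mu>) - exp (b / \<mu>)\<bar> \<le> exp Y * \<bar>a / \<mu> - b / \<mu>\<bar>"
    by (rule exp_diff_le[OF assms])
  also have "\<bar>a / \<mu> - b / \<mu>\<bar> = \<bar>a - b\<bar> / \<mu>"
    using \<mu> by (simp add: diff_divide_distrib[symmetric])
  also have "exp Y * (\<bar>a - b\<bar> / \<mu>) \<le> exp Y * \<bar>a - b\<bar>"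
    by (intro mult_left_mono scaled_le) auto
  finally show ?thesis .
qed

text \<open>The product of a bounded weight with Lipschitz constant \<open>exp Y * G\<^sub>1\<close>
  and a gradient bounded by \<open>G\<^sub>1\<close>. The gradient of the risk is Lipschitz since it
  is the mean of the mini-batch gradients. A bound for each device is needed because the local
  models differ.\<close>

lemma target_lipschitz:
  "norm (target loss D \<mu> i \<theta> - target loss D \<mu> i \<theta>') \<le> exp Y * (\<bar>L\<^sub>1\<bar> + G\<^sub>1\<^sup>2) * norm (\<theta> - \<theta>')"
proof -
  define p where "p \<theta> = exp (local_risk loss D i \<theta> / \<mu>)" for \<theta>
  define g where "g = gradient (local_risk loss D i)"
  have "target loss D \<mu> i \<theta> - target loss D \<mu> i \<theta>'
      = (p \<theta> / \<mu>) *\<^sub>R (g \<theta> - g \<theta>') + ((p \<theta> - p \<theta>') / \<mu>) *\<^sub>R g \<theta>'"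
    by (simp add: target_def p_def g_def algebra_simps diff_divide_distrib)
  also have "norm \<dots> \<le> norm ((p \<theta> / \<mu>) *\<^sub>R (g \<theta> - g \<theta>')) + norm (((p \<theta> - p \<theta>') / \<mu>) *\<^sub>R g \<theta>')"
    by (rule norm_triangle_ineq)
  also have "\<dots> = p \<theta> / \<mu> * norm (g \<theta> - g \<theta>') + \<bar>p \<theta> - p \<theta>'\<bar> / \<mu> * norm (g \<theta>')"
    using \<mu> by (simp add: p_def)
  also have "\<dots> \<le> exp Y * (\<bar>L\<^sub>1\<bar> * norm (\<theta> - \<theta>')) + exp Y * (G\<^sub>1 * norm (\<theta> - \<theta>')) * G\<^sub>1"
  proof (intro add_mono mult_mono)
    show "p \<theta> / \<mu> \<le> exp Y"
      unfolding p_def using scaled_risk_le[of \<theta>] by (intro scaled_le) auto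
    show "norm (g \<theta> - g \<theta>') \<le> \<bar>L\<^sub>1\<bar> * norm (\<theta> - \<theta>')"
      unfolding g_def minibatch_grad_unbiased[symmetric] by (rule integral_minibatch_grad_lipschitz)
    have "\<bar>p \<theta> - p \<theta>'\<bar> \<le> exp Y * \<bar>local_risk loss D i \<theta> - local_risk loss D i \<theta>'\<bar>"
      unfolding p_def by (intro exp_scaled_diff_le scaled_risk_le)
    also have "\<dots> \<le> exp Y * (G\<^sub>1 * norm (\<theta> - \<theta>'))"
      by (intro mult_left_mono risk_lipschitz) auto
    finally show "\<bar>p \<theta> - p \<theta>'\<bar> / \<mu> \<le> exp Y * (G\<^sub>1 * norm (\<theta> - \<theta>'))"
      using G\<^sub>1_nonneg by (intro scaled_le) auto
    show "norm (g \<theta>') \<le> G\<^sub>1"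
      unfolding g_def by (rule gradient_risk_bound)
  qed (use G\<^sub>1_nonneg in auto)
  finally show ?thesis
    by (simp add: algebra_simps power2_eq_square)
qed

lemma minibatch_loss_scaled_le:
  assumes "x \<in> space (minibatch_law D B i)"
  shows "minibatch_loss loss B \<theta> x / \<mu> \<le> Y"
proof -
  have "(\<Sum>j\<in>{1..B}. loss \<theta> (x j) / \<mu>) \<le> (\<Sum>j\<in>{1..B}. Y)"
  proof (rule sum_mono)
    fix j assume "j \<in> {1..B}"
    then have "x j \<in> space (D i)"
      by (rule sample_in_space[OF assms])
    then show "loss \<theta> (x j) / \<mu> \<le> Y"
      using i by (intro range) (auto simp: scaled_loss_range_def)
  qed
  then have "1 / real B * (\<Sum>j\<in>{1..B}. loss \<theta> (x j) / \<mu>) \<le> 1 / real B * (real B * Y)"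
    by (intro mult_left_mono) auto
  then show ?thesis
    using B by (simp add: minibatch_loss_def sum_divide_distrib mult.commute)
qed

text \<open>The weight is at most \<open>exp Y\<close> at every sample and not only in the mean, so
  it comes out of the second moment of the gradient.\<close>

lemma estimator_square:
  "expectation_le (minibatch_law D B i) (\<lambda>x. (norm (estimator loss B \<mu> \<theta> x))\<^sup>2) ((exp Y)\<^sup>2 * (2 * \<sigma>\<^sub>2\<^sup>2 + 2 * G\<^sub>1\<^sup>2))"
proof (rule expectation_le_mono)
  show "expectation_le (minibatch_law D B i) (\<lambda>x. (exp Y)\<^sup>2 * (norm (minibatch_grad loss B \<theta> x))\<^sup>2)
      ((exp Y)\<^sup>2 * (2 * \<sigma>\<^sub>2\<^sup>2 + 2 * G\<^sub>1\<^sup>2))"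
    by (intro expectation_le_cmult minibatch_grad_square) simp
  show "(\<lambda>x. (norm (estimator loss B \<mu> \<theta> x))\<^sup>2) \<in> borel_measurable (minibatch_law D B i)"
    using measurable_estimator by measurable
  fix x assume "x \<in> space (minibatch_law D B i)"
  then have "exp (minibatch_loss loss B \<theta> x / \<mu>) / \<mu> \<le> exp Y"
    using minibatch_loss_scaled_le[of x \<theta>] by (intro scaled_le) auto
  then have "(norm (estimator loss B \<mu> \<theta> x))\<^sup>2 \<le> (exp Y * norm (minibatch_grad loss B \<theta> x))\<^sup>2"
    using \<mu> unfolding estimator_def minibatch_exp_eq norm_scaleR by (intro power_mono mult_right_mono) auto
  then show "\<bar>(norm (estimator loss B \<mu> \<theta> x))\<^sup>2\<bar> \<le> (exp Y)\<^sup>2 * (norm (minibatch_grad loss B \<theta> x))\<^sup>2"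
    by (simp add: power_mult_distrib)
qed

lemma minibatch_loss_variance:
  "expectation_le (minibatch_law D B i) (\<lambda>x. (minibatch_loss loss B \<theta> x - local_risk loss D i \<theta>)\<^sup>2) (\<sigma>\<^sub>1\<^sup>2 / real B)"
  unfolding minibatch_loss_def minibatch_law_def
proof (rule variance_sample_mean[OF prob_D[OF i] integrable_loss B])
  show "expectation_le (D i) (\<lambda>x. (loss \<theta> x - local_risk loss D i \<theta>)\<^sup>2) (\<sigma>\<^sub>1\<^sup>2)"
    using variance i by (simp add: variance_assm_def)
qed (rule local_risk_def)

text \<open>The bias is the mean of \<open>(h - F\<^sub>i) g / \<mu>\<close>, since \<open>g\<close> is unbiased; it is of order \<open>1 / sqrt B\<close> because the
  mini-batch loss, unlike \<open>g\<close>, is assumed to have single-sample variance \<open>\<sigma>\<^sub>1\<^sup>2\<close>.\<close>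

lemma estimator_bias:
  "norm ((LINT x|minibatch_law D B i. estimator loss B \<mu> \<theta> x) - target loss D \<mu> i \<theta>)
    \<le> ((exp Y)\<^sup>2 * \<sigma>\<^sub>1\<^sup>2 + 2 * \<sigma>\<^sub>2\<^sup>2 + 2 * G\<^sub>1\<^sup>2) / 2 / sqrt (real B)"
proof -
  let ?N = "minibatch_law D B i" and ?g = "minibatch_grad loss B \<theta>"
  define p where "p = exp (local_risk loss D i \<theta> / \<mu>)"
  define e where "e x = minibatch_loss loss B \<theta> x - local_risk loss D i \<theta>" for x
  \<comment> \<open>The weight for splitting the product of loss error and gradient by Young's
    inequality: the squared loss error has mean of order \<open>1 / B\<close>, the squared gradient
    of order 1, and \<open>r = sqrt B\<close> balances both terms at
    \<open>1 / sqrt B\<close>.\<close>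
  define r where "r = sqrt (real B)"
  have r: "0 < r" "r * r = real B"
    using B by (simp_all add: r_def)
  have int_z: "integrable ?N (estimator loss B \<mu> \<theta>)"
    using estimator_square[of \<theta>] N.integrable_of_square[OF measurable_estimator[of \<theta>]]
    by (simp add: expectation_le_def)
  have int_pg: "integrable ?N (\<lambda>x. (p / \<mu>) *\<^sub>R ?g x)"
    by (intro integrable_scaleR_right integrable_minibatch_grad)
  have "(LINT x|?N. (p / \<mu>) *\<^sub>R ?g x) = target loss D \<mu> i \<theta>"
    unfolding integral_scaleR_right minibatch_grad_unbiased target_def p_def ..
  then have "(LINT x|?N. estimator loss B \<mu> \<theta> x) - target loss D \<mu> i \<theta>
      = (LINT x|?N. estimator loss B \<mu> \<theta> x - (p / \<mu>) *\<^sub>R ?g x)"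
    using int_z int_pg by simp
  then have "norm ((LINT x|?N. estimator loss B \<mu> \<theta> x) - target loss D \<mu> i \<theta>)
      \<le> (LINT x|?N. norm (estimator loss B \<mu> \<theta> x - (p / \<mu>) *\<^sub>R ?g x))"
    by simp
  also have "\<dots> \<le> r / 2 * ((exp Y)\<^sup>2 * (\<sigma>\<^sub>1\<^sup>2 / real B)) + 1 / (2 * r) * (2 * \<sigma>\<^sub>2\<^sup>2 + 2 * G\<^sub>1\<^sup>2)"
  proof -
    have "expectation_le ?N (\<lambda>x. norm (estimator loss B \<mu> \<theta> x - (p / \<mu>) *\<^sub>R ?g x))
        (r / 2 * ((exp Y)\<^sup>2 * (\<sigma>\<^sub>1\<^sup>2 / real B)) + 1 / (2 * r) * (2 * \<sigma>\<^sub>2\<^sup>2 + 2 * G\<^sub>1\<^sup>2))"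
    proof (rule expectation_le_mono)
      show "expectation_le ?N (\<lambda>x. r / 2 * ((exp Y)\<^sup>2 * (e x)\<^sup>2) + 1 / (2 * r) * (norm (?g x))\<^sup>2)
          (r / 2 * ((exp Y)\<^sup>2 * (\<sigma>\<^sub>1\<^sup>2 / real B)) + 1 / (2 * r) * (2 * \<sigma>\<^sub>2\<^sup>2 + 2 * G\<^sub>1\<^sup>2))"
        unfolding e_def using r
        by (intro expectation_le_add expectation_le_cmult minibatch_loss_variance minibatch_grad_square) auto
      show "(\<lambda>x. norm (estimator loss B \<mu> \<theta> x - (p / \<mu>) *\<^sub>R ?g x)) \<in> borel_measurable ?N"
        using measurable_estimator[of \<theta>] measurable_minibatch_grad[of \<theta>] by measurable
      fix x assume x: "x \<in> space ?N"
      have "estimator loss B \<mu> \<theta> x - (p / \<mu>) *\<^sub>R ?g x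
          = ((exp (minibatch_loss loss B \<theta> x / \<mu>) - p) / \<mu>) *\<^sub>R ?g x"
        unfolding estimator_def minibatch_exp_eq diff_divide_distrib scaleR_diff_left ..
      then have "norm (estimator loss B \<mu> \<theta> x - (p / \<mu>) *\<^sub>R ?g x)
          = \<bar>exp (minibatch_loss loss B \<theta> x / \<mu>) - p\<bar> / \<mu> * norm (?g x)"
        using \<mu> by simp
      also have "\<dots> \<le> (exp Y * \<bar>e x\<bar>) * norm (?g x)"
        unfolding p_def e_def
        by (intro mult_right_mono scaled_le exp_scaled_diff_le minibatch_loss_scaled_le x scaled_risk_le) auto
      also have "\<dots> \<le> r / 2 * (exp Y * \<bar>e x\<bar>)\<^sup>2 + 1 / (2 * r) * (norm (?g x))\<^sup>2"
      proof -
        have "0 \<le> (r * (exp Y * \<bar>e x\<bar>) - norm (?g x))\<^sup>2 / (2 * r)"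
          using r by simp
        also have "\<dots> = r / 2 * (exp Y * \<bar>e x\<bar>)\<^sup>2 + 1 / (2 * r) * (norm (?g x))\<^sup>2 - (exp Y * \<bar>e x\<bar>) * norm (?g x)"
          using r by (simp add: power2_eq_square field_simps)
        finally show ?thesis by simp
      qed
      finally show "\<bar>norm (estimator loss B \<mu> \<theta> x - (p / \<mu>) *\<^sub>R ?g x)\<bar>
          \<le> r / 2 * ((exp Y)\<^sup>2 * (e x)\<^sup>2) + 1 / (2 * r) * (norm (?g x))\<^sup>2"
        by (simp add: power_mult_distrib)
    qed
    then show ?thesis
      by (simp only: expectation_le_def)
  qed
  also have "\<dots> = ((exp Y)\<^sup>2 * \<sigma>\<^sub>1\<^sup>2 + 2 * \<sigma>\<^sub>2\<^sup>2 + 2 * G\<^sub>1\<^sup>2) / 2 / r"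
    unfolding r(2)[symmetric] using r(1) by (simp add: field_simps)
  finally show ?thesis
    unfolding r_def .
qed

end

section \<open>The robust objective and the reduction to decentralized SGD\<close>

lemma robust_obj_GDERIV:
  "GDERIV (robust_obj loss D K \<mu>) \<theta> :> (1 / real K) *\<^sub>R (\<Sum>i\<in>{1..K}. target loss D \<mu> i \<theta>)"
  unfolding robust_obj_def[abs_def]
proof (intro GDERIV_cmult GDERIV_sum)
  fix i assume i: "i \<in> {1..K}"
  have "((\<lambda>y. exp (y / \<mu>)) has_real_derivative exp (local_risk loss D i \<theta> / \<mu>) / \<mu>) (at (local_risk loss D i \<theta>))"
    using \<mu> by (auto intro!: derivative_eq_intros)
  then show "GDERIV (\<lambda>\<theta>. exp (local_risk loss D i \<theta> / \<mu>)) \<theta> :> target loss D \<mu> i \<theta>"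
    unfolding target_def by (rule GDERIV_DERIV_compose[OF differentiable_imp_GDERIV[OF differentiable_risk[OF i]]])
qed

lemma robust_obj_nonneg: "0 \<le> robust_obj loss D K \<mu> \<theta>"
  unfolding robust_obj_def by (intro mult_nonneg_nonneg sum_nonneg) auto

lemma robust_obj_le: "robust_obj loss D K \<mu> \<theta> \<le> exp Y"
proof -
  have "1 / real K * (\<Sum>i\<in>{1..K}. exp (local_risk loss D i \<theta> / \<mu>)) \<le> 1 / real K * (\<Sum>i\<in>{1..K}. exp Y)"
    by (intro mult_left_mono sum_mono) (auto intro: scaled_risk_le[simplified])
  then show ?thesis
    using K by (simp add: robust_obj_def)
qed

lemma target_bound:
  assumes "i \<in> {1..K}"
  shows "norm (target loss D \<mu> i \<theta>) \<le> exp Y * G\<^sub>1"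
proof -
  have "exp (local_risk loss D i \<theta> / \<mu>) / \<mu> \<le> exp Y"
    using scaled_risk_le[OF assms, of \<theta>] by (intro scaled_le[OF assms]) auto
  then show ?thesis
    using \<mu> unfolding target_def norm_scaleR by (intro mult_mono gradient_risk_bound assms) auto
qed

lemma gradient_robust_obj_bound: "norm (gradient (robust_obj loss D K \<mu>) \<theta>) \<le> exp Y * G\<^sub>1"
proof -
  have "norm (\<Sum>i\<in>{1..K}. target loss D \<mu> i \<theta>) \<le> (\<Sum>i\<in>{1..K}. exp Y * G\<^sub>1)"
    by (rule sum_norm_le) (rule target_bound)
  then show ?thesis
    unfolding gradient_eq[OF robust_obj_GDERIV] using K by (simp add: divide_le_eq mult.commute)
qed

lemma decentralized_sgd:
  assumes "iid_sampling P \<xi> D K B" "mixing_matrix K E W" "spectral_assm K W \<rho>"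
    and "0 \<le> L\<^sub>F" "0 < \<eta>" "L\<^sub>F * \<eta> \<le> 1 / 2"
  shows "decentralized_sgd P \<xi> D K B E W \<rho> \<eta> (\<lambda>_. estimator loss B \<mu>) (robust_obj loss D K \<mu>) (target loss D \<mu>)
    L\<^sub>F ((exp Y)\<^sup>2 * (2 * \<sigma>\<^sub>2\<^sup>2 + 2 * G\<^sub>1\<^sup>2))
    (((exp Y)\<^sup>2 * \<sigma>\<^sub>1\<^sup>2 + 2 * \<sigma>\<^sub>2\<^sup>2 + 2 * G\<^sub>1\<^sup>2) / 2 / sqrt (real B))
    (exp Y * (\<bar>L\<^sub>1\<bar> + G\<^sub>1\<^sup>2)) (exp Y) (exp Y * G\<^sub>1)"
proof (rule decentralized_sgd.intro)
  show "norm (gradient (robust_obj loss D K \<mu>) \<theta> - gradient (robust_obj loss D K \<mu>) \<theta>') \<le> L\<^sub>F * norm (\<theta> - \<theta>')" for \<theta> \<theta>'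
    using smooth by (simp add: smoothness_assm_def)
  show "robust_obj loss D K \<mu> differentiable at \<theta>" for \<theta>
    by (rule GDERIV_imp_differentiable[OF robust_obj_GDERIV])
  show "gradient (robust_obj loss D K \<mu>) \<theta> = (1 / real K) *\<^sub>R (\<Sum>i\<in>{1..K}. target loss D \<mu> i \<theta>)" for \<theta>
    by (rule gradient_eq[OF robust_obj_GDERIV])
qed (fact assms K B prob_D measurable_pair_estimator estimator_square estimator_bias target_lipschitz
    gradient_robust_obj_bound robust_obj_nonneg robust_obj_le)+

end

context decentralized_sgd
begin

lemma dr_dsgd_eq_\<Theta>:
  assumes "z = (\<lambda>_. estimator loss B \<mu>)"
  shows "dr_dsgd loss K W \<mu> \<eta> B \<theta>\<^sub>0 (\<lambda>t i j. \<xi> t i j \<omega>) t = (\<lambda>i. \<Theta> t i \<omega>)"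
proof (induction t)
  case 0
  show ?case by (simp add: \<Theta>_def)
next
  case (Suc t)
  have zj: "z j = estimator loss B \<mu>" for j
    using assms by (rule fun_cong)
  have "Z t j \<omega> = estimator loss B \<mu> (\<Theta> t j \<omega>) (\<lambda>k. \<xi> t j k \<omega>)" for j
    unfolding Z_def minibatch_def zj by (rule estimator_restrict)
  then show ?case
    by (simp add: Suc \<Theta>_Suc[abs_def] estimator_def)
qed

lemma dr_dsgd_mean_eq_mean_\<Theta>:
  assumes "z = (\<lambda>_. estimator loss B \<mu>)"
  shows "dr_dsgd_mean loss K W \<mu> \<eta> B \<theta>\<^sub>0 (\<lambda>t i j. \<xi> t i j \<omega>) t = mean_\<Theta> t \<omega>"
  by (simp add: dr_dsgd_mean_def mean_\<Theta>_def dr_dsgd_eq_\<Theta>[OF assms])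

end

section \<open>Convergence rate\<close>

lemma scaled_loss_range_le:
  assumes model: "loss_model loss D K" and bounded: "function_bounded_assm loss D K \<mu> M"
    and lip: "exp_lipschitz_const loss D K \<mu> L\<^sub>2" and K: "1 \<le> K" and \<mu>: "1 \<le> \<mu>"
    and b: "\<And>y. exp y \<le> (exp (M + 1) + \<bar>L\<^sub>2\<bar> * (M + 1)) + \<bar>L\<^sub>2\<bar> * \<bar>y\<bar> \<Longrightarrow> y \<le> b"
    and y: "y \<in> scaled_loss_range loss D K \<mu>"
  shows "y \<le> b"
proof -
  have 1: "1 \<in> {1..K}" using K by simp
  interpret D1: prob_space "D 1"
    using model 1 by (simp add: loss_model_def)
  \<comment> \<open>\<open>undefined\<close> stands for an arbitrary model, as the bound
    \<open>M\<close> on the mean holds at each of them. The sample found serves as the point from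
    which the Lipschitz bound is read.\<close>
  obtain x where x: "x \<in> space (D 1)" "\<bar>loss undefined x\<bar> \<le> M + 1"
    using D1.ex_abs_le_if_expectation_le[of "loss undefined" M] bounded 1
    by (auto simp: function_bounded_assm_def)
  define y\<^sub>0 where "y\<^sub>0 = loss undefined x / \<mu>"
  have "y\<^sub>0 \<in> scaled_loss_range loss D K \<mu>"
    using x(1) 1 unfolding y\<^sub>0_def scaled_loss_range_def by blast
  have "\<bar>y\<^sub>0\<bar> = \<bar>loss undefined x\<bar> / \<mu>"
    using \<mu> by (simp add: y\<^sub>0_def)
  also have "\<dots> \<le> \<bar>loss undefined x\<bar> / 1"
    using \<mu> by (intro divide_left_mono) auto
  finally have y\<^sub>0: "\<bar>y\<^sub>0\<bar> \<le> M + 1"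
    using x(2) by simp
  have "exp y - exp y\<^sub>0 \<le> \<bar>exp y - exp y\<^sub>0\<bar>"
    by simp
  also have "\<dots> \<le> L\<^sub>2 * \<bar>y - y\<^sub>0\<bar>"
    using lip y \<open>y\<^sub>0 \<in> _\<close> by (simp add: exp_lipschitz_const_def)
  also have "\<dots> \<le> \<bar>L\<^sub>2\<bar> * (\<bar>y\<bar> + (M + 1))"
    using y\<^sub>0 by (intro mult_mono) auto
  finally have "exp y \<le> exp y\<^sub>0 + \<bar>L\<^sub>2\<bar> * (\<bar>y\<bar> + (M + 1))"
    by simp
  also have "exp y\<^sub>0 \<le> exp (M + 1)"
    using y\<^sub>0 by simp
  finally show ?thesis
    by (intro b) (simp add: distrib_left)
qed

text \<open>With \<open>r = sqrt (T / K)\<close> the two rates are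
  \<open>a = r / T = 1 / (r * K)\<close> and \<open>b = 1 / r\<^sup>2\<close>. Since
  \<open>1 / \<eta> = 2 * L + r\<close> and \<open>\<eta> \<le> 1 / r\<close>, the four terms are of
  order \<open>1 / T + a\<close>, \<open>b\<close>, \<open>1 / B\<close> and \<open>a\<close>; here
  \<open>1 / T \<le> b\<close> because \<open>K \<ge> 1\<close>, and
  \<open>1 / B \<le> 2 * a\<close>.\<close>

lemma convergence_rate:
  fixes L l H q s c \<eta> :: real and K T B :: nat
  assumes K: "1 \<le> K" and T: "4 \<le> T" and L: "0 \<le> l" "l \<le> L"
    and nonneg: "0 \<le> H" "0 \<le> q" "0 \<le> s"
    and \<eta>: "\<eta> = 1 / (2 * L + sqrt (real T / real K))"
    and B: "\<bar>real B - sqrt (real K * real T)\<bar> < 1"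
  shows "2 * H / (\<eta> * real T) + 2 * q * \<eta>\<^sup>2 * s + 2 * (c / sqrt (real B))\<^sup>2 + 2 * l * \<eta> * (s / real K)
    \<le> (4 * H * L + 2 * H + 2 * q * s + 4 * c\<^sup>2 + 2 * L * s) * (1 / sqrt (real K * real T) + real K / real T)"
proof -
  define r where "r = sqrt (real T / real K)"
  define a where "a = 1 / sqrt (real K * real T)"
  define b where "b = real K / real T"
  have r: "0 < r" using K T by (simp add: r_def)
  have "r\<^sup>2 = real T / real K" by (simp add: r_def)
  have "r * sqrt (real K * real T) = real T"
    using K by (simp add: r_def real_sqrt_mult[symmetric])
  moreover have sqrt_pos: "0 < sqrt (real K * real T)"
    using K T by simp
  ultimately have a1: "a = r / real T"
    using r sqrt_pos unfolding a_def by (metis div_by_1 nonzero_divide_mult_cancel_left less_irrefl)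
  have b1: "b = 1 / r\<^sup>2"
    using \<open>r\<^sup>2 = _\<close> by (simp add: b_def)
  have a2: "a = 1 / (r * real K)"
    using \<open>r\<^sup>2 = _\<close> K T r unfolding a1 by (simp add: field_simps power2_eq_square)
  have ab: "0 \<le> a" "0 \<le> b" by (simp_all add: a_def b_def)
  have \<eta>_pos: "0 < \<eta>" and \<eta>_le: "\<eta> \<le> 1 / r"
    using L r unfolding \<eta> r_def[symmetric] by (auto intro!: divide_left_mono)
  have "2 * H / (\<eta> * real T) = 4 * H * L * (1 / real T) + 2 * H * a"
    using L r unfolding \<eta> a1 r_def[symmetric] by (simp add: add_divide_distrib distrib_left)
  also have "\<dots> \<le> 4 * H * L * (a + b) + 2 * H * (a + b)"
    using nonneg L K ab by (intro add_mono mult_left_mono) (auto simp: b_def divide_right_mono intro: add_increasing)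
  finally have 1: "2 * H / (\<eta> * real T) \<le> 4 * H * L * (a + b) + 2 * H * (a + b)" .
  have "\<eta>\<^sup>2 \<le> (1 / r)\<^sup>2"
    using \<eta>_pos \<eta>_le by (intro power_mono) auto
  then have "\<eta>\<^sup>2 \<le> a + b"
    using ab b1 by (simp add: power_divide)
  then have "2 * q * s * \<eta>\<^sup>2 \<le> 2 * q * s * (a + b)"
    using nonneg by (intro mult_left_mono) auto
  then have 2: "2 * q * \<eta>\<^sup>2 * s \<le> 2 * q * s * (a + b)"
    by (simp add: mult_ac)
  \<comment> \<open>\<open>T \<ge> 4\<close> makes the root at least 2, so that rounding, which
    moves \<open>B\<close> by less than 1, leaves at least half of it.\<close>
  have "sqrt 4 \<le> sqrt (real K * real T)"
    using K T mult_mono[of 1 "real K" 4 "real T"] by (intro real_sqrt_le_mono) auto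
  then have "sqrt (real K * real T) / 2 \<le> real B"
    using B by simp
  then have "1 / real B \<le> 1 / (sqrt (real K * real T) / 2)"
    using sqrt_pos by (intro divide_left_mono mult_pos_pos) linarith+
  also have "\<dots> = 2 * a"
    by (simp add: a_def)
  finally have "2 * c\<^sup>2 * (1 / real B) \<le> 2 * c\<^sup>2 * (2 * (a + b))"
    using ab by (intro mult_left_mono) auto
  then have 3: "2 * (c / sqrt (real B))\<^sup>2 \<le> 4 * c\<^sup>2 * (a + b)"
    by (simp add: power_divide algebra_simps)
  have "\<eta> / real K \<le> 1 / r / real K"
    using \<eta>_le by (intro divide_right_mono) auto
  then have "\<eta> / real K \<le> a + b"
    using ab a2 by simp
  then have "(2 * l * s) * (\<eta> / real K) \<le> (2 * L * s) * (a + b)"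
    using L nonneg \<eta>_pos by (intro mult_mono) auto
  then have 4: "2 * l * \<eta> * (s / real K) \<le> 2 * L * s * (a + b)"
    by (simp add: mult_ac)
  from 1 2 3 4 show ?thesis
    unfolding a_def[symmetric] b_def[symmetric] by (simp only: distrib_right)
qed

theorem corollary1:
  fixes L\<^sub>F L\<^sub>1 L\<^sub>2 G\<^sub>1 \<sigma>\<^sub>1 \<sigma>\<^sub>2 M \<rho> :: real
  shows "\<exists>C. \<forall>\<^sub>F T in sequentially.
    \<forall>K\<ge>1. \<forall>(loss :: real ^ 'd::finite \<Rightarrow> 'b \<Rightarrow> real) (D :: nat \<Rightarrow> 'b measure) E W \<mu> \<eta> B
      (P :: 'w measure) \<xi> \<theta>\<^sub>0.
      connected_graph K E \<and> mixing_matrix K E W \<and> loss_model loss D K \<and> iid_sampling P \<xi> D K B \<and>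
      smoothness_assm loss D K \<mu> B L\<^sub>F L\<^sub>1 \<and>
      gradient_bounded_assm loss D K G\<^sub>1 \<and>
      variance_assm loss D K B \<sigma>\<^sub>1 \<sigma>\<^sub>2 \<and>
      function_bounded_assm loss D K \<mu> M \<and>
      spectral_assm K W \<rho> \<and>
      exp_lipschitz_const loss D K \<mu> L\<^sub>2 \<and>
      1 \<le> \<mu> \<and>
      \<eta> = 1 / (2 * max L\<^sub>F (max L\<^sub>1 L\<^sub>2) + sqrt (real T / real K)) \<and>
      \<comment> \<open>\<open>B\<close> is the square root of \<open>K T\<close>, rounded to an integer if it is not one\<close>
      \<bar>real B - sqrt (real K * real T)\<bar> < 1
      \<longrightarrow> 1 / real T * (\<Sum>t = 1..T. LINT \<omega>|P.
             (norm (gradient (robust_obj loss D K \<mu>)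
                (dr_dsgd_mean loss K W \<mu> \<eta> B \<theta>\<^sub>0 (\<lambda>t i j. \<xi> t i j \<omega>) t)))\<^sup>2)
          \<le> C * (1 / sqrt (real K * real T) + real K / real T)"
proof -
  \<comment> \<open>Obtained before the loss, the distributions, \<open>K\<close> and
    \<open>\<mu>\<close> are fixed, so that \<open>C\<close> cannot depend on them. The affine
    function is the Lipschitz bound from a point of the scaled range of absolute value at most
    \<open>M + 1\<close>.\<close>
  obtain b where b: "\<And>y. exp y \<le> (exp (M + 1) + \<bar>L\<^sub>2\<bar> * (M + 1)) + \<bar>L\<^sub>2\<bar> * \<bar>y\<bar> \<Longrightarrow> y \<le> b"
    using bounded_if_exp_le_affine by blast
  define Y where "Y = max M b"
  define L where "L = max L\<^sub>F (max L\<^sub>1 L\<^sub>2)"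
  define s where "s = (exp Y)\<^sup>2 * (2 * \<sigma>\<^sub>2\<^sup>2 + 2 * G\<^sub>1\<^sup>2)"
  \<comment> \<open>The bias bound without its factor \<open>1 / sqrt B\<close>, so that
    \<open>B\<close> stays out of \<open>C\<close>.\<close>
  define c where "c = ((exp Y)\<^sup>2 * \<sigma>\<^sub>1\<^sup>2 + 2 * \<sigma>\<^sub>2\<^sup>2 + 2 * G\<^sub>1\<^sup>2) / 2"
  define \<Lambda> where "\<Lambda> = exp Y * (\<bar>L\<^sub>1\<bar> + G\<^sub>1\<^sup>2)"
  \<comment> \<open>This is \<open>\<Lambda>\<^sup>2 * \<gamma>\<close>, with
    \<open>\<gamma>\<close> spelled out because its locale is interpreted only after
    \<open>C\<close> has been chosen.\<close>
  define q where "q = \<Lambda>\<^sup>2 * (2 * (1 + 2 / (1 - \<rho>)) / (1 - \<rho>))"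
  define C where "C = 4 * exp Y * L + 2 * exp Y + 2 * q * s + 4 * c\<^sup>2 + 2 * L * s"
  show ?thesis
  proof (intro exI[of _ C] eventually_sequentiallyI[of 4] allI impI, elim conjE)
    fix T K :: nat and loss :: "real ^ 'd \<Rightarrow> 'b \<Rightarrow> real" and D :: "nat \<Rightarrow> 'b measure"
      and E W \<mu> \<eta> B and P :: "'w measure" and \<xi> \<theta>\<^sub>0
    assume T: "4 \<le> T" and K: "1 \<le> K" and mix: "mixing_matrix K E W" and model: "loss_model loss D K"
      and iid: "iid_sampling P \<xi> D K B" and smooth: "smoothness_assm loss D K \<mu> B L\<^sub>F L\<^sub>1"
      and grad: "gradient_bounded_assm loss D K G\<^sub>1" and var: "variance_assm loss D K B \<sigma>\<^sub>1 \<sigma>\<^sub>2"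
      and bounded: "function_bounded_assm loss D K \<mu> M" and spec: "spectral_assm K W \<rho>"
      and lip: "exp_lipschitz_const loss D K \<mu> L\<^sub>2" and \<mu>: "1 \<le> \<mu>"
      and \<eta>: "\<eta> = 1 / (2 * max L\<^sub>F (max L\<^sub>1 L\<^sub>2) + sqrt (real T / real K))"
      and B: "\<bar>real B - sqrt (real K * real T)\<bar> < 1"
    \<comment> \<open>The sign of \<open>L\<^sub>F\<close> follows from the Lipschitz bound at two
      distinct points; 0 and 1 differ in \<open>real ^ 'd\<close>.\<close>
    have "0 \<le> L\<^sub>F * norm (0 - 1 :: real ^ 'd)"
      using smooth unfolding smoothness_assm_def by (meson norm_ge_zero order_trans)
    then have LF: "0 \<le> L\<^sub>F"
      by (simp add: zero_le_mult_iff)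
    have L: "L\<^sub>F \<le> L" "0 \<le> L"
      using LF by (auto simp: L_def)
    have \<rho>: "\<rho> < 1"
      using spec by (simp add: spectral_assm_def)
    have sqrt_pos: "0 < sqrt (real T / real K)"
      using K T by simp
    have "0 < 2 * L + r" "L\<^sub>F \<le> 1 / 2 * (2 * L + r)" if "0 < r" for r
      using L that by (auto simp: distrib_left)
    note denominator = this[OF sqrt_pos]
    then have \<eta>_pos: "0 < \<eta>"
      unfolding \<eta> L_def[symmetric] by (intro divide_pos_pos) auto
    have "L\<^sub>F * \<eta> \<le> 1 / 2"
      using denominator(2) unfolding \<eta> L_def[symmetric]
      by (simp only: times_divide_eq_right mult_1_right pos_divide_le_eq[OF denominator(1)])
    have "sqrt 4 \<le> sqrt (real K * real T)"
      using K T mult_mono[of 1 "real K" 4 "real T"] by (intro real_sqrt_le_mono) auto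
    then have B1: "1 \<le> B"
      using B by simp
    have MY: "M \<le> Y"
      by (simp add: Y_def)
    have range_le: "y \<le> Y" if "y \<in> scaled_loss_range loss D K \<mu>" for y
      using scaled_loss_range_le[OF model bounded lip K \<mu> b that] by (simp add: Y_def)
    interpret M: dr_dsgd_model loss D K B \<mu> L\<^sub>F L\<^sub>1 G\<^sub>1 \<sigma>\<^sub>1 \<sigma>\<^sub>2 M Y
      by (rule dr_dsgd_model.intro) (fact model smooth grad var bounded \<mu> K B1 MY range_le)+
    interpret S: decentralized_sgd P \<xi> D K B E W \<rho> \<eta> "\<lambda>_. estimator loss B \<mu>" \<theta>\<^sub>0 "robust_obj loss D K \<mu>"
      "target loss D \<mu>" L\<^sub>F s "c / sqrt (real B)" \<Lambda> "exp Y" "exp Y * G\<^sub>1"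
      unfolding s_def c_def \<Lambda>_def
      by (rule M.decentralized_sgd[OF iid mix spec LF \<eta>_pos \<open>L\<^sub>F * \<eta> \<le> 1 / 2\<close>])
    have "1 / real T * (\<Sum>t = 1..T. LINT \<omega>|P. (norm (gradient (robust_obj loss D K \<mu>)
          (dr_dsgd_mean loss K W \<mu> \<eta> B \<theta>\<^sub>0 (\<lambda>t i j. \<xi> t i j \<omega>) t)))\<^sup>2)
        \<le> 2 * exp Y / (\<eta> * real T) + 2 * q * \<eta>\<^sup>2 * s + 2 * (c / sqrt (real B))\<^sup>2 + 2 * L\<^sub>F * \<eta> * (s / real K)"
      using S.average_gradient_bound[of T] T
      unfolding S.dr_dsgd_mean_eq_mean_\<Theta>[OF refl] q_def S.\<gamma>_def by (simp add: mult.assoc)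
    also have "\<dots> \<le> C * (1 / sqrt (real K * real T) + real K / real T)"
      unfolding C_def
    proof (rule convergence_rate[OF K T LF L(1) _ _ _ \<eta>[folded L_def] B])
      show "0 \<le> q" "0 \<le> s"
        using \<rho> by (simp_all add: q_def s_def)
    qed simp
    finally show "1 / real T * (\<Sum>t = 1..T. LINT \<omega>|P. (norm (gradient (robust_obj loss D K \<mu>)
          (dr_dsgd_mean loss K W \<mu> \<eta> B \<theta>\<^sub>0 (\<lambda>t i j. \<xi> t i j \<omega>) t)))\<^sup>2)
        \<le> C * (1 / sqrt (real K * real T) + real K / real T)" .
  qed
qed

end
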